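(* Let $n\ge 2$. There exists $\sigma_n>0$ depending only on $n$ with the following property. Let $\Omega\subset\mathbb{R}^n$ be a bounded domain with $0\in\partial\Omega$ satisfying the exterior ball condition $B_\rho(-\rho e_n)\subset\mathbb{R}^n\setminus\overline{\Omega}$ for some $\rho>0$, and let $D=\sup_{x\in\Omega}|x|$. If $\rho\ge D/\sigma_n$, then $$\int_\Omega|\nabla u|^2dx\ \ge\ \frac{n^2}{4}\int_\Omega\frac{u^2}{|x|^2}dx+\frac14\sum_{i=1}^\infty\int_\Omega\frac{u^2}{|x|^2}X_1^2\cdots X_i^2\,dx\qquad\text{for all }u\in C_c^\infty(\Omega),$$ where $X_i=X_i(|x|/(3\kappa D))$. If in addition $\Omega$ satisfies an interior ball condition at $0$, then the constants $1/4$ are sharp at each step, that is, $$\inf_{u\in C_c^\infty(\Omega),\,u\neq0}\frac{\int_\Omega|\nabla u|^2dx-\frac{n^2}{4}\int_\Omega\frac{u^2}{|x|^2}dx}{\int_\Omega\frac{u^2}{|x|^2}X_1^2dx}=\frac14,$$ and for each $m=2,3,\dots$ $$\inf_{u\in C_c^\infty(\Omega),\,u\neq0}\frac{\int_\Omega|\nabla u|^2dx-\frac{n^2}{4}\int_\Omega\frac{u^2}{|x|^2}dx-\frac14\sum_{i=1}^{m-1}\int_\Omega\frac{u^2}{|x|^2}X_1^2\cdots X_i^2dx}{\int_\Omega\frac{u^2}{|x|^2}X_1^2\cdots X_m^2dx}=\frac14.$$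
   Context: $B_r(x_0)$ is the open ball of radius $r$ centered at $x_0$; $e_n$ is the unit vector in the $x_n$ direction. Interior ball condition at $0$: there exists an open ball $B\subset\Omega$ with $0\in\partial B$. Iterated logarithms: $X_1(t)=\frac{1}{1-\ln t}$ and $X_{k+1}(t)=X_k(X_1(t))$ for $t\in(0,1]$, $k\ge1$. The series $\sum_{i\ge1}X_1(t)\cdots X_i(t)$ converges for $t\in(0,1)$ and is strictly increasing in $t$; $\kappa$ denotes the unique number $\kappa>1$ with $\sum_{i=1}^\infty X_1(1/\kappa)\cdots X_i(1/\kappa)=\frac14$. *)

theory Defs
  imports "HOL-Analysis.Analysis"
begin

(* Starting the recursion at the identity makes iter_log 1 t = 1 / (1 - ln t). *)
primrec iter_log :: "nat \<Rightarrow> real \<Rightarrow> real" where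
  "iter_log 0 t = t"
| "iter_log (Suc k) t = iter_log k (1 / (1 - ln t))"

definition log_prod :: "nat \<Rightarrow> real \<Rightarrow> real" where
  "log_prod i t = (\<Prod>j = 1..i. iter_log j t)"

definition kappa :: real where
  "kappa = (THE k. k > 1 \<and> (\<lambda>i. log_prod (Suc i) (1 / k)) sums (1 / 4))"

fun C_k :: "nat \<Rightarrow> (real ^ 'n::finite \<Rightarrow> real) \<Rightarrow> bool" where
  "C_k 0 f \<longleftrightarrow> continuous_on UNIV f"
| "C_k (Suc k) f \<longleftrightarrow> f differentiable_on UNIV \<and>
     (\<forall>i. C_k k (\<lambda>x. frechet_derivative f (at x) (axis i 1)))"

(* Functions on the open set are represented by their extension by zero. *)
definition test_functions :: "(real ^ 'n::finite) set \<Rightarrow> (real ^ 'n \<Rightarrow> real) set" where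
  "test_functions \<Omega> = {u. (\<forall>k. C_k k u) \<and>
     compact (closure {x. u x \<noteq> 0}) \<and> closure {x. u x \<noteq> 0} \<subseteq> \<Omega>}"

definition gradient :: "(real ^ 'n::finite \<Rightarrow> real) \<Rightarrow> real ^ 'n \<Rightarrow> real ^ 'n" where
  "gradient u x = (\<chi> i. frechet_derivative u (at x) (axis i 1))"

definition dirichlet_energy :: "(real ^ 'n::finite) set \<Rightarrow> (real ^ 'n \<Rightarrow> real) \<Rightarrow> real" where
  "dirichlet_energy \<Omega> u = (LINT x:\<Omega>|lborel. (norm (gradient u x))\<^sup>2)"

definition hardy_term :: "(real ^ 'n::finite) set \<Rightarrow> real \<Rightarrow> nat \<Rightarrow> (real ^ 'n \<Rightarrow> real) \<Rightarrow> real" where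
  "hardy_term \<Omega> D i u = (LINT x:\<Omega>|lborel.
     (u x)\<^sup>2 / (norm x)\<^sup>2 * (log_prod i (norm x / (3 * kappa * D)))\<^sup>2)"

definition interior_ball_at_0 :: "(real ^ 'n::finite) set \<Rightarrow> bool" where
  "interior_ball_at_0 \<Omega> \<longleftrightarrow> (\<exists>c r. r > 0 \<and> ball c r \<subseteq> \<Omega> \<and> 0 \<in> frontier (ball c r))"

end

theory Submission
  imports Defs "HOL-Real_Asymp.Real_Asymp"
begin

text \<open>
  Lower bound. For every positive function \<open>\<phi>\<close> one has \<open>\<integral>|\<nabla>u|\<^sup>2 \<ge> \<integral>(- \<Delta>\<phi> / \<phi>) u\<^sup>2\<close>. On the half space the function
  \<open>x\<^sub>n \<cdot> |x| powr (- n/2)\<close> gives the weight \<open>n\<^sup>2 / (4 |x|\<^sup>2)\<close>, and an extra factor \<open>(X\<^sub>1 \<cdots> X\<^sub>m) powr (- 1/2)\<close> adds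
  \<open>1/4 (\<Sum>i\<le>m. X\<^sub>1\<^sup>2 \<cdots> X\<^sub>i\<^sup>2) / |x|\<^sup>2\<close>, because in the variable \<open>\<tau> = - ln t\<close> the product \<open>X\<^sub>1 \<cdots> X\<^sub>i\<close> is the derivative of
  \<open>- ln X\<^sub>i\<close>. A domain with an exterior ball need not lie in the half space. There \<open>x\<^sub>n\<close> is
  replaced by \<open>q exp (- c q)\<close> with \<open>q = |x|\<^sup>2 + 2 \<rho> x\<^sub>n\<close>, which is positive outside the ball; the exponential
  makes it superharmonic enough to compensate \<open>\<Delta>q > 0\<close> near the sphere. The error is of relative order
  \<open>|x| / \<rho>\<close>. One more factor \<open>exp (- |x| / (2 D))\<close> gains a multiple of \<open>|x| / D\<close>, provided that \<open>\<Sum>i. X\<^sub>1 \<cdots> X\<^sub>i\<close> is at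
  most \<open>1/4\<close>, which is what \<open>\<kappa>\<close> is for. So the error is absorbed if \<open>D / \<rho>\<close> is below a constant that depends on
  \<open>n\<close> only. This is \<open>improved_hardy_finite\<close>, from \<open>hardy_from_vector_field\<close> and \<open>hardy_field_algebra\<close>, where
  \<open>\<nabla>\<phi> / \<phi>\<close> is used directly as a vector field. It holds for every \<open>m\<close> with the same
  constants; bounded partial sums give the series.

  Sharpness. The interior ball is tangent to the exterior one, hence contains the part near the origin
  of every cone \<open>x\<^sub>n \<ge> \<delta> |x|\<close>, up to a distance proportional to \<open>\<delta>\<close>. The competitors are products
  of \<open>|x| powr (1 - n/2)\<close>, an angular function that is a smooth version of the positive part of
  \<open>x\<^sub>n / |x| - \<delta>\<close>, and a radial profile. The angular factor misses the eigenvalue \<open>n - 1\<close> of the half sphere by a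
  multiple of \<open>\<delta>\<close> (\<open>polar_integral_cap_defect\<close>). The profile is \<open>(X\<^sub>1 \<cdots> X\<^sub>m) powr (- 1/2)\<close> times a wide bump
  in the variable \<open>- ln X\<^sub>m\<close> and turns the quotient into \<open>1/4\<close> plus the inverse square of the width
  (\<open>ex_hardy_profile\<close>). For a fixed width the bump is moved towards the origin. The radial support then lies below a radius
  so small that the loss from \<open>\<delta>\<close>, which is proportional to that radius, beats the growth of all
  logarithmic factors on the support (\<open>exp_tower_negligible\<close>). The result is \<open>ex_near_optimal\<close>.

  Both parts rest on one form of the divergence theorem, \<open>divergence_scaled_translate_eq_0\<close> and the
  directional version before it, which follows from the invariance of Lebesgue measure under translations.
\<close>

section \<open>Differentiable functions on open sets\<close>

text \<open>
  The notion for functions on the whole space is localised here to open sets and extended to all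
  Euclidean spaces, in particular to functions of one real variable, so that the composition
  rule can be stated for one class. The derivatives are carried as witnesses, which makes the closure
  rules inductions on the order.
\<close>
primrec Ck_on :: "nat \<Rightarrow> 'a::euclidean_space set \<Rightarrow> ('a \<Rightarrow> real) \<Rightarrow> bool" where
  "Ck_on 0 U f \<longleftrightarrow> continuous_on U f"
| "Ck_on (Suc k) U f \<longleftrightarrow>
     (\<exists>f'. (\<forall>x\<in>U. (f has_derivative (\<lambda>h. \<Sum>b\<in>Basis. (h \<bullet> b) * f' b x)) (at x)) \<and>
           (\<forall>b\<in>Basis. Ck_on k U (f' b)))"

lemma Ck_on_SucE:
  assumes "Ck_on (Suc k) U f"
  obtains f' where "\<And>x. x \<in> U \<Longrightarrow> (f has_derivative (\<lambda>h. \<Sum>b\<in>Basis. (h \<bullet> b) * f' b x)) (at x)"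
    "\<And>b. b \<in> Basis \<Longrightarrow> Ck_on k U (f' b)"
  using assms by auto

lemma Ck_on_Suc_imp_continuous: "Ck_on (Suc k) U f \<Longrightarrow> continuous_on U f"
proof (elim Ck_on_SucE)
  fix f' assume "\<And>x. x \<in> U \<Longrightarrow> (f has_derivative (\<lambda>h. \<Sum>b\<in>Basis. (h \<bullet> b) * f' b x)) (at x)"
  then have "\<forall>x\<in>U. isCont f x" using has_derivative_continuous by blast
  then show "continuous_on U f" by (rule continuous_at_imp_continuous_on)
qed

lemma Ck_on_imp_continuous: "Ck_on k U f \<Longrightarrow> continuous_on U f"
proof (cases k)
  case (Suc j)
  assume "Ck_on k U f"
  then show ?thesis unfolding Suc by (rule Ck_on_Suc_imp_continuous)
qed simp

lemma Ck_on_pred: "Ck_on (Suc k) U f \<Longrightarrow> Ck_on k U f"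
proof (induction k arbitrary: f)
  case 0
  then show ?case unfolding Ck_on.simps(1) by (rule Ck_on_Suc_imp_continuous)
next
  case (Suc k)
  obtain f' where f: "\<And>x. x \<in> U \<Longrightarrow> (f has_derivative (\<lambda>h. \<Sum>b\<in>Basis. (h \<bullet> b) * f' b x)) (at x)"
    "\<And>b. b \<in> Basis \<Longrightarrow> Ck_on (Suc k) U (f' b)" using Suc.prems by (rule Ck_on_SucE) blast
  show ?case
    by (subst Ck_on.simps(2)) (use f Suc.IH in blast)
qed

lemma Ck_on_subset: "Ck_on k U f \<Longrightarrow> V \<subseteq> U \<Longrightarrow> Ck_on k V f"
proof (induction k arbitrary: f)
  case (Suc k)
  then show ?case by simp (meson subsetD)
qed (auto intro: continuous_on_subset)

lemma Ck_on_cong: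
  assumes "open U" "\<And>x. x \<in> U \<Longrightarrow> f x = g x" "Ck_on k U f"
  shows "Ck_on k U g"
proof (cases k)
  case 0
  then show ?thesis using assms by (simp cong: continuous_on_cong)
next
  case (Suc j)
  then obtain f' where f': "\<And>x. x \<in> U \<Longrightarrow> (f has_derivative (\<lambda>h. \<Sum>b\<in>Basis. (h \<bullet> b) * f' b x)) (at x)"
    and C: "\<forall>b\<in>Basis. Ck_on j U (f' b)" using assms(3) by auto
  have "(g has_derivative (\<lambda>h. \<Sum>b\<in>Basis. (h \<bullet> b) * f' b x)) (at x)" if "x \<in> U" for x
    using has_derivative_transform_within_open[OF f'[OF that] assms(1) that] assms(2) by auto
  then show ?thesis using C Suc by auto
qed

lemma Ck_on_const: "Ck_on k U (\<lambda>x. c)"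
proof (induction k arbitrary: c)
  case (Suc k)
  have "\<forall>x\<in>U. ((\<lambda>x. c) has_derivative (\<lambda>h. \<Sum>b\<in>Basis. (h \<bullet> b) * (\<lambda>b x. 0) b x)) (at x)"
    by auto
  then show ?case using Suc[of 0] by (auto intro!: exI[of _ "\<lambda>b x. 0"])
qed auto

lemma Ck_on_inner: "Ck_on k U (\<lambda>x. x \<bullet> v)"
proof (cases k)
  case 0
  then show ?thesis by (auto intro!: continuous_intros)
next
  case (Suc j)
  have "((\<lambda>x. x \<bullet> v) has_derivative (\<lambda>h. \<Sum>b\<in>Basis. (h \<bullet> b) * (b \<bullet> v))) (at x)" for x :: 'a
  proof -
    have "((\<lambda>x. x \<bullet> v) has_derivative (\<lambda>h. h \<bullet> v)) (at x)"
      by (auto intro!: derivative_eq_intros)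
    moreover have "(\<lambda>h. h \<bullet> v) = (\<lambda>h. \<Sum>b\<in>Basis. (h \<bullet> b) * (b \<bullet> v))"
      by (subst euclidean_inner) (simp add: inner_commute)
    ultimately show ?thesis by simp
  qed
  then show ?thesis using Suc Ck_on_const by (auto intro!: exI[of _ "\<lambda>b x. b \<bullet> v"])
qed

lemma Ck_on_add: "Ck_on k U f \<Longrightarrow> Ck_on k U g \<Longrightarrow> Ck_on k U (\<lambda>x. f x + g x)"
proof (induction k arbitrary: f g)
  case (Suc k)
  obtain f' where
    f: "\<And>x. x \<in> U \<Longrightarrow> (f has_derivative (\<lambda>h. \<Sum>b\<in>Basis. (h \<bullet> b) * f' b x)) (at x)" "\<And>b. b \<in> Basis \<Longrightarrow> Ck_on k U (f' b)"
    using Suc.prems(1) by (rule Ck_on_SucE) blast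
  obtain g' where
    g: "\<And>x. x \<in> U \<Longrightarrow> (g has_derivative (\<lambda>h. \<Sum>b\<in>Basis. (h \<bullet> b) * g' b x)) (at x)" "\<And>b. b \<in> Basis \<Longrightarrow> Ck_on k U (g' b)"
    using Suc.prems(2) by (rule Ck_on_SucE) blast
  have "((\<lambda>x. f x + g x) has_derivative (\<lambda>h. \<Sum>b\<in>Basis. (h \<bullet> b) * (f' b x + g' b x))) (at x)" if "x \<in> U" for x
    using has_derivative_add[OF f(1) g(1), OF that that] by (simp add: distrib_left sum.distrib)
  then show ?case using Suc.IH f(2) g(2) by (auto intro!: exI[of _ "\<lambda>b x. f' b x + g' b x"])
qed (auto intro!: continuous_intros)

lemma Ck_on_mult: "Ck_on k U f \<Longrightarrow> Ck_on k U g \<Longrightarrow> Ck_on k U (\<lambda>x. f x * g x)"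
proof (induction k arbitrary: f g)
  case (Suc k)
  obtain f' where
    f: "\<And>x. x \<in> U \<Longrightarrow> (f has_derivative (\<lambda>h. \<Sum>b\<in>Basis. (h \<bullet> b) * f' b x)) (at x)" "\<And>b. b \<in> Basis \<Longrightarrow> Ck_on k U (f' b)"
    using Suc.prems(1) by (rule Ck_on_SucE) blast
  obtain g' where
    g: "\<And>x. x \<in> U \<Longrightarrow> (g has_derivative (\<lambda>h. \<Sum>b\<in>Basis. (h \<bullet> b) * g' b x)) (at x)" "\<And>b. b \<in> Basis \<Longrightarrow> Ck_on k U (g' b)"
    using Suc.prems(2) by (rule Ck_on_SucE) blast
  have "((\<lambda>x. f x * g x) has_derivative (\<lambda>h. \<Sum>b\<in>Basis. (h \<bullet> b) * (f x * g' b x + f' b x * g x))) (at x)" if "x \<in> U" for x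
    using has_derivative_mult[OF f(1) g(1), OF that that]
    by (simp add: distrib_left sum.distrib sum_distrib_left sum_distrib_right ac_simps)
  moreover have "Ck_on k U (\<lambda>x. f x * g' b x + f' b x * g x)" if "b \<in> Basis" for b
    using Suc.IH[OF Ck_on_pred[OF Suc.prems(1)], of "g' b"] Suc.IH[of "f' b", OF _ Ck_on_pred[OF Suc.prems(2)]]
       f(2) g(2) that by (auto intro!: Ck_on_add)
  ultimately show ?case by (auto intro!: exI[of _ "\<lambda>b x. f x * g' b x + f' b x * g x"])
qed (auto intro!: continuous_intros)

lemma Ck_on_minus: "Ck_on k U f \<Longrightarrow> Ck_on k U (\<lambda>x. - f x)"
  using Ck_on_mult[OF Ck_on_const[of k U "-1"]] by simp

lemma Ck_on_diff: "Ck_on k U f \<Longrightarrow> Ck_on k U g \<Longrightarrow> Ck_on k U (\<lambda>x. f x - g x)"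
  using Ck_on_add[OF _ Ck_on_minus] by (simp add: diff_conv_add_uminus del: add_uminus_conv_diff)

lemma Ck_on_sum: "(\<And>i. i \<in> I \<Longrightarrow> Ck_on k U (f i)) \<Longrightarrow> Ck_on k U (\<lambda>x. \<Sum>i\<in>I. f i x)"
  by (induction I rule: infinite_finite_induct) (auto intro!: Ck_on_const Ck_on_add)

lemma Ck_on_power: "Ck_on k U f \<Longrightarrow> Ck_on k U (\<lambda>x. f x ^ j)"
  by (induction j) (auto intro!: Ck_on_const Ck_on_mult)

lemma Ck_on_compose:
  fixes g :: "real \<Rightarrow> real"
  assumes "Ck_on k V g" "Ck_on k U f" "f ` U \<subseteq> V"
  shows "Ck_on k U (\<lambda>x. g (f x))"
  using assms
proof (induction k arbitrary: f g)
  case 0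
  then show ?case by (auto intro: continuous_on_compose2)
next
  case (Suc k)
  obtain f' where
    f: "\<And>x. x \<in> U \<Longrightarrow> (f has_derivative (\<lambda>h. \<Sum>b\<in>Basis. (h \<bullet> b) * f' b x)) (at x)" "\<And>b. b \<in> Basis \<Longrightarrow> Ck_on k U (f' b)"
    using Suc.prems(2) by (rule Ck_on_SucE) blast
  obtain g' where
    g: "\<And>x. x \<in> V \<Longrightarrow> (g has_derivative (\<lambda>h. h * g' (1::real) x)) (at x)" "Ck_on k V (g' 1)"
  proof -
    obtain g' where "\<And>x. x \<in> V \<Longrightarrow> (g has_derivative (\<lambda>h. \<Sum>b\<in>Basis. (h \<bullet> b) * g' b x)) (at x)"
      "\<And>b::real. b \<in> Basis \<Longrightarrow> Ck_on k V (g' b)"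
      using Suc.prems(1) by (rule Ck_on_SucE) blast
    then show ?thesis by (intro that[of g']) (simp_all add: Basis_real_def)
  qed
  have "((\<lambda>x. g (f x)) has_derivative (\<lambda>h. \<Sum>b\<in>Basis. (h \<bullet> b) * (g' (1::real) (f x) * f' b x))) (at x)" if "x \<in> U" for x
    using has_derivative_compose[OF f(1)[OF that] g(1)] that Suc.prems(3)
    by (simp add: image_subset_iff sum_distrib_left sum_distrib_right ac_simps)
  moreover have "Ck_on k U (\<lambda>x. g' (1::real) (f x) * f' b x)" if "b \<in> Basis" for b
    using Suc.IH[OF g(2) Ck_on_pred[OF Suc.prems(2)] Suc.prems(3)] f(2) that by (auto intro!: Ck_on_mult)
  ultimately show ?case by (auto intro!: exI[of _ "\<lambda>b x. g' (1::real) (f x) * f' b x"])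
qed

lemma Ck_on_real_SucI:
  fixes g :: "real \<Rightarrow> real"
  assumes "\<And>x. x \<in> V \<Longrightarrow> (g has_real_derivative g' x) (at x)" "Ck_on k V g'"
  shows "Ck_on (Suc k) V g"
proof -
  have "(g has_derivative (\<lambda>h. \<Sum>b\<in>Basis. (h \<bullet> b) * g' x)) (at x)" if "x \<in> V" for x
    using assms(1)[OF that] by (simp add: Basis_real_def has_field_derivative_def mult.commute[of _ "g' x"])
  then show ?thesis using assms(2) by (auto intro!: exI[of _ "\<lambda>b. g'"])
qed

lemma Ck_on_exp_real: "Ck_on k U (exp :: real \<Rightarrow> real)"
proof (induction k)
  case (Suc k)
  then show ?case by (intro Ck_on_real_SucI[where g' = exp]) (auto intro!: derivative_eq_intros)
qed (auto intro!: continuous_intros)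

lemma Ck_on_id_real: "Ck_on k U (\<lambda>x::real. x)"
  using Ck_on_inner[of k U "1::real"] by simp

lemma Ck_on_inverse_real: "Ck_on k {0<..} (inverse :: real \<Rightarrow> real)"
proof (induction k)
  case (Suc k)
  then show ?case
    by (intro Ck_on_real_SucI[where g' = "\<lambda>x. - (inverse x * inverse x)"] Ck_on_minus Ck_on_mult)
       (auto intro!: derivative_eq_intros simp: divide_simps power2_eq_square)
qed (auto intro!: continuous_intros)

lemma Ck_on_ln_real: "Ck_on k {0<..} (ln :: real \<Rightarrow> real)"
proof (cases k)
  case (Suc j)
  show ?thesis unfolding Suc
    by (intro Ck_on_real_SucI[where g' = inverse] Ck_on_inverse_real)
       (auto intro!: derivative_eq_intros simp: divide_simps)
qed (auto intro!: continuous_intros)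

lemma Ck_on_exp: "Ck_on k U f \<Longrightarrow> Ck_on k U (\<lambda>x. exp (f x))"
  by (rule Ck_on_compose[OF Ck_on_exp_real[of _ UNIV]]) auto

lemma Ck_on_ln: "Ck_on k U f \<Longrightarrow> (\<And>x. x \<in> U \<Longrightarrow> f x > 0) \<Longrightarrow> Ck_on k U (\<lambda>x. ln (f x))"
  by (rule Ck_on_compose[OF Ck_on_ln_real]) auto

lemma Ck_on_inverse: "Ck_on k U f \<Longrightarrow> (\<And>x. x \<in> U \<Longrightarrow> f x > 0) \<Longrightarrow> Ck_on k U (\<lambda>x. inverse (f x))"
  by (rule Ck_on_compose[OF Ck_on_inverse_real]) auto

lemma Ck_on_divide: "Ck_on k U f \<Longrightarrow> Ck_on k U g \<Longrightarrow> (\<And>x. x \<in> U \<Longrightarrow> g x > 0) \<Longrightarrow> Ck_on k U (\<lambda>x. f x / g x)"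
  unfolding divide_inverse by (intro Ck_on_mult Ck_on_inverse)

lemma Ck_on_norm_power2: "Ck_on k U (\<lambda>x. (norm x)\<^sup>2)"
  unfolding power2_norm_eq_inner
  by (subst euclidean_inner) (intro Ck_on_sum Ck_on_mult Ck_on_inner)

lemma Ck_on_norm:
  assumes "open U" "0 \<notin> U"
  shows "Ck_on k U norm"
proof (rule Ck_on_cong[OF assms(1)])
  show "Ck_on k U (\<lambda>x. exp (ln ((norm x)\<^sup>2) * (1/2)))"
    using assms by (intro Ck_on_exp Ck_on_mult Ck_on_const Ck_on_ln Ck_on_norm_power2) auto
  show "exp (ln ((norm x)\<^sup>2) * (1/2)) = norm x" if "x \<in> U" for x
    using that assms by (auto simp: ln_realpow)
qed

lemmas Ck_intros = Ck_on_const Ck_on_inner Ck_on_id_real Ck_on_add Ck_on_mult Ck_on_minus Ck_on_diff Ck_on_sum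
  Ck_on_power Ck_on_exp Ck_on_ln Ck_on_inverse Ck_on_divide Ck_on_norm_power2 Ck_on_norm

text \<open>
  Test functions are given by formulas that make sense only away from the origin. A function on
  an open set that vanishes off a closed subset keeps its regularity when it is continued by zero,
  because outside the closed set it is locally zero; the partial derivatives have the same property,
  which drives the induction.
\<close>
lemma Ck_on_zero_extension:
  assumes "open U" "closed K" "K \<subseteq> U" "\<And>x. x \<notin> K \<Longrightarrow> f x = 0" "Ck_on k U f"
  shows "Ck_on k UNIV f"
  using assms(4,5)
proof (induction k arbitrary: f)
  case 0
  have "continuous_on (-K) f"
    using continuous_on_cong[of "-K" "-K" f "\<lambda>x. 0"] 0 by simp
  then have "continuous_on (U \<union> -K) f"
    using 0 assms by (intro continuous_on_open_Un) auto
  moreover have "U \<union> -K = UNIV" using assms by auto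
  ultimately show ?case by simp
next
  case (Suc k)
  obtain f' where f: "\<And>x. x \<in> U \<Longrightarrow> (f has_derivative (\<lambda>h. \<Sum>b\<in>Basis. (h \<bullet> b) * f' b x)) (at x)"
    "\<And>b. b \<in> Basis \<Longrightarrow> Ck_on k U (f' b)" using Suc.prems(2) by (rule Ck_on_SucE) blast
  define F where "F b x = (if x \<in> U then f' b x else 0)" for b x
  have out: "(f has_derivative (\<lambda>h. 0)) (at x)" if "x \<notin> K" for x
    by (rule has_derivative_transform_within_open[of "\<lambda>x. 0" _ _ UNIV "-K"]) (use that assms Suc in auto)
  have F0: "F b x = 0" if "b \<in> Basis" "x \<notin> K" for b x
  proof (cases "x \<in> U")
    case True
    have "(\<lambda>h. \<Sum>b\<in>Basis. (h \<bullet> b) * f' b x) = (\<lambda>h. 0)"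
      using has_derivative_unique[OF f(1)[OF True] out[OF that(2)]] .
    from fun_cong[OF this, of b] that True show ?thesis
      by (simp add: F_def inner_Basis if_distrib[of "\<lambda>y. y * _"] cong: if_cong)
  qed (auto simp: F_def)
  have "(f has_derivative (\<lambda>h. \<Sum>b\<in>Basis. (h \<bullet> b) * F b x)) (at x)" for x
  proof (cases "x \<in> U")
    case True
    then show ?thesis using f(1) by (simp add: F_def)
  next
    case False
    then show ?thesis using out[of x] assms by (auto simp: F_def)
  qed
  moreover have "Ck_on k UNIV (F b)" if "b \<in> Basis" for b
    by (rule Suc.IH[OF F0[OF that]]) (use that f(2) assms in \<open>auto simp: F_def intro: Ck_on_cong[of U "f' b"]\<close>)
  ultimately show ?case by auto
qed

lemma sum_Basis_vec: "(\<Sum>b\<in>Basis. F (b :: real ^ 'n::finite)) = (\<Sum>i\<in>UNIV. F (axis i 1))"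
proof -
  have "inj (\<lambda>i::'n. axis i (1::real))" by (auto simp: inj_on_def axis_eq_axis)
  moreover have "(Basis :: (real^'n) set) = range (\<lambda>i. axis i 1)"
    by (auto simp: Basis_vec_def)
  ultimately show ?thesis using sum.reindex[of "\<lambda>i::'n. axis i (1::real)" UNIV F] by (simp add: o_def)
qed

text \<open>
  Every directional derivative is a combination of the partial derivatives, so the recursion over
  partial derivatives that defines the test functions agrees with the one used here. This is the
  only bridge needed: regularity is proved with the closure rules above and transferred at the end.
\<close>
lemma Ck_on_UNIV_iff: "Ck_on k UNIV f \<longleftrightarrow> C_k k (f :: real ^ 'n::finite \<Rightarrow> real)"
proof (induction k arbitrary: f)
  case (Suc k)
  show ?case
  proof
    assume "Ck_on (Suc k) UNIV f"
    then obtain f' where f: "\<And>x. (f has_derivative (\<lambda>h. \<Sum>b\<in>Basis. (h \<bullet> b) * f' b x)) (at x)"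
      "\<And>b. b \<in> Basis \<Longrightarrow> Ck_on k UNIV (f' b)" by (rule Ck_on_SucE) blast
    have "frechet_derivative f (at x) (axis i 1) = f' (axis i 1) x" for x i
      unfolding frechet_derivative_at[OF f(1), symmetric]
      by (simp add: inner_Basis axis_in_Basis_iff if_distrib[of "\<lambda>y. y * _"] cong: if_cong)
    then show "C_k (Suc k) f" using f Suc[symmetric]
      by (auto simp: differentiable_on_def differentiable_def axis_in_Basis_iff)
  next
    assume *: "C_k (Suc k) f"
    have "(f has_derivative (\<lambda>h. \<Sum>b\<in>Basis. (h \<bullet> b) * frechet_derivative f (at x) b)) (at x)" for x
    proof -
      have d: "(f has_derivative frechet_derivative f (at x)) (at x)"
        using * by (auto simp: differentiable_on_def frechet_derivative_works)
      have l: "linear (frechet_derivative f (at x))" using d has_derivative_linear by blast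
      have "frechet_derivative f (at x) = (\<lambda>h. \<Sum>b\<in>Basis. (h \<bullet> b) * frechet_derivative f (at x) b)"
      proof
        fix h
        show "frechet_derivative f (at x) h = (\<Sum>b\<in>Basis. (h \<bullet> b) * frechet_derivative f (at x) b)"
          by (subst euclidean_representation[of h, symmetric])
             (simp only: linear_sum[OF l] linear_cmul[OF l] real_scaleR_def)
      qed
      with d show ?thesis by simp
    qed
    moreover have "Ck_on k UNIV (\<lambda>x. frechet_derivative f (at x) b)" if "b \<in> Basis" for b
      using that * Suc by (auto simp: Basis_vec_def)
    ultimately show "Ck_on (Suc k) UNIV f" by (auto intro!: exI[of _ "\<lambda>b x. frechet_derivative f (at x) b"])
  qed
qed auto

declare Ck_on.simps(2) [simp del]

section \<open>A family of smooth functions vanishing on a half line\<close>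

text \<open>
  All negative powers of \<open>t\<close> are included as factors of \<open>exp (- 1 / t)\<close>: the derivative of a member of the family is
  a linear combination of two others, so the smoothness of the whole family follows by one
  induction.
\<close>
definition flat_exp :: "nat \<Rightarrow> real \<Rightarrow> real" where
  "flat_exp j t = (if t > 0 then inverse t ^ j * exp (- inverse t) else 0)"

lemma flat_exp_tendsto_0: "(flat_exp j \<longlongrightarrow> 0) (at 0)"
proof (rule filterlim_split_at)
  show "(flat_exp j \<longlongrightarrow> 0) (at_left 0)"
    by (rule tendsto_eventually)
       (auto simp: flat_exp_def eventually_at_filter)
  have "((\<lambda>t::real. inverse t ^ j / exp (inverse t)) \<longlongrightarrow> 0) (at_right 0)"
    using filterlim_compose[OF tendsto_power_div_exp_0 filterlim_inverse_at_top_right] .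
  then show "(flat_exp j \<longlongrightarrow> 0) (at_right 0)"
    by (rule Lim_transform_eventually)
       (auto simp: flat_exp_def eventually_at_filter exp_minus field_simps)
qed

lemma flat_exp_deriv:
  "(flat_exp j has_real_derivative (flat_exp (j+2) t - j * flat_exp (j+1) t)) (at t)"
proof -
  consider "t > 0" | "t < 0" | "t = 0" by linarith
  then show ?thesis
  proof cases
    case 1
    have d: "(inverse has_real_derivative - ((inverse t)\<^sup>2)) (at t)"
      using 1 DERIV_inverse[of t] by (simp add: power2_eq_square)
    have "((\<lambda>t. inverse t ^ j * exp (- inverse t)) has_real_derivative
       (inverse t ^ (j+2) * exp (- inverse t) - j * (inverse t ^ (j+1) * exp (- inverse t)))) (at t)"
      by (rule DERIV_cong[OF DERIV_mult[OF DERIV_power[OF d] DERIV_fun_exp[OF DERIV_minus[OF d]]]])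
         (cases j; simp add: power2_eq_square algebra_simps)
    then have "((\<lambda>t. inverse t ^ j * exp (- inverse t)) has_real_derivative
        (flat_exp (j+2) t - j * flat_exp (j+1) t)) (at t)"
      using 1 by (simp add: flat_exp_def)
    then show ?thesis
      by (rule has_field_derivative_transform_within_open[where S = "{0<..}"])
         (use 1 in \<open>auto simp: flat_exp_def\<close>)
  next
    case 2
    show ?thesis
      by (rule has_field_derivative_transform_within_open[where S = "{..<0}" and f = "\<lambda>t. 0"])
         (use 2 in \<open>auto simp: flat_exp_def\<close>)
  next
    case 3
    have "((\<lambda>h. (flat_exp j (0 + h) - flat_exp j 0) / h) \<longlongrightarrow> 0) (at 0)"
      by (rule Lim_transform_eventually[OF flat_exp_tendsto_0[of "Suc j"]])
         (auto simp: flat_exp_def eventually_at_filter field_simps)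
    then show ?thesis using 3 by (simp add: flat_exp_def DERIV_def)
  qed
qed

lemma Ck_on_flat_exp: "Ck_on k U (flat_exp j)"
proof (induction k arbitrary: j)
  case 0
  show ?case using flat_exp_deriv by (auto intro!: continuous_at_imp_continuous_on DERIV_isCont)
next
  case (Suc k)
  show ?case by (rule Ck_on_real_SucI[OF flat_exp_deriv]) (intro Ck_intros Suc)
qed

section \<open>Divergence theorem for compactly supported fields\<close>

lemma integrable_continuous_compact_support:
  fixes f :: "'a::euclidean_space \<Rightarrow> real"
  assumes "open U" "compact K" "K \<subseteq> U" "\<And>x. x \<notin> K \<Longrightarrow> f x = 0" "continuous_on U f"
  shows "integrable lborel f"
proof -
  have "integrable lborel (\<lambda>x. indicator K x *\<^sub>R f x)"
    by (rule borel_integrable_compact) (use assms in \<open>auto intro: continuous_on_subset\<close>)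
  moreover have "(\<lambda>x. indicator K x *\<^sub>R f x) = f" using assms(4) by (auto simp: indicator_def fun_eq_iff)
  ultimately show ?thesis by simp
qed

lemma lborel_integral_translation:
  fixes f :: "'a::euclidean_space \<Rightarrow> real"
  assumes "f \<in> borel_measurable borel"
  shows "(LINT x|lborel. f (t + x)) = (LINT x|lborel. f x)"
proof -
  have "(LINT x|lborel. f x) = integral\<^sup>L (density (distr lborel borel (\<lambda>x. t + 1 *\<^sub>R x)) (\<lambda>_. ennreal (\<bar>1\<bar> ^ DIM('a)))) f"
    using lborel_affine[of 1 t] by simp
  also have "\<dots> = integral\<^sup>L (distr lborel borel (\<lambda>x. t + 1 *\<^sub>R x)) f"
    by (simp add: density_1)
  also have "\<dots> = (LINT x|lborel. f (t + x))"
    using assms by (subst integral_distr) auto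
  finally show ?thesis by simp
qed

lemma lborel_integral_reflection:
  fixes f :: "'a::euclidean_space \<Rightarrow> real"
  assumes "f \<in> borel_measurable borel"
  shows "(LINT x|lborel. f (- x)) = (LINT x|lborel. f x)"
proof -
  have "(LINT x|lborel. f x) = integral\<^sup>L (density (distr lborel borel (\<lambda>x. 0 + (-1) *\<^sub>R x)) (\<lambda>_. ennreal (\<bar>-1\<bar> ^ DIM('a)))) f"
    using lborel_affine[of "-1" "0::'a"] by simp
  also have "\<dots> = integral\<^sup>L (distr lborel borel (\<lambda>x. 0 + (-1) *\<^sub>R x)) f"
    by (simp add: density_1)
  also have "\<dots> = (LINT x|lborel. f (- x))"
    using assms by (subst integral_distr) auto
  finally show ?thesis by simp
qed

text \<open>
  The integral of a difference quotient vanishes because Lebesgue measure is invariant under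
  translations. The quotients are bounded by the maximum of the derivative and live on a fixed
  compact set, so dominated convergence carries the identity over to the derivative.
\<close>
lemma directional_derivative_integral_eq_0:
  fixes f :: "'a::euclidean_space \<Rightarrow> real"
  assumes C1: "Ck_on 1 UNIV f" and K: "compact K" "\<And>x. x \<notin> K \<Longrightarrow> f x = 0"
    and D: "\<And>x. (f has_derivative f' x) (at x)"
  shows "integrable lborel (\<lambda>x. f' x v)" "(LINT x|lborel. f' x v) = 0"
    "continuous_on UNIV (\<lambda>x. f' x v)" "\<And>x. x \<notin> K \<Longrightarrow> f' x v = 0"
proof -
  obtain F where F: "\<And>x. (f has_derivative (\<lambda>h. \<Sum>b\<in>Basis. (h \<bullet> b) * F b x)) (at x)"
    "\<And>b. b \<in> Basis \<Longrightarrow> continuous_on UNIV (F b)"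
    using Ck_on_SucE[of 0 UNIV f] C1 by auto
  have f'_eq: "f' x = (\<lambda>h. \<Sum>b\<in>Basis. (h \<bullet> b) * F b x)" for x
    by (rule has_derivative_unique[OF D F(1)])
  show cont: "continuous_on UNIV (\<lambda>x. f' x v)"
    unfolding f'_eq by (intro continuous_intros F)
  show z: "f' x v = 0" if "x \<notin> K" for x
  proof -
    have "(f has_derivative (\<lambda>h. 0)) (at x)"
      by (rule has_derivative_transform_within_open[of "\<lambda>x. 0" _ _ UNIV "-K"])
         (use that K in \<open>auto intro: compact_imp_closed\<close>)
    then show ?thesis using has_derivative_unique[OF D] by (auto dest: fun_cong)
  qed
  show int: "integrable lborel (\<lambda>x. f' x v)"
    by (rule integrable_continuous_compact_support[OF open_UNIV K(1) _ z cont]) auto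
  have fc: "continuous_on UNIV f" using C1 by (rule Ck_on_imp_continuous)
  have fint: "integrable lborel f"
    by (rule integrable_continuous_compact_support[OF open_UNIV K(1) _ K(2) fc]) auto
  have meas [measurable]: "f \<in> borel_measurable borel" "(\<lambda>x. f' x v) \<in> borel_measurable borel"
    using fc cont by (auto intro: borel_measurable_continuous_onI)
  obtain M where M: "\<And>x. \<bar>f' x v\<bar> \<le> M"
  proof -
    have "bounded ((\<lambda>x. f' x v) ` K)"
      using cont K(1) by (meson compact_continuous_image compact_imp_bounded continuous_on_subset subset_UNIV)
    then obtain B where "\<And>x. x \<in> K \<Longrightarrow> \<bar>f' x v\<bar> \<le> B" by (auto simp: bounded_iff)
    then have "\<bar>f' x v\<bar> \<le> max B 0" for x using z[of x] by (cases "x \<in> K") (auto simp: max.coboundedI1)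
    then show ?thesis using that by blast
  qed
  \<comment> \<open>All difference quotients with step at most 1 vanish outside this set.\<close>
  define K' where "K' = (\<lambda>(x, s). x - s *\<^sub>R v) ` (K \<times> {0..1::real})"
  have K': "compact K'" unfolding K'_def
    by (intro compact_continuous_image compact_Times K compact_Icc) (auto intro!: continuous_intros simp: case_prod_unfold)
  define h where "h n = 1 / (real n + 1)" for n
  have h: "h n > 0" "h n \<le> 1" for n by (auto simp: h_def divide_simps)
  define d where "d n x = (f (h n *\<^sub>R v + x) - f x) / h n" for n x
  have d0: "(LINT x|lborel. d n x) = 0" for n
  proof -
    have i: "integrable lborel (\<lambda>x. f (h n *\<^sub>R v + x))"
    proof (rule integrable_continuous_compact_support[OF open_UNIV])
      show "compact ((\<lambda>x. - (h n *\<^sub>R v) + x) ` K)" by (rule compact_translation[OF K(1)])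
      show "f (h n *\<^sub>R v + x) = 0" if "x \<notin> (\<lambda>x. - (h n *\<^sub>R v) + x) ` K" for x
        using that by (intro K(2)) (metis (no_types, lifting) add_minus_cancel image_eqI minus_add_cancel)
      show "continuous_on UNIV (\<lambda>x. f (h n *\<^sub>R v + x))"
        by (intro continuous_on_compose2[OF fc] continuous_intros) auto
    qed auto
    have "(LINT x|lborel. d n x) = ((LINT x|lborel. f (h n *\<^sub>R v + x)) - (LINT x|lborel. f x)) / h n"
      unfolding d_def using i fint by simp
    then show ?thesis by (simp add: lborel_integral_translation)
  qed
  have "(\<lambda>n. LINT x|lborel. d n x) \<longlonglongrightarrow> (LINT x|lborel. f' x v)"
  proof (rule integral_dominated_convergence[where w = "\<lambda>x. indicator K' x *\<^sub>R M"])
    show "integrable lborel (\<lambda>x. indicator K' x *\<^sub>R M)"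
      by (rule borel_integrable_compact[OF K']) auto
    show "AE x in lborel. norm (d n x) \<le> indicator K' x *\<^sub>R M" for n
    proof (rule AE_I2)
      fix x
      have der: "((\<lambda>s. f (s *\<^sub>R v + x)) has_real_derivative f' (s *\<^sub>R v + x) v) (at s)" for s
      proof -
        have "((\<lambda>s. f (s *\<^sub>R v + x)) has_derivative (\<lambda>t. f' (s *\<^sub>R v + x) (t *\<^sub>R v))) (at s)"
          by (rule has_derivative_compose[OF _ D]) (auto intro!: derivative_eq_intros)
        moreover have "f' (s *\<^sub>R v + x) (t *\<^sub>R v) = f' (s *\<^sub>R v + x) v * t" for t
          by (simp add: f'_eq sum_distrib_left sum_distrib_right ac_simps)
        ultimately show ?thesis by (simp add: has_field_derivative_def)
      qed
      obtain s where s: "0 < s" "s < h n" "f (h n *\<^sub>R v + x) - f (0 *\<^sub>R v + x) = (h n - 0) * f' (s *\<^sub>R v + x) v"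
        using MVT2[OF h(1), where f = "\<lambda>s. f (s *\<^sub>R v + x)" and f' = "\<lambda>s. f' (s *\<^sub>R v + x) v"] der by blast
      have dn: "d n x = f' (s *\<^sub>R v + x) v" using s h(1)[of n] by (simp add: d_def)
      show "norm (d n x) \<le> indicator K' x *\<^sub>R M"
      proof (cases "x \<in> K'")
        case True then show ?thesis using M dn by simp
      next
        case False
        have "s *\<^sub>R v + x \<notin> K"
        proof
          assume "s *\<^sub>R v + x \<in> K"
          then have "x \<in> K'" unfolding K'_def using s h(2)[of n]
            by (intro image_eqI[of _ _ "(s *\<^sub>R v + x, s)"]) auto
          with False show False by simp
        qed
        then show ?thesis using z dn False by simp
      qed
    qed
    show "AE x in lborel. (\<lambda>n. d n x) \<longlonglongrightarrow> f' x v"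
    proof (rule AE_I2)
      fix x
      have "((\<lambda>s. f (s *\<^sub>R v + x)) has_derivative (\<lambda>t. f' (0 *\<^sub>R v + x) (t *\<^sub>R v))) (at 0)"
        by (rule has_derivative_compose[OF _ D]) (auto intro!: derivative_eq_intros)
      moreover have "f' x (t *\<^sub>R v) = f' x v * t" for t
        by (simp add: f'_eq sum_distrib_left sum_distrib_right ac_simps)
      ultimately have "((\<lambda>s. f (s *\<^sub>R v + x)) has_real_derivative f' x v) (at 0)"
        by (simp add: has_field_derivative_def)
      then have "((\<lambda>s. (f (s *\<^sub>R v + x) - f x) / s) \<longlongrightarrow> f' x v) (at 0)"
        by (simp add: DERIV_def)
      moreover have "filterlim h (at 0) sequentially"
        unfolding filterlim_at using h(1) LIMSEQ_inverse_real_of_nat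
        by (auto simp: h_def[abs_def] inverse_eq_divide add.commute less_imp_neq[THEN not_sym])
      ultimately have "(\<lambda>n. (f (h n *\<^sub>R v + x) - f x) / h n) \<longlonglongrightarrow> f' x v"
        by (rule filterlim_compose)
      then show "(\<lambda>n. d n x) \<longlonglongrightarrow> f' x v" by (simp add: d_def)
    qed
  qed (auto simp: d_def)
  then show "(LINT x|lborel. f' x v) = 0" using d0 LIMSEQ_unique by (simp add: LIMSEQ_const_iff)
qed

text \<open>
  The divergence theorem for a compactly supported field \<open>x \<mapsto> R x *\<^sub>R (x + v)\<close>. Both the fields of the
  Hardy inequality and the radial fields behind the polar integrals have this shape, and its
  divergence needs only the derivative of the scalar \<open>R\<close> along the field itself.
\<close>
lemma divergence_scaled_translate_eq_0:
  fixes R :: "'a::euclidean_space \<Rightarrow> real"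
  assumes C1: "Ck_on 1 UNIV R" and K: "compact K" "\<And>x. x \<notin> K \<Longrightarrow> R x = 0"
    and D: "\<And>x. (R has_derivative R' x) (at x)"
  shows "integrable lborel (\<lambda>x. DIM('a) * R x + R' x (x + v))"
    "(LINT x|lborel. DIM('a) * R x + R' x (x + v)) = 0"
proof -
  have l: "linear (R' x)" for x using D has_derivative_linear by blast
  define g where "g b x h = R x * (h \<bullet> b) + R' x h * (x \<bullet> b)" for b x h
  have gd: "((\<lambda>x. R x * (x \<bullet> b)) has_derivative g b x) (at x)" for b x
    unfolding g_def by (rule has_derivative_mult[OF D]) (auto intro!: derivative_eq_intros)
  have gC: "Ck_on 1 UNIV (\<lambda>x. R x * (x \<bullet> b))" for b by (intro Ck_intros C1)
  have gK: "R x * (x \<bullet> b) = 0" if "x \<notin> K" for x b using K that by simp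
  note g = directional_derivative_integral_eq_0[OF gC K(1) gK gd]
    and r = directional_derivative_integral_eq_0[OF C1 K D]
  have eq: "DIM('a) * R x + R' x (x + v) = (\<Sum>b\<in>Basis. g b x b) + R' x v" for x
  proof -
    have "(\<Sum>b\<in>Basis. g b x b) = DIM('a) * R x + (\<Sum>b\<in>Basis. R' x ((x \<bullet> b) *\<^sub>R b))"
      by (simp add: g_def sum.distrib linear_cmul[OF l] mult.commute)
    also have "(\<Sum>b\<in>Basis. R' x ((x \<bullet> b) *\<^sub>R b)) = R' x x"
      by (simp only: linear_sum[OF l, symmetric] euclidean_representation)
    finally show ?thesis by (simp add: linear_add[OF l])
  qed
  show "integrable lborel (\<lambda>x. DIM('a) * R x + R' x (x + v))"
    unfolding eq by (intro Bochner_Integration.integrable_add Bochner_Integration.integrable_sum g r)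
  show "(LINT x|lborel. DIM('a) * R x + R' x (x + v)) = 0"
    unfolding eq using g r by (subst Bochner_Integration.integral_add) auto
qed

section \<open>Iterated logarithms and the constant kappa\<close>

text \<open>
  The iterated logarithms in the variable \<open>\<tau> = - ln t\<close>: \<open>zlog j \<tau>\<close> is \<open>- ln (X\<^sub>j t)\<close>. Since \<open>X\<^sub>1\<close> sends
  \<open>exp (- \<tau>)\<close> to \<open>1 / (1 + \<tau>)\<close>, the recursion becomes \<open>\<tau> \<mapsto> ln (1 + \<tau>)\<close>, and a product of the \<open>X\<^sub>j\<close>
  becomes the exponential of a sum. Below, \<open>P\<^sub>i\<close> stands for \<open>zprod i\<close>.
\<close>
primrec zlog :: "nat \<Rightarrow> real \<Rightarrow> real" where
  "zlog 0 \<tau> = \<tau>"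
| "zlog (Suc j) \<tau> = ln (1 + zlog j \<tau>)"

definition zprod :: "nat \<Rightarrow> real \<Rightarrow> real" where
  "zprod i \<tau> = exp (- (\<Sum>j=1..i. zlog j \<tau>))"

lemma zlog_pos: "\<tau> > 0 \<Longrightarrow> zlog j \<tau> > 0"
  by (induction j) (auto simp: ln_gt_zero)

lemma zlog_shift: "zlog j (ln (1 + \<tau>)) = zlog (Suc j) \<tau>"
  by (induction j) auto

lemma iter_log_exp: "\<tau> > 0 \<Longrightarrow> iter_log j (exp (- \<tau>)) = exp (- zlog j \<tau>)"
proof (induction j arbitrary: \<tau>)
  case (Suc j)
  have "iter_log (Suc j) (exp (- \<tau>)) = iter_log j (exp (- ln (1 + \<tau>)))"
    using Suc.prems by (simp add: exp_minus[of "ln _"] inverse_eq_divide)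
  also have "\<dots> = exp (- zlog (Suc j) \<tau>)"
    using Suc.prems by (subst Suc.IH) (simp_all only: zlog_shift, simp)
  finally show ?case .
qed simp

lemma zprod_0 [simp]: "zprod 0 \<tau> = 1" by (simp add: zprod_def)

lemma zprod_pos: "zprod i \<tau> > 0" by (simp add: zprod_def)

lemma log_prod_exp: "\<tau> > 0 \<Longrightarrow> log_prod i (exp (- \<tau>)) = zprod i \<tau>"
  unfolding log_prod_def zprod_def
  by (simp add: iter_log_exp exp_sum flip: sum_negf)

lemma log_prod_eq_zprod: "0 < t \<Longrightarrow> t < 1 \<Longrightarrow> log_prod i t = zprod i (- ln t)"
  using log_prod_exp[of "- ln t" i] by (simp add: ln_less_zero)

lemma zprod_Suc: "\<tau> > 0 \<Longrightarrow> zprod (Suc j) \<tau> = zprod j \<tau> / (1 + zlog j \<tau>)"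
  using zlog_pos[of \<tau> j] by (simp add: zprod_def exp_diff exp_minus field_simps exp_add)

lemma zlog_mono: "0 < \<tau> \<Longrightarrow> \<tau> \<le> \<tau>' \<Longrightarrow> zlog j \<tau> \<le> zlog j \<tau>'"
proof (induction j)
  case (Suc j)
  then show ?case using zlog_pos[of \<tau> j] by simp
qed simp

lemma zprod_antimono: "0 < \<tau> \<Longrightarrow> \<tau> \<le> \<tau>' \<Longrightarrow> zprod i \<tau>' \<le> zprod i \<tau>"
  unfolding zprod_def by (auto intro!: sum_mono zlog_mono)

lemma zlog_le_ln: "\<tau> > 0 \<Longrightarrow> zlog (Suc j) \<tau> \<le> ln (1 + \<tau>)"
proof (induction j)
  case (Suc j)
  have "zlog (Suc (Suc j)) \<tau> \<le> zlog (Suc j) \<tau>"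
    using zlog_pos[OF Suc.prems, of "Suc j"] ln_add_one_self_le_self[of "zlog (Suc j) \<tau>"] by simp
  then show ?case using Suc by linarith
qed simp

lemma zprod_ge_power: "\<tau> > 0 \<Longrightarrow> 1 \<le> zprod i \<tau> * (1 + \<tau>) ^ i"
proof -
  assume \<tau>: "\<tau> > 0"
  have "(\<Sum>j=1..i. zlog j \<tau>) \<le> (\<Sum>j=1..i. ln (1 + \<tau>))"
  proof (rule sum_mono)
    fix j assume "j \<in> {1..i}"
    then obtain k where "j = Suc k" by (cases j) auto
    then show "zlog j \<tau> \<le> ln (1 + \<tau>)" using zlog_le_ln[OF \<tau>] by blast
  qed
  then have "exp (\<Sum>j=1..i. zlog j \<tau>) \<le> exp (real i * ln (1 + \<tau>))" by simp
  also have "\<dots> = (1 + \<tau>) ^ i" using \<tau> by (simp add: exp_of_nat_mult)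
  finally show ?thesis by (simp add: zprod_def exp_minus field_simps)
qed

text \<open>
  The product \<open>X\<^sub>1 \<cdots> X\<^sub>j\<close> is the derivative of the \<open>j\<close>-th iterated logarithm, because
  \<open>1 + zlog j \<tau>\<close> is the reciprocal of \<open>X\<^bsub>j+1\<^esub>\<close>. All differential identities below reduce to this.
\<close>
lemma zlog_deriv: "\<tau> > 0 \<Longrightarrow> (zlog j has_real_derivative zprod j \<tau>) (at \<tau>)"
proof (induction j)
  case 0
  show ?case by (auto intro!: derivative_eq_intros simp: zlog.simps(1)[abs_def])
next
  case (Suc j)
  have "((\<lambda>\<tau>. ln (1 + zlog j \<tau>)) has_real_derivative zprod j \<tau> / (1 + zlog j \<tau>)) (at \<tau>)"
    using zlog_pos[OF Suc.prems, of j] Suc by (auto intro!: derivative_eq_intros)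
  then show ?case using Suc.prems by (simp add: zprod_Suc zlog.simps(2)[abs_def])
qed

lemma zprod_deriv:
  assumes "\<tau> > 0"
  shows "(zprod i has_real_derivative - zprod i \<tau> * (\<Sum>j=1..i. zprod j \<tau>)) (at \<tau>)"
proof -
  have "((\<lambda>\<tau>. exp (- (\<Sum>j=1..i. zlog j \<tau>))) has_real_derivative
      exp (- (\<Sum>j=1..i. zlog j \<tau>)) * (- (\<Sum>j=1..i. zprod j \<tau>))) (at \<tau>)"
    by (intro DERIV_fun_exp DERIV_minus DERIV_sum zlog_deriv assms)
  then show ?thesis by (simp add: zprod_def[abs_def])
qed

lemma Ck_on_zlog: "Ck_on k {0<..} (zlog j)"
proof (induction j)
  case 0
  then show ?case by (simp add: Ck_on_id_real zlog.simps(1)[abs_def] cong: Ck_on.simps)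
next
  case (Suc j)
  have "Ck_on k {0<..} (\<lambda>\<tau>. ln (1 + zlog j \<tau>))"
    using zlog_pos[of _ j] by (intro Ck_intros Suc) (auto intro: add_pos_pos)
  then show ?case by (simp add: zlog.simps(2)[abs_def])
qed

lemma Ck_on_zprod: "Ck_on k {0<..} (zprod i)"
  unfolding zprod_def[abs_def] by (intro Ck_intros Ck_on_zlog)

definition zsum :: "nat \<Rightarrow> real \<Rightarrow> real" where
  "zsum m \<tau> = (\<Sum>i=1..m. zprod i \<tau>)"

definition zsqsum :: "nat \<Rightarrow> real \<Rightarrow> real" where
  "zsqsum m \<tau> = (\<Sum>i=1..m. (zprod i \<tau>)\<^sup>2)"

lemma Ck_on_zsum: "Ck_on k {0<..} (zsum m)"
  unfolding zsum_def[abs_def] by (intro Ck_intros Ck_on_zprod)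

text \<open>
  Differentiating each product gives \<open>- (\<Sum>i\<le>m. \<Sum>j\<le>i. P\<^sub>i P\<^sub>j)\<close>, and a triangular double sum is half of the
  square of the sum plus half of the sum of squares. The squares are the logarithmic weights of the
  Hardy inequality.
\<close>
lemma zsum_deriv:
  assumes "\<tau> > 0"
  shows "(zsum m has_real_derivative - ((zsum m \<tau>)\<^sup>2 + zsqsum m \<tau>) / 2) (at \<tau>)"
proof -
  have "(zsum m has_real_derivative (\<Sum>i=1..m. - zprod i \<tau> * zsum i \<tau>)) (at \<tau>)"
    unfolding zsum_def[abs_def] by (intro DERIV_sum zprod_deriv assms)
  moreover have "(\<Sum>i=1..m. - zprod i \<tau> * zsum i \<tau>) = - ((zsum m \<tau>)\<^sup>2 + zsqsum m \<tau>) / 2"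
    by (induction m) (auto simp: zsum_def zsqsum_def power2_eq_square field_simps)
  ultimately show ?thesis by (simp only:)
qed

lemma ln_one_plus_ge_pade: "z \<ge> 0 \<Longrightarrow> 2 * z / (2 + z) \<le> ln (1 + z)" for z :: real
proof -
  assume z: "z \<ge> 0"
  have "ln (1 + 0) - 2 * 0 / (2 + 0) \<le> ln (1 + z) - 2 * z / (2 + z)"
  proof (rule DERIV_nonneg_imp_nondecreasing[OF z])
    fix x :: real assume x: "0 \<le> x" "x \<le> z"
    have "((\<lambda>z. ln (1 + z) - 2 * z / (2 + z)) has_real_derivative (1 / (1 + x) - 4 / (2 + x)\<^sup>2)) (at x)"
      using x by (auto intro!: derivative_eq_intros simp: power2_eq_square field_simps)
    moreover have "1 / (1 + x) - 4 / (2 + x)\<^sup>2 \<ge> 0"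
      using x by (simp add: power2_eq_square divide_simps) (simp add: algebra_simps)
    ultimately show "\<exists>y. ((\<lambda>z. ln (1 + z) - 2 * z / (2 + z)) has_real_derivative y) (at x) \<and> 0 \<le> y" by blast
  qed
  then show ?thesis by simp
qed

text \<open>
  The products decay like \<open>1/k\<^sup>2\<close>, which ratio tests do not see. The quotient of \<open>P\<^sub>k\<close> by the \<open>k\<close>-th iterated
  logarithm \<open>z\<close> decreases, and in one step by at least half of \<open>P\<^bsub>k+1\<^esub>\<close>: with \<open>P\<^bsub>k+1\<^esub> = P\<^sub>k / (1 + z)\<close> this is
  the bound \<open>2 z / (2 + z) \<le> ln (1 + z)\<close>. Hence the series converges with the explicit bound \<open>2 / \<tau>\<close>.
\<close>
lemma zprod_Suc_le_telescope:
  assumes "\<tau> > 0"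
  shows "zprod (Suc k) \<tau> \<le> 2 * (zprod k \<tau> / zlog k \<tau> - zprod (Suc k) \<tau> / zlog (Suc k) \<tau>)"
proof -
  define z where "z = zlog k \<tau>"
  have z: "z > 0" using zlog_pos[OF assms] by (simp add: z_def)
  have "1 / ln (1 + z) \<le> (2 + z) / (2 * z)"
    using ln_one_plus_ge_pade[of z] z by (simp add: divide_simps mult.commute)
  then have "1 / (1 + z) * (1 / ln (1 + z)) \<le> 1 / (1 + z) * ((2 + z) / (2 * z))"
    using z by (intro mult_left_mono) auto
  moreover have "1 / (1 + z) = 2 * (1 / z - 1 / (1 + z) * ((2 + z) / (2 * z)))"
    using z by (simp add: divide_simps)
  ultimately have "1 / (1 + z) \<le> 2 * (1 / z - 1 / (1 + z) * (1 / ln (1 + z)))"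
    by (smt (verit, best))
  then have "zprod k \<tau> * (1 / (1 + z)) \<le> zprod k \<tau> * (2 * (1 / z - 1 / (1 + z) * (1 / ln (1 + z))))"
    using zprod_pos[of k \<tau>] by (intro mult_left_mono) auto
  then show ?thesis using assms by (simp add: zprod_Suc z_def[symmetric] algebra_simps)
qed

lemma sum_zprod_Suc_le: "\<tau> > 0 \<Longrightarrow> (\<Sum>k<N. zprod (Suc k) \<tau>) \<le> 2 / \<tau>"
proof -
  assume \<tau>: "\<tau> > 0"
  have "(\<Sum>k<N. zprod (Suc k) \<tau>) \<le> 2 * (1 / \<tau> - zprod N \<tau> / zlog N \<tau>)"
  proof (induction N)
    case (Suc N)
    then show ?case using zprod_Suc_le_telescope[OF \<tau>, of N] by simp
  qed simp
  moreover have "zprod N \<tau> / zlog N \<tau> \<ge> 0" using zprod_pos[of N \<tau>] zlog_pos[OF \<tau>, of N] by simp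
  ultimately have "(\<Sum>k<N. zprod (Suc k) \<tau>) \<le> 2 * (1 / \<tau>)" by (smt (verit))
  then show ?thesis by simp
qed

lemma summable_zprod: "\<tau> > 0 \<Longrightarrow> summable (\<lambda>k. zprod (Suc k) \<tau>)"
  by (rule bounded_imp_summable[where B = "2 / \<tau>"])
     (use zprod_pos sum_zprod_Suc_le[of \<tau> "Suc _"] in \<open>auto simp: lessThan_Suc_atMost intro: less_imp_le\<close>)

lemma suminf_zprod_le: "\<tau> > 0 \<Longrightarrow> (\<Sum>k. zprod (Suc k) \<tau>) \<le> 2 / \<tau>"
  by (intro suminf_le_const summable_zprod sum_zprod_Suc_le)

lemma zprod_1: "zprod (Suc 0) \<tau> = exp (- ln (1 + \<tau>))"
  by (simp add: zprod_def)

lemma suminf_zprod_strict_antimono: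
  assumes "0 < \<tau>" "\<tau> < \<tau>'"
  shows "(\<Sum>k. zprod (Suc k) \<tau>') < (\<Sum>k. zprod (Suc k) \<tau>)"
proof -
  have "0 < (\<Sum>k. zprod (Suc k) \<tau> - zprod (Suc k) \<tau>')"
  proof (rule suminf_pos2)
    show "summable (\<lambda>k. zprod (Suc k) \<tau> - zprod (Suc k) \<tau>')"
      by (intro summable_diff summable_zprod) (use assms in auto)
    show "0 \<le> zprod (Suc k) \<tau> - zprod (Suc k) \<tau>'" for k using zprod_antimono[of \<tau> \<tau>'] assms by simp
    show "0 < zprod (Suc 0) \<tau> - zprod (Suc 0) \<tau>'" using assms by (simp add: zprod_1)
  qed
  then show ?thesis using assms by (subst (asm) suminf_diff[symmetric]) (auto intro!: summable_zprod)
qed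

text \<open>
  Intermediate values on \<open>[1, 8]\<close>: at \<open>8\<close> the bound \<open>2 / \<tau>\<close> is \<open>1/4\<close>, while at \<open>1\<close> the first term alone is
  \<open>1/2\<close>. Monotonicity of the terms makes the convergence uniform.
\<close>
lemma ex_suminf_zprod_eq_quarter: "\<exists>\<tau>>0. (\<Sum>k. zprod (Suc k) \<tau>) = 1 / 4"
proof -
  have "continuous_on {1..8} (\<lambda>\<tau>. \<Sum>k. zprod (Suc k) \<tau>)"
  proof (rule uniform_limit_theorem[OF _ Weierstrass_m_test])
    show "\<forall>\<^sub>F n in sequentially. continuous_on {1..8} (\<lambda>x. \<Sum>i<n. zprod (Suc i) x)"
      by (intro always_eventually allI continuous_on_sum continuous_on_subset[OF Ck_on_imp_continuous[OF Ck_on_zprod]]) auto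
    show "norm (zprod (Suc n) x) \<le> zprod (Suc n) 1" if "x \<in> {1..8}" for n x
      using that zprod_antimono[of 1 x] zprod_pos[of "Suc n" x] by simp
    show "summable (\<lambda>k. zprod (Suc k) 1)" by (intro summable_zprod) auto
  qed auto
  moreover have "(\<Sum>k. zprod (Suc k) 8) \<le> 1 / 4" using suminf_zprod_le[of 8] by simp
  moreover have "1 / 4 \<le> (\<Sum>k. zprod (Suc k) 1)"
  proof -
    have "zprod (Suc 0) 1 \<le> (\<Sum>k. zprod (Suc k) 1)"
      using sum_le_suminf[OF summable_zprod[of 1], of "{0}"] zprod_pos by (auto intro: less_imp_le)
    then show ?thesis by (simp add: zprod_1 exp_minus)
  qed
  ultimately obtain \<tau> where "1 \<le> \<tau>" "(\<Sum>k. zprod (Suc k) \<tau>) = 1 / 4"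
    using IVT2'[of "\<lambda>\<tau>. \<Sum>k. zprod (Suc k) \<tau>" 8 "1/4" 1] by auto
  then show ?thesis by (intro exI[of _ \<tau>]) auto
qed

text \<open>
  The definite description is well defined: a solution exists by intermediate values and is unique
  because the series is strictly monotone.
\<close>
lemma kappa_gt_1: "kappa > 1" and suminf_zprod_ln_kappa: "(\<Sum>k. zprod (Suc k) (ln kappa)) = 1 / 4"
proof -
  define Q where "Q k \<longleftrightarrow> k > 1 \<and> (\<lambda>i. log_prod (Suc i) (1 / k)) sums (1 / 4)" for k
  have Q: "Q k \<longleftrightarrow> k > 1 \<and> (\<Sum>i. zprod (Suc i) (ln k)) = 1 / 4" for k
  proof (cases "k > 1")
    case True
    then have l: "ln k > 0" by simp
    have "log_prod (Suc i) (1 / k) = zprod (Suc i) (ln k)" for i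
      using True by (subst log_prod_eq_zprod) (auto simp: ln_div)
    then show ?thesis using True summable_zprod[OF l] by (auto simp: Q_def sums_iff)
  qed (auto simp: Q_def)
  obtain \<tau> where \<tau>: "\<tau> > 0" "(\<Sum>k. zprod (Suc k) \<tau>) = 1 / 4" using ex_suminf_zprod_eq_quarter by auto
  have "Q (exp \<tau>)" using \<tau> by (simp add: Q)
  moreover have "k = exp \<tau>" if "Q k" for k
  proof -
    have "ln k = \<tau>"
      using that \<tau> suminf_zprod_strict_antimono[of \<tau> "ln k"] suminf_zprod_strict_antimono[of "ln k" \<tau>]
      unfolding Q by (cases "ln k" \<tau> rule: linorder_cases) auto
    then show ?thesis using that unfolding Q by (metis exp_ln zero_less_one order_less_trans)
  qed
  ultimately have "Q kappa" unfolding kappa_def Q_def[symmetric] by (rule theI)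
  then show "kappa > 1" "(\<Sum>k. zprod (Suc k) (ln kappa)) = 1 / 4" by (auto simp: Q)
qed

lemma zsum_le_quarter:
  assumes "ln kappa \<le> \<tau>"
  shows "zsum m \<tau> \<le> 1 / 4"
proof -
  have l: "ln kappa > 0" using kappa_gt_1 by simp
  have "zsum m \<tau> \<le> zsum m (ln kappa)"
    unfolding zsum_def using assms l by (intro sum_mono zprod_antimono)
  also have "\<dots> = (\<Sum>k<m. zprod (Suc k) (ln kappa))"
    unfolding zsum_def by (rule sum.reindex_bij_witness[of _ Suc "\<lambda>i. i - 1"]) auto
  also have "\<dots> \<le> (\<Sum>k. zprod (Suc k) (ln kappa))"
    using summable_zprod[OF l] zprod_pos by (intro sum_le_suminf) (auto intro: less_imp_le)
  finally show ?thesis by (simp add: suminf_zprod_ln_kappa)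
qed

lemma zsum_nonneg: "zsum m \<tau> \<ge> 0"
  unfolding zsum_def by (intro sum_nonneg less_imp_le zprod_pos)

section \<open>Hardy inequalities from vector fields\<close>

lemma set_integral_zero_outside:
  fixes f :: "'a \<Rightarrow> real"
  assumes "\<And>x. x \<notin> \<Omega> \<Longrightarrow> f x = 0"
  shows "(LINT x:\<Omega>|M. f x) = (LINT x|M. f x)"
proof -
  have "(\<lambda>x. indicator \<Omega> x *\<^sub>R f x) = f" using assms by (auto simp: indicator_def fun_eq_iff)
  then show ?thesis by (simp add: set_lebesgue_integral_def)
qed

lemma test_functionsE:
  assumes "u \<in> test_functions \<Omega>"
  obtains K where "compact K" "K \<subseteq> \<Omega>" "\<And>x. x \<notin> K \<Longrightarrow> u x = 0" "\<And>k. Ck_on k UNIV u"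
proof (rule that[of "closure {x. u x \<noteq> 0}"])
  show "u x = 0" if "x \<notin> closure {x. u x \<noteq> 0}" for x
    using that closure_subset[of "{x. u x \<noteq> 0}"] by auto
qed (use assms in \<open>auto simp: test_functions_def Ck_on_UNIV_iff\<close>)

lemma test_functionsI:
  assumes "compact K" "K \<subseteq> \<Omega>" "\<And>x. x \<notin> K \<Longrightarrow> u x = 0" "\<And>k. Ck_on k UNIV u"
  shows "u \<in> test_functions \<Omega>"
proof -
  have "closure {x. u x \<noteq> 0} \<subseteq> K"
    by (rule closure_minimal) (use assms in \<open>auto intro: compact_imp_closed\<close>)
  moreover have "bounded {x. u x \<noteq> 0}"
    using assms(1,3) by (auto intro: bounded_subset[OF compact_imp_bounded])
  ultimately show ?thesis using assms
    by (auto simp: test_functions_def Ck_on_UNIV_iff compact_closure)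
qed

lemma has_derivative_gradient:
  fixes u :: "real ^ 'n::finite \<Rightarrow> real"
  assumes "Ck_on 1 UNIV u"
  shows "(u has_derivative (\<lambda>h. h \<bullet> gradient u x)) (at x)"
proof -
  have d: "(u has_derivative frechet_derivative u (at x)) (at x)"
    using assms Ck_on_UNIV_iff[of 1 u] by (auto simp: differentiable_on_def frechet_derivative_works)
  have l: "linear (frechet_derivative u (at x))" using d has_derivative_linear by blast
  have "frechet_derivative u (at x) = (\<lambda>h. h \<bullet> gradient u x)"
  proof
    fix h
    have "frechet_derivative u (at x) h = frechet_derivative u (at x) (\<Sum>b\<in>Basis. (h \<bullet> b) *\<^sub>R b)"
      by (simp only: euclidean_representation)
    also have "\<dots> = (\<Sum>b\<in>Basis. (h \<bullet> b) * frechet_derivative u (at x) b)"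
      by (simp only: linear_sum[OF l] linear_cmul[OF l] real_scaleR_def)
    also have "\<dots> = h \<bullet> gradient u x"
      unfolding sum_Basis_vec by (simp add: gradient_def inner_axis) (simp add: inner_vec_def)
    finally show "frechet_derivative u (at x) h = h \<bullet> gradient u x" .
  qed
  with d show ?thesis by simp
qed

lemma gradient_eqI:
  fixes u :: "real ^ 'n::finite \<Rightarrow> real"
  assumes "(u has_derivative (\<lambda>h. h \<bullet> g)) (at x)"
  shows "gradient u x = g"
  using frechet_derivative_at[OF assms, symmetric]
  by (simp add: gradient_def vec_eq_iff inner_axis')

lemma gradient_compact_support:
  fixes u :: "real ^ 'n::finite \<Rightarrow> real"
  assumes "Ck_on 1 UNIV u" "compact K" "\<And>x. x \<notin> K \<Longrightarrow> u x = 0"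
  shows "integrable lborel (\<lambda>x. (norm (gradient u x))\<^sup>2)" "\<And>x. x \<notin> K \<Longrightarrow> gradient u x = 0"
proof -
  note g = directional_derivative_integral_eq_0[OF assms has_derivative_gradient[OF assms(1)]]
  show z: "gradient u x = 0" if "x \<notin> K" for x
    using g(4)[OF _ that, of "gradient u x"] by simp
  have "continuous_on UNIV (\<lambda>x. (norm (gradient u x))\<^sup>2)"
    unfolding power2_norm_eq_inner by (subst euclidean_inner, subst (1 2) inner_commute) (intro continuous_intros g(3))
  then show "integrable lborel (\<lambda>x. (norm (gradient u x))\<^sup>2)"
    by (rule integrable_continuous_compact_support[OF open_UNIV assms(2), rotated 2]) (auto simp: z)
qed

text \<open>
  Expand \<open>|\<nabla>u - u A|\<^sup>2 \<ge> 0\<close> and integrate the mixed term by parts: the Dirichlet energy dominates the integral of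
  \<open>- (div A + |A|\<^sup>2) u\<^sup>2\<close>. For \<open>A = \<nabla>\<phi> / \<phi>\<close> this weight is \<open>- \<Delta>\<phi> / \<phi>\<close>, so that \<open>A\<close> encodes a positive supersolution. The
  field is a combination of two fields with scalar coefficients, one centred at \<open>- v\<close> and one at the origin.
\<close>
lemma hardy_from_vector_field:
  fixes u a b V :: "real ^ 'n::finite \<Rightarrow> real" and a' b' :: "real ^ 'n \<Rightarrow> real ^ 'n \<Rightarrow> real" and v :: "real ^ 'n"
  assumes u: "u \<in> test_functions \<Omega>" and \<Omega>: "open \<Omega>"
    and a: "Ck_on 1 \<Omega> a" "\<And>x. x \<in> \<Omega> \<Longrightarrow> (a has_derivative a' x) (at x)"
    and b: "Ck_on 1 \<Omega> b" "\<And>x. x \<in> \<Omega> \<Longrightarrow> (b has_derivative b' x) (at x)"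
    and V: "continuous_on \<Omega> V"
    and le: "\<And>x. x \<in> \<Omega> \<Longrightarrow> CARD('n) * a x + a' x (x + v) + CARD('n) * b x + b' x x
         + (norm (a x *\<^sub>R (x + v) + b x *\<^sub>R x))\<^sup>2 \<le> - V x"
  shows "(LINT x:\<Omega>|lborel. V x * (u x)\<^sup>2) \<le> dirichlet_energy \<Omega> u"
proof -
  obtain K where K: "compact K" "K \<subseteq> \<Omega>" "\<And>x. x \<notin> K \<Longrightarrow> u x = 0" and uC: "\<And>k. Ck_on k UNIV u"
    using u by (rule test_functionsE) blast
  note du = has_derivative_gradient[OF uC]
  note grad = gradient_compact_support[OF uC K(1,3)]
  have uc: "continuous_on \<Omega> u" using uC[of 0] by (auto intro: continuous_on_subset)
  define F where "F c c' x h = (if x \<in> \<Omega> then (u x)\<^sup>2 * c' x h + 2 * u x * (h \<bullet> gradient u x) * c x else 0)"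
    for c :: "real ^ 'n \<Rightarrow> real" and c' x h
  have F: "Ck_on 1 UNIV (\<lambda>x. (u x)\<^sup>2 * c x)" "\<And>x. ((\<lambda>x. (u x)\<^sup>2 * c x) has_derivative F c c' x) (at x)"
    if c: "Ck_on 1 \<Omega> c" "\<And>x. x \<in> \<Omega> \<Longrightarrow> (c has_derivative c' x) (at x)" for c c'
  proof -
    show "Ck_on 1 UNIV (\<lambda>x. (u x)\<^sup>2 * c x)"
      by (rule Ck_on_zero_extension[OF \<Omega> compact_imp_closed[OF K(1)] K(2)])
         (simp add: K(3), intro Ck_intros c Ck_on_subset[OF uC] subset_UNIV)
    fix x
    show "((\<lambda>x. (u x)\<^sup>2 * c x) has_derivative F c c' x) (at x)"
    proof (cases "x \<in> \<Omega>")
      case True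
      have "((\<lambda>x. (u x)\<^sup>2 * c x) has_derivative (\<lambda>h. (u x)\<^sup>2 * c' x h + 2 * u x * (h \<bullet> gradient u x) * c x)) (at x)"
        by (rule derivative_eq_intros du c(2)[OF True] refl)+ (auto simp: algebra_simps)
      then show ?thesis using True by (simp add: F_def[abs_def])
    next
      case False
      have "((\<lambda>x. (u x)\<^sup>2 * c x) has_derivative (\<lambda>h. 0)) (at x)"
        by (rule has_derivative_transform_within_open[of "\<lambda>x. 0" _ _ UNIV "-K"])
           (use False K in \<open>auto intro: compact_imp_closed\<close>)
      then show ?thesis using False by (simp add: F_def[abs_def])
    qed
  qed
  have I: "integrable lborel (\<lambda>x. CARD('n) * ((u x)\<^sup>2 * c x) + F c c' x (x + w))"
      "(LINT x|lborel. CARD('n) * ((u x)\<^sup>2 * c x) + F c c' x (x + w)) = 0"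
    if c: "Ck_on 1 \<Omega> c" "\<And>x. x \<in> \<Omega> \<Longrightarrow> (c has_derivative c' x) (at x)" for c c' w
  proof -
    have z: "(u x)\<^sup>2 * c x = 0" if "x \<notin> K" for x using K(3)[OF that] by simp
    have "Ck_on 1 UNIV (\<lambda>x. (u x)\<^sup>2 * c x)" "\<And>x. ((\<lambda>x. (u x)\<^sup>2 * c x) has_derivative F c c' x) (at x)"
      using F c by blast+
    from divergence_scaled_translate_eq_0[OF this(1) K(1) z this(2)]
    show "integrable lborel (\<lambda>x. CARD('n) * ((u x)\<^sup>2 * c x) + F c c' x (x + w))"
      "(LINT x|lborel. CARD('n) * ((u x)\<^sup>2 * c x) + F c c' x (x + w)) = 0" by auto
  qed
  define S where "S x = (CARD('n) * ((u x)\<^sup>2 * a x) + F a a' x (x + v)) + (CARD('n) * ((u x)\<^sup>2 * b x) + F b b' x (x + 0))" for x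
  have S: "integrable lborel S" "integral\<^sup>L lborel S = 0"
    unfolding S_def using I[OF a, of v] I[OF b, of 0] by auto
  have VK: "integrable lborel (\<lambda>x. V x * (u x)\<^sup>2)"
    by (rule integrable_continuous_compact_support[OF \<Omega> K(1,2)]) (auto simp: K(3) intro!: continuous_intros V uc)
  have "S x \<le> (norm (gradient u x))\<^sup>2 - V x * (u x)\<^sup>2" for x
  proof (cases "x \<in> \<Omega>")
    case True
    define A where "A = a x *\<^sub>R (x + v) + b x *\<^sub>R x"
    have "S x = (u x)\<^sup>2 * (CARD('n) * a x + a' x (x + v) + CARD('n) * b x + b' x x)
              + 2 * u x * (A \<bullet> gradient u x)"
      using True by (simp add: S_def F_def A_def inner_add_left algebra_simps)
    also have "\<dots> \<le> (u x)\<^sup>2 * (- V x - (norm A)\<^sup>2) + 2 * u x * (A \<bullet> gradient u x)"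
      using le[OF True] by (intro add_right_mono mult_left_mono) (auto simp: A_def)
    also have "\<dots> = (norm (gradient u x))\<^sup>2 - V x * (u x)\<^sup>2 - (norm (gradient u x - u x *\<^sub>R A))\<^sup>2"
      unfolding power2_norm_eq_inner
      by (simp add: inner_diff_left inner_diff_right inner_commute algebra_simps power2_eq_square)
    finally show ?thesis using zero_le_power2[of "norm (gradient u x - u x *\<^sub>R A)"] by linarith
  next
    case False
    then have "u x = 0" using K by auto
    then show ?thesis using False by (simp add: S_def F_def)
  qed
  then have "integral\<^sup>L lborel S \<le> (LINT x|lborel. (norm (gradient u x))\<^sup>2 - V x * (u x)\<^sup>2)"
    by (intro integral_mono S Bochner_Integration.integrable_diff grad VK)
  also have "\<dots> = (LINT x|lborel. (norm (gradient u x))\<^sup>2) - (LINT x|lborel. V x * (u x)\<^sup>2)"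
    by (intro Bochner_Integration.integral_diff grad VK)
  also have "(LINT x|lborel. (norm (gradient u x))\<^sup>2) = dirichlet_energy \<Omega> u"
    unfolding dirichlet_energy_def using K grad(2) by (subst set_integral_zero_outside) auto
  also have "(LINT x|lborel. V x * (u x)\<^sup>2) = (LINT x:\<Omega>|lborel. V x * (u x)\<^sup>2)"
    using K by (subst set_integral_zero_outside) auto
  finally show ?thesis using S(2) by simp
qed

text \<open>
  The pointwise inequality for the field of the supersolution
  \<open>q exp (- c q) \<cdot> |x| powr (- n/2) \<cdot> (X\<^sub>1 \<cdots> X\<^sub>m) powr (- 1/2) \<cdot> exp (- |x| / (2 D))\<close>, where
  \<open>q = |x|\<^sup>2 + 2 \<rho> x\<^sub>n\<close> vanishes on the sphere of the exterior ball and \<open>y = |x| / D\<close>. The radial part produces exactly the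
  Hardy weights, plus a gain of order \<open>y\<close> from the last factor that is positive because \<open>\<eta> \<le> 1/4\<close>. The
  constant \<open>c\<close> is chosen such that the terms of order \<open>1/q\<close> add up to something nonpositive; no bounded quantity
  could absorb them near the sphere. What remains has order \<open>|x| / \<rho>\<close> and is absorbed by the gain when \<open>\<rho>\<close> is large compared
  with \<open>D\<close>.
\<close>
lemma hardy_field_algebra:
  fixes n r \<rho> q \<eta> Q y :: real
  defines "c \<equiv> n / (8 * \<rho>\<^sup>2)" and "\<beta> \<equiv> - (n / 2) - \<eta> / 2 - y / 2"
  assumes r: "0 < r" "r \<le> \<rho>" and q: "0 < q" "q \<le> r\<^sup>2 + 2 * \<rho> * r"
    and n: "0 < n" and y: "0 \<le> y" "y \<le> 1" and \<eta>: "0 \<le> \<eta>" "\<eta> \<le> 1 / 4"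
    and small: "n * (n + 1) * (r / \<rho>) \<le> y / 8"
  shows "n * (2 * (1 / q - c)) + - 4 * (q + \<rho>\<^sup>2) / q\<^sup>2 + n * (\<beta> / r\<^sup>2)
      + (- (\<eta>\<^sup>2 + Q) / 4 - y / 2 - 2 * \<beta>) / r\<^sup>2
      + ((2 * (1 / q - c))\<^sup>2 * (q + \<rho>\<^sup>2) + 2 * (1 / q - c) * (\<beta> / r\<^sup>2) * (q + r\<^sup>2) + (\<beta> / r\<^sup>2)\<^sup>2 * r\<^sup>2)
      \<le> - ((n\<^sup>2 / 4 + Q / 4) / r\<^sup>2)" (is "?T \<le> _")
proof -
  have \<rho>: "\<rho> > 0" using r by simp
  define \<gamma> where "\<gamma> = \<eta> / 2 + y / 2"
  have \<gamma>: "0 \<le> \<gamma>" "\<gamma> \<le> 1" using y \<eta> by (auto simp: \<gamma>_def)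
  have \<beta>: "\<beta> = - n / 2 - \<gamma>" by (simp add: \<beta>_def \<gamma>_def)
  have c: "c > 0" using n \<rho> by (simp add: c_def)
  have c8: "8 * c * \<rho>\<^sup>2 = n" using \<rho> by (simp add: c_def)
  have T: "?T = (n * \<beta> + \<beta>\<^sup>2 - (\<eta>\<^sup>2 + Q) / 4 - y / 2) / r\<^sup>2 + (2 * n + 2 * \<beta> - 8 * c * \<rho>\<^sup>2) / q
      + (4 * q * c\<^sup>2 + 4 * c * (c * \<rho>\<^sup>2) - 8 * c - 2 * n * c - 2 * c * \<beta>) - 2 * c * \<beta> * q / r\<^sup>2"
    using r q by (simp add: field_simps power2_eq_square)
  have "r\<^sup>2 * ?T = (n * \<beta> + \<beta>\<^sup>2 - (\<eta>\<^sup>2 + Q) / 4 - y / 2) + (2 * n + 2 * \<beta> - 8 * c * \<rho>\<^sup>2) / q * r\<^sup>2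
      + (4 * q * c\<^sup>2 + 4 * c * (c * \<rho>\<^sup>2) - 8 * c - 2 * n * c - 2 * c * \<beta>) * r\<^sup>2 - 2 * c * \<beta> * q"
    unfolding T using r by (simp add: field_simps)
  also have "(n * \<beta> + \<beta>\<^sup>2 - (\<eta>\<^sup>2 + Q) / 4 - y / 2) = - (n\<^sup>2 / 4) - Q / 4 + y / 2 * (\<eta> + y / 2 - 1)"
    by (simp add: \<beta>_def field_simps power2_eq_square)
  also have "(2 * n + 2 * \<beta> - 8 * c * \<rho>\<^sup>2) / q * r\<^sup>2 = - (2 * \<gamma> / q * r\<^sup>2)"
    unfolding c8 \<beta> by (simp add: field_simps)
  also have "4 * q * c\<^sup>2 + 4 * c * (c * \<rho>\<^sup>2) - 8 * c - 2 * n * c - 2 * c * \<beta>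
      = 4 * q * c\<^sup>2 - n * c / 2 - (8 - 2 * \<gamma>) * c"
    using c8 by (simp add: \<beta> algebra_simps) 
  also have "2 * c * \<beta> * q = - ((n + 2 * \<gamma>) * (c * q))" by (simp add: \<beta> algebra_simps)
  finally have eq: "r\<^sup>2 * ?T = - (n\<^sup>2 / 4) - Q / 4 + y / 2 * (\<eta> + y / 2 - 1) + - (2 * \<gamma> / q * r\<^sup>2)
      + (4 * q * c\<^sup>2 - n * c / 2 - (8 - 2 * \<gamma>) * c) * r\<^sup>2 + (n + 2 * \<gamma>) * (c * q)"
    by (simp add: \<beta> algebra_simps)
  have e1: "y / 2 * (\<eta> + y / 2 - 1) \<le> y / 2 * (- 1 / 4)" using y \<eta> by (intro mult_left_mono) auto
  have e2: "2 * \<gamma> / q * r\<^sup>2 \<ge> 0" using \<gamma> q by simp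
  have qr: "q \<le> 3 * \<rho> * r" 
  proof -
    have "r * r \<le> \<rho> * r" using r by (intro mult_right_mono) auto
    then show ?thesis using q(2) by (simp add: power2_eq_square)
  qed
  have cq: "c * q \<le> 3 * n / 8 * (r / \<rho>)"
  proof -
    have "c * q \<le> c * (3 * \<rho> * r)" using qr c by (intro mult_left_mono) auto
    also have "\<dots> = 3 * n / 8 * (r / \<rho>)" using \<rho> by (simp add: c_def field_simps power2_eq_square)
    finally show ?thesis .
  qed
  have cr: "c * r\<^sup>2 \<le> n / 8"
  proof -
    have "c * r\<^sup>2 \<le> c * \<rho>\<^sup>2" using c r by (intro mult_left_mono power_mono) auto
    then show ?thesis using c8 by simp
  qed
  have e3: "(4 * q * c\<^sup>2 - n * c / 2 - (8 - 2 * \<gamma>) * c) * r\<^sup>2 \<le> n / 2 * (3 * n / 8 * (r / \<rho>))"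
  proof -
    have "(4 * q * c\<^sup>2 - n * c / 2 - (8 - 2 * \<gamma>) * c) * r\<^sup>2 \<le> 4 * q * c\<^sup>2 * r\<^sup>2"
    proof (intro mult_right_mono)
      have "n * c \<ge> 0" "(8 - 2 * \<gamma>) * c \<ge> 0" using n c \<gamma> by auto
      then show "4 * q * c\<^sup>2 - n * c / 2 - (8 - 2 * \<gamma>) * c \<le> 4 * q * c\<^sup>2" by linarith
    qed simp
    also have "\<dots> = 4 * (c * r\<^sup>2) * (c * q)" by (simp add: power2_eq_square)
    also have "\<dots> \<le> 4 * (n / 8) * (3 * n / 8 * (r / \<rho>))"
      by (rule mult_mono) (use cq cr c q n in auto)
    finally show ?thesis by simp
  qed
  have e4: "(n + 2 * \<gamma>) * (c * q) \<le> (n + 2) * (3 * n / 8 * (r / \<rho>))"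
    by (rule mult_mono) (use \<gamma> cq n c q in auto)
  have "n / 2 * (3 * n / 8 * (r / \<rho>)) + (n + 2) * (3 * n / 8 * (r / \<rho>)) \<le> n * (n + 1) * (r / \<rho>)"
  proof -
    have "n * (n + 1) * t - (n / 2 * (3 * n / 8 * t) + (n + 2) * (3 * n / 8 * t))
        = (7 / 16 * n\<^sup>2 + n / 4) * t" for t by (simp add: field_simps power2_eq_square)
    from this[of "r / \<rho>"]
    have "n * (n + 1) * (r / \<rho>) - (n / 2 * (3 * n / 8 * (r / \<rho>)) + (n + 2) * (3 * n / 8 * (r / \<rho>)))
        = (7 / 16 * n\<^sup>2 + n / 4) * (r / \<rho>)" .
    also have "\<dots> \<ge> 0" using n r by simp
    finally show ?thesis by simp
  qed
  then have "r\<^sup>2 * ?T \<le> - (n\<^sup>2 / 4 + Q / 4)" using eq e1 e2 e3 e4 small by simp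
  moreover have "T \<le> - (X / r\<^sup>2)" if "r\<^sup>2 * T \<le> - X" for T X :: real
  proof -
    have "T = (r\<^sup>2 * T) / r\<^sup>2" using r by simp
    also have "\<dots> \<le> - X / r\<^sup>2" by (rule divide_right_mono[OF that]) simp
    finally show ?thesis by simp
  qed
  ultimately show ?thesis by blast
qed

section \<open>The improved Hardy inequality\<close>

lemma norm_has_derivative:
  fixes x :: "'a::real_inner"
  assumes "x \<noteq> 0"
  shows "(norm has_derivative (\<lambda>h. (h \<bullet> x) / norm x)) (at x)"
  using has_derivative_norm[OF assms] by (simp add: sgn_div_norm divide_inverse mult.commute)

text \<open>
  What the analysis uses of the domain: the origin lies outside, and \<open>D\<close> bounds the distances to the origin,
  so that the argument of the logarithms is at most \<open>1 / (3 \<kappa>)\<close>.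
\<close>
locale punctured_domain =
  fixes \<Omega> :: "(real ^ 'n::finite) set" and D :: real
  assumes open_domain: "open \<Omega>" and zero_notin: "0 \<notin> \<Omega>"
    and norm_le: "\<And>x. x \<in> \<Omega> \<Longrightarrow> norm x \<le> D" and D_pos: "D > 0"
begin

definition "outer_scale = 3 * kappa * D"

text \<open>
  Logarithmic distance to the origin. In this variable the radial derivative \<open>|x| \<partial>/\<partial>|x|\<close> is \<open>- d/d\<tau>\<close>.
\<close>
definition tau :: "real ^ 'n \<Rightarrow> real" where
  "tau x = ln (outer_scale / norm x)"

lemma outer_scale_pos: "outer_scale > 0"
  using kappa_gt_1 D_pos by (simp add: outer_scale_def)

lemma norm_pos: "x \<in> \<Omega> \<Longrightarrow> norm x > 0"
  using zero_notin by auto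

lemma ln_kappa_le_tau: assumes "x \<in> \<Omega>" shows "ln kappa \<le> tau x"
proof -
  have "kappa * norm x \<le> kappa * (3 * D)"
    using norm_le[OF assms] kappa_gt_1 D_pos by (intro mult_left_mono) auto
  then have "kappa \<le> outer_scale / norm x"
    using norm_pos[OF assms] by (simp add: outer_scale_def field_simps)
  then show ?thesis using kappa_gt_1 by (simp add: tau_def)
qed

lemma tau_pos: "x \<in> \<Omega> \<Longrightarrow> tau x > 0"
  using ln_kappa_le_tau[of x] kappa_gt_1 by (smt (verit) ln_gt_zero)

lemma log_prod_eq:
  assumes "x \<in> \<Omega>"
  shows "log_prod i (norm x / (3 * kappa * D)) = zprod i (tau x)"
proof -
  have "exp (- tau x) = norm x / outer_scale"
    using norm_pos[OF assms] outer_scale_pos by (simp add: tau_def exp_minus)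
  then show ?thesis using log_prod_exp[OF tau_pos[OF assms], of i] by (simp add: outer_scale_def)
qed

lemma tau_has_derivative:
  assumes "x \<noteq> 0"
  shows "(tau has_derivative (\<lambda>h. - (h \<bullet> x) / (norm x)\<^sup>2)) (at x)"
proof -
  have "((\<lambda>x. ln outer_scale - ln (norm x)) has_derivative (\<lambda>h. - (h \<bullet> x) / (norm x)\<^sup>2)) (at x)"
    using assms by (auto intro!: derivative_eq_intros norm_has_derivative simp: power2_eq_square divide_inverse)
  then show ?thesis
    by (rule has_derivative_transform_within_open[of _ _ x UNIV "-{0}"])
       (use assms outer_scale_pos in \<open>auto simp: tau_def ln_div\<close>)
qed

lemma Ck_on_tau: assumes "open U" "0 \<notin> U" shows "Ck_on k U tau"
  by (rule Ck_on_cong[OF assms(1), of "\<lambda>x. ln outer_scale - ln (norm x)"])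
     (use assms outer_scale_pos in \<open>auto simp: tau_def ln_div intro!: Ck_intros\<close>)

lemma Ck_on_zprod_tau: "Ck_on k \<Omega> (\<lambda>x. zprod i (tau x))"
  by (rule Ck_on_compose[OF Ck_on_zprod Ck_on_tau[OF open_domain zero_notin]]) (use tau_pos in auto)

lemma hardy_term_eq:
  assumes "u \<in> test_functions \<Omega>"
  shows "hardy_term \<Omega> D i u = (LINT x|lborel. (u x)\<^sup>2 / (norm x)\<^sup>2 * (zprod i (tau x))\<^sup>2)"
    "integrable lborel (\<lambda>x. (u x)\<^sup>2 / (norm x)\<^sup>2 * (zprod i (tau x))\<^sup>2)"
proof -
  obtain K where K: "compact K" "K \<subseteq> \<Omega>" "\<And>x. x \<notin> K \<Longrightarrow> u x = 0" "\<And>k. Ck_on k UNIV u"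
    using assms by (rule test_functionsE) blast
  have "hardy_term \<Omega> D i u = (LINT x:\<Omega>|lborel. (u x)\<^sup>2 / (norm x)\<^sup>2 * (zprod i (tau x))\<^sup>2)"
    unfolding hardy_term_def
    by (rule set_lebesgue_integral_cong) (use open_domain log_prod_eq in auto)
  also have "\<dots> = (LINT x|lborel. (u x)\<^sup>2 / (norm x)\<^sup>2 * (zprod i (tau x))\<^sup>2)"
    by (rule set_integral_zero_outside) (use K in auto)
  finally show "hardy_term \<Omega> D i u = (LINT x|lborel. (u x)\<^sup>2 / (norm x)\<^sup>2 * (zprod i (tau x))\<^sup>2)" .
  show "integrable lborel (\<lambda>x. (u x)\<^sup>2 / (norm x)\<^sup>2 * (zprod i (tau x))\<^sup>2)"
  proof (rule integrable_continuous_compact_support[OF open_domain K(1,2)])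
    have "continuous_on \<Omega> u" using K(4)[of 0] by (auto intro: continuous_on_subset)
    then show "continuous_on \<Omega> (\<lambda>x. (u x)\<^sup>2 / (norm x)\<^sup>2 * (zprod i (tau x))\<^sup>2)"
      using Ck_on_imp_continuous[OF Ck_on_zprod_tau] zero_notin by (intro continuous_intros) auto
  qed (use K in auto)
qed

lemma leading_term_eq:
  assumes "u \<in> test_functions \<Omega>"
  shows "(LINT x:\<Omega>|lborel. (u x)\<^sup>2 / (norm x)\<^sup>2) = (LINT x|lborel. (u x)\<^sup>2 / (norm x)\<^sup>2)"
    "integrable lborel (\<lambda>x. (u x)\<^sup>2 / (norm x)\<^sup>2)"
proof -
  obtain K where K: "K \<subseteq> \<Omega>" "\<And>x. x \<notin> K \<Longrightarrow> u x = 0"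
    using assms by (rule test_functionsE) blast
  show "(LINT x:\<Omega>|lborel. (u x)\<^sup>2 / (norm x)\<^sup>2) = (LINT x|lborel. (u x)\<^sup>2 / (norm x)\<^sup>2)"
    by (rule set_integral_zero_outside) (use K in auto)
  show "integrable lborel (\<lambda>x. (u x)\<^sup>2 / (norm x)\<^sup>2)" using hardy_term_eq(2)[OF assms, of 0] by simp
qed

lemma hardy_term_nonneg: "u \<in> test_functions \<Omega> \<Longrightarrow> hardy_term \<Omega> D i u \<ge> 0"
  by (simp add: hardy_term_eq)

text \<open>
  A continuous function that is not identically zero does not vanish on a nonempty open set, and such
  a set is not a null set.
\<close>
lemma hardy_term_pos:
  assumes u: "u \<in> test_functions \<Omega>" and nz: "u x0 \<noteq> 0"
  shows "hardy_term \<Omega> D i u > 0"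
proof -
  obtain K where K: "compact K" "K \<subseteq> \<Omega>" "\<And>x. x \<notin> K \<Longrightarrow> u x = 0" "\<And>k. Ck_on k UNIV u"
    using u by (rule test_functionsE) blast
  have uc: "continuous_on UNIV u" using K(4)[of 0] by simp
  let ?g = "\<lambda>x. (u x)\<^sup>2 / (norm x)\<^sup>2 * (zprod i (tau x))\<^sup>2"
  have "hardy_term \<Omega> D i u \<noteq> 0"
  proof
    assume "hardy_term \<Omega> D i u = 0"
    then have "AE x in lborel. ?g x = 0"
      using integral_nonneg_eq_0_iff_AE[OF hardy_term_eq(2)[OF u, of i]] hardy_term_eq(1)[OF u, of i] by simp
    moreover have "?g x = 0 \<longrightarrow> u x = 0" for x
    proof (cases "x \<in> \<Omega>")
      case True
      then show ?thesis using norm_pos[OF True] zprod_pos[of i "tau x"] by auto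
    qed (use K in auto)
    ultimately have "AE x in lborel. u x = 0" by (auto elim: AE_mp)
    moreover have "open {x. u x \<noteq> 0}"
      using open_Collect_neq[OF uc continuous_on_const[of UNIV 0]] by simp
    ultimately have "{x. u x \<noteq> 0} = {}"
      using AE_iff_null[of lborel "\<lambda>x. u x = 0"] open_not_negligible[of "{x. u x \<noteq> 0}"]
      by (auto simp: negligible_iff_null_sets borel_open intro: null_sets_completionI)
    then show False using nz by auto
  qed
  then show ?thesis using hardy_term_nonneg[OF u, of i] by simp
qed

text \<open>
  All that is left after the pointwise inequality is to compute the divergence and the norm of the field. The
  position vectors \<open>x + v\<close> and \<open>x\<close> have inner products that are polynomials in \<open>q\<close> and \<open>|x|\<close>, so everything
  reduces to these two scalars.
\<close>
lemma improved_hardy_finite: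
  fixes e :: 'n and \<rho> :: real
  defines "n \<equiv> real CARD('n)"
  defines "q \<equiv> \<lambda>x. (norm x)\<^sup>2 + 2 * \<rho> * (x \<bullet> axis e 1)"
  assumes u: "u \<in> test_functions \<Omega>"
    and \<rho>: "\<rho> > 0" "8 * n * (n + 1) * D \<le> \<rho>"
    and q_pos: "\<And>x. x \<in> \<Omega> \<Longrightarrow> q x > 0"
  shows "n\<^sup>2 / 4 * (LINT x:\<Omega>|lborel. (u x)\<^sup>2 / (norm x)\<^sup>2) + 1 / 4 * (\<Sum>i=1..m. hardy_term \<Omega> D i u)
      \<le> dirichlet_energy \<Omega> u"
proof -
  have n: "n \<ge> 1" by (simp add: n_def Suc_le_eq)
  define v :: "real ^ 'n" where "v = \<rho> *\<^sub>R axis e 1"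
  define c where "c = n / (8 * \<rho>\<^sup>2)"
  \<comment> \<open>The logarithmic radial derivative of \<open>\<phi>\<close>, one summand for each radial factor.\<close>
  define \<beta> where "\<beta> x = - (n / 2) - zsum m (tau x) / 2 - norm x / D / 2" for x
  define a where "a x = 2 * (inverse (q x) - c)" for x
  define b where "b x = \<beta> x * inverse ((norm x)\<^sup>2)" for x
  define a' where "a' x h = - 2 * (2 * (h \<bullet> x) + 2 * \<rho> * (h \<bullet> axis e 1)) / (q x)\<^sup>2" for x h
  define d\<beta> where "d\<beta> x h = (- ((zsum m (tau x))\<^sup>2 + zsqsum m (tau x)) / 4 / (norm x)\<^sup>2 - 1 / (2 * D * norm x)) * (h \<bullet> x)" for x h
  define b' where "b' x h = d\<beta> x h / (norm x)\<^sup>2 - 2 * \<beta> x * (h \<bullet> x) / (norm x) ^ 4" for x h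
  define V where "V x = (n\<^sup>2 / 4 + zsqsum m (tau x) / 4) / (norm x)\<^sup>2" for x
  have Cq: "Ck_on 1 \<Omega> q" unfolding q_def by (intro Ck_intros)
  have Ca: "Ck_on 1 \<Omega> a" unfolding a_def by (intro Ck_intros Cq) (rule q_pos)
  have Ctau: "Ck_on 1 \<Omega> tau" by (rule Ck_on_tau[OF open_domain zero_notin])
  have Czs: "Ck_on 1 \<Omega> (\<lambda>x. zsum m (tau x))"
    by (rule Ck_on_compose[OF Ck_on_zsum Ctau]) (use tau_pos in auto)
  have Cb: "Ck_on 1 \<Omega> b"
    unfolding b_def \<beta>_def by (intro Ck_intros Czs open_domain zero_notin) (use D_pos norm_pos in auto)
  have Vc: "continuous_on \<Omega> V"
    unfolding V_def zsqsum_def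
    by (intro continuous_intros Ck_on_imp_continuous[OF Ck_on_zprod_tau[of 1]]) (use zero_notin in auto)
  have da: "(a has_derivative a' x) (at x)" if x: "x \<in> \<Omega>" for x
  proof -
    have "(q has_derivative (\<lambda>h. 2 * (h \<bullet> x) + 2 * \<rho> * (h \<bullet> axis e 1))) (at x)"
      unfolding q_def power2_norm_eq_inner
      by (auto intro!: derivative_eq_intros simp: inner_commute)
    then show ?thesis
      unfolding a_def a'_def using q_pos[OF x]
      by (auto intro!: derivative_eq_intros simp: power2_eq_square field_simps)
  qed
  have db: "(b has_derivative b' x) (at x)" if x: "x \<in> \<Omega>" for x
  proof -
    have x0: "x \<noteq> 0" using x zero_notin by auto
    have "((\<lambda>x. zsum m (tau x)) has_derivative (\<lambda>h. ((zsum m (tau x))\<^sup>2 + zsqsum m (tau x)) / 2 / (norm x)\<^sup>2 * (h \<bullet> x))) (at x)"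
      using has_derivative_compose[OF tau_has_derivative[OF x0] zsum_deriv[OF tau_pos[OF x], unfolded has_field_derivative_def]]
      by (rule has_derivative_eq_rhs) (use x0 in \<open>auto simp: fun_eq_iff field_simps\<close>)
    then have "(\<beta> has_derivative d\<beta> x) (at x)"
      unfolding \<beta>_def d\<beta>_def using D_pos x0
      by (auto intro!: derivative_eq_intros norm_has_derivative simp: fun_eq_iff field_simps)
    moreover have "((\<lambda>x. inverse ((norm x)\<^sup>2)) has_derivative (\<lambda>h. - 2 * (h \<bullet> x) / (norm x) ^ 4)) (at x)"
      unfolding power2_norm_eq_inner using x0
      by (auto intro!: derivative_eq_intros simp: fun_eq_iff inner_commute power2_norm_eq_inner[symmetric] field_simps)
    ultimately have "(b has_derivative (\<lambda>h. \<beta> x * (- 2 * (h \<bullet> x) / (norm x) ^ 4) + d\<beta> x h * inverse ((norm x)\<^sup>2))) (at x)"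
      unfolding b_def by (rule has_derivative_mult)
    then show ?thesis by (rule has_derivative_eq_rhs) (auto simp: b'_def fun_eq_iff field_simps)
  qed
  have ineq: "CARD('n) * a x + a' x (x + v) + CARD('n) * b x + b' x x
         + (norm (a x *\<^sub>R (x + v) + b x *\<^sub>R x))\<^sup>2 \<le> - V x" if x: "x \<in> \<Omega>" for x
  proof -
    define r where "r = norm x"
    define \<eta> where "\<eta> = zsum m (tau x)"
    define Q where "Q = zsqsum m (tau x)"
    define y where "y = r / D"
    have r: "r > 0" "r \<le> D" using norm_pos[OF x] norm_le[OF x] by (auto simp: r_def)
    \<comment> \<open>The lower bound on \<open>\<rho>\<close> also gives \<open>|x| \<le> \<rho>\<close>, which bounds \<open>q\<close> by \<open>3 \<rho> |x|\<close>.\<close>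
    have "1 * D \<le> (8 * n * (n + 1)) * D"
      using n D_pos mult_mono[of 1 n 1 "n + 1"] by (intro mult_right_mono) auto
    then have "r \<le> \<rho>" using r \<rho>(2) by linarith
    have q: "q x > 0" by (rule q_pos[OF x])
    have xa: "x \<bullet> axis e 1 \<le> r" using norm_cauchy_schwarz[of x "axis e 1"] by (simp add: r_def norm_axis_1)
    have xv: "x \<bullet> axis e 1 = (q x - r\<^sup>2) / (2 * \<rho>)" using \<rho> by (simp add: q_def r_def)
    have ql: "q x \<le> r\<^sup>2 + 2 * \<rho> * r" using xa \<rho> by (simp add: q_def r_def)
    have small: "n * (n + 1) * (r / \<rho>) \<le> y / 8"
    proof -
      have "r * (8 * n * (n + 1) * D) \<le> r * \<rho>" using \<rho>(2) r by (intro mult_left_mono) auto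
      then show ?thesis using \<rho>(1) D_pos by (simp add: y_def divide_simps) (simp add: algebra_simps)
    qed
    have "- (n / 2) - \<eta> / 2 - y / 2 = \<beta> x" by (simp add: \<beta>_def \<eta>_def y_def r_def)
    note key = hardy_field_algebra[OF r(1) \<open>r \<le> \<rho>\<close> q ql, of n y \<eta> Q, unfolded this]
    have xx: "x \<bullet> x = r\<^sup>2" by (simp add: r_def power2_norm_eq_inner)
    have aa: "axis e 1 \<bullet> (axis e 1 :: real ^ 'n) = 1" by (simp add: inner_axis_axis)
    have vv: "(x + v) \<bullet> (x + v) = q x + \<rho>\<^sup>2"
      using \<rho> by (simp add: v_def inner_add_left inner_add_right xx aa inner_commute xv power2_eq_square)
    have vx: "(x + v) \<bullet> x = (q x + r\<^sup>2) / 2"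
      using \<rho> by (simp add: v_def inner_add_left inner_add_right xx aa inner_commute xv power2_eq_square field_simps)
    have ve: "(x + v) \<bullet> x + \<rho> * ((x + v) \<bullet> axis e 1) = q x + \<rho>\<^sup>2"
      using vv by (simp add: v_def inner_add_right)
    have "a' x (x + v) = - 2 * (2 * ((x + v) \<bullet> x + \<rho> * ((x + v) \<bullet> axis e 1))) / (q x)\<^sup>2"
      by (simp add: a'_def algebra_simps)
    also have "\<dots> = - 4 * (q x + \<rho>\<^sup>2) / (q x)\<^sup>2" unfolding ve by simp
    finally have 1: "a' x (x + v) = - 4 * (q x + \<rho>\<^sup>2) / (q x)\<^sup>2" .
    have 2: "b' x x = (- (\<eta>\<^sup>2 + Q) / 4 - y / 2 - 2 * \<beta> x) / r\<^sup>2"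
      using r D_pos unfolding b'_def d\<beta>_def xx r_def[symmetric] \<eta>_def[symmetric] Q_def[symmetric] y_def
      by (simp add: field_simps power2_eq_square power4_eq_xxxx)
    have 3: "a x = 2 * (1 / q x - c)" "b x = \<beta> x / r\<^sup>2"
      by (simp_all add: a_def b_def r_def divide_inverse)
    have 4: "(norm (a x *\<^sub>R (x + v) + b x *\<^sub>R x))\<^sup>2 = (a x)\<^sup>2 * (q x + \<rho>\<^sup>2) + a x * b x * (q x + r\<^sup>2) + (b x)\<^sup>2 * r\<^sup>2"
    proof -
      have "(norm (a x *\<^sub>R (x + v) + b x *\<^sub>R x))\<^sup>2
          = (a x)\<^sup>2 * ((x + v) \<bullet> (x + v)) + 2 * (a x * b x * ((x + v) \<bullet> x)) + (b x)\<^sup>2 * (x \<bullet> x)"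
        unfolding power2_norm_eq_inner
        by (simp only: inner_add_left[of "a x *\<^sub>R (x + v)"] inner_add_right[of _ "a x *\<^sub>R (x + v)"] inner_scaleR_left inner_scaleR_right inner_commute[of x "x + v"])
           (simp add: power2_eq_square algebra_simps)
      then show ?thesis unfolding vv vx xx by simp
    qed
    have y: "0 \<le> y" "y \<le> 1" using r D_pos by (auto simp: y_def)
    have \<eta>: "0 \<le> \<eta>" "\<eta> \<le> 1 / 4"
      unfolding \<eta>_def using zsum_nonneg zsum_le_quarter[OF ln_kappa_le_tau[OF x]] by auto
    show ?thesis
      using key[folded c_def, OF _ y \<eta> small] n
      unfolding 4 1 2 unfolding 3 V_def Q_def[symmetric] r_def[symmetric] n_def[symmetric]
      by (simp add: mult.assoc add.assoc)
  qed
  have "(LINT x:\<Omega>|lborel. V x * (u x)\<^sup>2) \<le> dirichlet_energy \<Omega> u"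
    by (rule hardy_from_vector_field[OF u open_domain Ca da Cb db Vc ineq])
  also have "(LINT x:\<Omega>|lborel. V x * (u x)\<^sup>2) = (LINT x|lborel. V x * (u x)\<^sup>2)"
  proof -
    obtain K where K: "K \<subseteq> \<Omega>" "\<And>x. x \<notin> K \<Longrightarrow> u x = 0" using u by (rule test_functionsE) blast
    show ?thesis by (rule set_integral_zero_outside) (use K in auto)
  qed
  also have "\<dots> = (LINT x|lborel. n\<^sup>2 / 4 * ((u x)\<^sup>2 / (norm x)\<^sup>2)
      + 1 / 4 * (\<Sum>i=1..m. (u x)\<^sup>2 / (norm x)\<^sup>2 * (zprod i (tau x))\<^sup>2))"
    by (intro Bochner_Integration.integral_cong refl)
       (simp add: V_def zsqsum_def sum_distrib_left sum_divide_distrib add_divide_distrib algebra_simps)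
  also have "\<dots> = n\<^sup>2 / 4 * (LINT x:\<Omega>|lborel. (u x)\<^sup>2 / (norm x)\<^sup>2) + 1 / 4 * (\<Sum>i=1..m. hardy_term \<Omega> D i u)"
    unfolding hardy_term_eq(1)[OF u] leading_term_eq(1)[OF u]
    by (subst Bochner_Integration.integral_add,
        intro integrable_mult_right leading_term_eq(2)[OF u],
        intro integrable_mult_right Bochner_Integration.integrable_sum hardy_term_eq(2)[OF u],
        simp only: integral_mult_right_zero,
        subst Bochner_Integration.integral_sum, rule hardy_term_eq(2)[OF u], rule refl)
  finally show ?thesis .
qed

end

text \<open>
  Points of the domain lie outside the open ball by assumption, and outside its sphere because every
  neighbourhood of a point of the sphere meets the ball.
\<close>
lemma exterior_ball_imp_pos:
  fixes \<Omega> :: "(real ^ 'n::finite) set"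
  assumes "open \<Omega>" "\<rho> > 0" "ball (- \<rho> *\<^sub>R axis e 1) \<rho> \<subseteq> - closure \<Omega>" "x \<in> \<Omega>"
  shows "(norm x)\<^sup>2 + 2 * \<rho> * (x \<bullet> axis e 1) > 0"
proof -
  let ?c = "- \<rho> *\<^sub>R axis e 1 :: real ^ 'n"
  have "x \<notin> cball ?c \<rho>"
  proof
    assume "x \<in> cball ?c \<rho>"
    then have "x \<in> closure (ball ?c \<rho>)" using assms(2) by simp
    moreover have "closure (ball ?c \<rho>) \<subseteq> - \<Omega>"
      by (rule closure_minimal) (use assms closure_subset[of \<Omega>] in auto)
    ultimately show False using assms(4) by auto
  qed
  then have "norm (x + \<rho> *\<^sub>R axis e 1) > \<rho>" by (simp add: dist_norm norm_minus_commute)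
  then have "(norm (x + \<rho> *\<^sub>R axis e 1))\<^sup>2 > \<rho>\<^sup>2" using assms(2) by (intro power_strict_mono) auto
  then show ?thesis
    unfolding power2_norm_eq_inner
    by (simp add: inner_add_left inner_add_right inner_axis_axis inner_commute power2_eq_square algebra_simps)
qed

section \<open>Integrals of products of radial and angular functions\<close>

text \<open>
  The angular variable; test functions will depend on the angle through it only.
\<close>
definition cosine :: "'n \<Rightarrow> real ^ 'n::finite \<Rightarrow> real" where
  "cosine e x = (x \<bullet> axis e 1) / norm x"

lemma abs_cosine_le: "\<bar>cosine e x\<bar> \<le> 1"
  using Cauchy_Schwarz_ineq2[of x "axis e 1"] by (cases "x = 0") (auto simp: cosine_def norm_axis_1 divide_simps)

lemma cosine_uminus [simp]: "cosine e (- x) = - cosine e x"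
  by (simp add: cosine_def)

context punctured_domain
begin

text \<open>
  Products of a power of \<open>|x|\<close>, a radial and an angular factor. When \<open>f\<close> lives on a bounded interval, they vanish
  near the origin, hence all regularity questions concern the complement of the origin.
\<close>
definition separable :: "'n \<Rightarrow> real \<Rightarrow> (real \<Rightarrow> real) \<Rightarrow> (real \<Rightarrow> real) \<Rightarrow> real ^ 'n \<Rightarrow> real" where
  "separable e p f W x = norm x powr p * f (tau x) * W (cosine e x)"

definition annulus :: "real \<Rightarrow> real \<Rightarrow> (real ^ 'n) set" where
  "annulus lo hi = {x. outer_scale * exp (- hi) \<le> norm x \<and> norm x \<le> outer_scale * exp (- lo)}"

lemma compact_annulus: "compact (annulus lo hi)"
proof -
  have "closed (annulus lo hi)"
    unfolding annulus_def by (intro closed_Collect_conj closed_Collect_le continuous_intros)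
  moreover have "annulus lo hi \<subseteq> cball 0 (outer_scale * exp (- lo))" by (auto simp: annulus_def)
  ultimately show ?thesis using bounded_subset[OF bounded_cball] by (simp add: compact_eq_bounded_closed)
qed

lemma zero_notin_annulus: "0 \<notin> annulus lo hi"
  using outer_scale_pos by (simp add: annulus_def not_le)

lemma tau_in_iff_annulus: "x \<noteq> 0 \<Longrightarrow> lo \<le> tau x \<and> tau x \<le> hi \<longleftrightarrow> x \<in> annulus lo hi"
proof -
  assume x: "x \<noteq> 0"
  have e: "norm x = outer_scale * exp (- tau x)"
    using x outer_scale_pos by (simp add: tau_def exp_minus)
  show ?thesis unfolding annulus_def mem_Collect_eq e using outer_scale_pos by auto
qed

lemma separable_zero_outside:
  assumes "\<And>t. t \<notin> {lo..hi} \<Longrightarrow> f t = 0" "x \<notin> annulus lo hi"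
  shows "separable e p f W x = 0"
proof (cases "x = 0")
  case False
  then have "tau x \<notin> {lo..hi}" using tau_in_iff_annulus assms(2) by auto
  then show ?thesis using assms(1) by (simp add: separable_def)
qed (simp add: separable_def)

lemma Ck_on_cosine: "Ck_on k (-{0}) (cosine e)"
  unfolding cosine_def[abs_def] by (intro Ck_intros) auto

lemma Ck_on_separable:
  assumes "Ck_on k UNIV f" "\<And>t. t \<notin> {lo..hi} \<Longrightarrow> f t = 0" "Ck_on k UNIV W"
  shows "Ck_on k UNIV (separable e p f W)"
proof (rule Ck_on_zero_extension[of "-{0}"])
  show "Ck_on k (-{0}) (separable e p f W)"
  proof (rule Ck_on_cong)
    show "Ck_on k (-{0}) (\<lambda>x. exp (p * ln (norm x)) * f (tau x) * W (cosine e x))"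
      by (intro Ck_intros Ck_on_compose[OF assms(1) Ck_on_tau] Ck_on_compose[OF assms(3) Ck_on_cosine]) auto
    show "exp (p * ln (norm x)) * f (tau x) * W (cosine e x) = separable e p f W x" if "x \<in> -{0}" for x
      using that by (simp add: separable_def powr_def)
  qed auto
  show "closed (annulus lo hi)" by (intro compact_imp_closed compact_annulus)
qed (use zero_notin_annulus separable_zero_outside[OF assms(2)] in auto)

lemma integrable_separable:
  assumes "continuous_on UNIV f" "\<And>t. t \<notin> {lo..hi} \<Longrightarrow> f t = 0" "continuous_on UNIV W"
  shows "integrable lborel (separable e p f W)"
proof (rule integrable_continuous_compact_support[OF open_UNIV compact_annulus])
  show "continuous_on UNIV (separable e p f W)" using Ck_on_separable[of 0 f lo hi W e p] assms by auto
qed (use separable_zero_outside[OF assms(2)] in auto)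

text \<open>
  With the exponent \<open>- n\<close> the measure is invariant under dilations, so the integral ought to split into a
  radial factor \<open>\<integral> f\<close> and a spherical factor. The two lemmas
  \<open>polar_integral_derivative_eq_0\<close> and \<open>polar_integral_sphere_parts\<close> express the consequences of such a splitting
  as divergence identities.
\<close>
definition polar_integral :: "'n \<Rightarrow> (real \<Rightarrow> real) \<Rightarrow> (real \<Rightarrow> real) \<Rightarrow> real" where
  "polar_integral e f W = integral\<^sup>L lborel (separable e (- real CARD('n)) f W)"

lemma cosine_has_derivative:
  assumes "x \<noteq> 0"
  shows "(cosine e has_derivative (\<lambda>h. (h \<bullet> axis e 1) / norm x - cosine e x * (h \<bullet> x) / (norm x)\<^sup>2)) (at x)"
  unfolding cosine_def[abs_def] using assms
  by (auto intro!: derivative_eq_intros norm_has_derivative simp: fun_eq_iff field_simps power2_eq_square)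

lemma separable_has_derivative:
  assumes f: "\<And>t. (f has_real_derivative f' t) (at t)" and W: "\<And>s. (W has_real_derivative W' s) (at s)"
    and supp: "\<And>t. t \<notin> {lo..hi} \<Longrightarrow> f t = 0"
  shows "(separable e p f W has_derivative (\<lambda>h. if x = 0 then 0 else
      norm x powr p * ((p * f (tau x) - f' (tau x)) * W (cosine e x) * (h \<bullet> x) / (norm x)\<^sup>2
        + f (tau x) * W' (cosine e x) * ((h \<bullet> axis e 1) / norm x - cosine e x * (h \<bullet> x) / (norm x)\<^sup>2)))) (at x)"
proof (cases "x = 0")
  case True
  have "(separable e p f W has_derivative (\<lambda>h. 0)) (at x)"
    by (rule has_derivative_transform_within_open[of "\<lambda>x. 0" _ _ UNIV "- annulus lo hi"])
       (use True compact_imp_closed[OF compact_annulus] zero_notin_annulus separable_zero_outside[OF supp] in auto)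
  then show ?thesis using True by simp
next
  case False
  have df: "((\<lambda>x. f (tau x)) has_derivative (\<lambda>h. f' (tau x) * (- (h \<bullet> x) / (norm x)\<^sup>2))) (at x)"
    using has_derivative_compose[OF tau_has_derivative[OF False] f[unfolded has_field_derivative_def]] by simp
  have dW: "((\<lambda>x. W (cosine e x)) has_derivative (\<lambda>h. W' (cosine e x) * ((h \<bullet> axis e 1) / norm x - cosine e x * (h \<bullet> x) / (norm x)\<^sup>2))) (at x)"
    using has_derivative_compose[OF cosine_has_derivative[OF False] W[unfolded has_field_derivative_def]] by simp
  have dp: "((\<lambda>x. norm x powr p) has_derivative (\<lambda>h. p * norm x powr p * (h \<bullet> x) / (norm x)\<^sup>2)) (at x)"
  proof -
    have "((\<lambda>r. r powr p) has_derivative (\<lambda>h. p * norm x powr (p - 1) * h)) (at (norm x))"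
      using False has_real_derivative_powr[of "norm x" p] by (simp add: has_field_derivative_def)
    from has_derivative_compose[OF norm_has_derivative[OF False] this]
    show ?thesis
      by (rule has_derivative_eq_rhs) (use False in \<open>auto simp: fun_eq_iff powr_diff power2_eq_square\<close>)
  qed
  have "(separable e p f W has_derivative (\<lambda>h. (norm x powr p * f (tau x)) * (W' (cosine e x) * ((h \<bullet> axis e 1) / norm x - cosine e x * (h \<bullet> x) / (norm x)\<^sup>2))
     + (norm x powr p * (f' (tau x) * (- (h \<bullet> x) / (norm x)\<^sup>2)) + p * norm x powr p * (h \<bullet> x) / (norm x)\<^sup>2 * f (tau x)) * W (cosine e x))) (at x)"
    unfolding separable_def[abs_def] by (intro has_derivative_mult dp df dW)
  then show ?thesis
    by (rule has_derivative_eq_rhs) (use False in \<open>auto simp: fun_eq_iff add_divide_distrib diff_divide_distrib algebra_simps\<close>)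
qed

text \<open>
  A radial integrand with a compactly supported primitive integrates to zero: apply the divergence
  theorem to the primitive times the field \<open>x\<close>, along which the angle is constant.
\<close>
lemma polar_integral_derivative_eq_0:
  assumes f: "Ck_on 1 UNIV f" "\<And>t. (f has_real_derivative f' t) (at t)" "\<And>t. t \<notin> {lo..hi} \<Longrightarrow> f t = 0"
    and W: "Ck_on 1 UNIV W" "\<And>s. (W has_real_derivative W' s) (at s)"
  shows "polar_integral e f' W = 0"
proof -
  let ?R = "separable e (- real CARD('n)) f W"
  have z: "?R x = 0" if "x \<notin> annulus lo hi" for x
    by (rule separable_zero_outside[OF f(3) that])
  note div = divergence_scaled_translate_eq_0(2)[OF Ck_on_separable[where lo = lo and hi = hi, OF f(1) _ W(1)] compact_annulus z
      separable_has_derivative[where lo = lo and hi = hi, OF f(2) W(2) f(3)], where v = 0]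
  \<comment> \<open>The angle does not change along \<open>x\<close>, and the power of \<open>|x|\<close> cancels the dimension.\<close>
  have eq: "DIM(real ^ 'n) * ?R x + (if x = 0 then 0 else
      norm x powr (- real CARD('n)) * ((- real CARD('n) * f (tau x) - f' (tau x)) * W (cosine e x) * ((x + 0) \<bullet> x) / (norm x)\<^sup>2
        + f (tau x) * W' (cosine e x) * (((x + 0) \<bullet> axis e 1) / norm x - cosine e x * ((x + 0) \<bullet> x) / (norm x)\<^sup>2)))
    = - separable e (- real CARD('n)) f' W x" for x
  proof (cases "x = 0")
    case False
    then have "(x + 0) \<bullet> x = (norm x)\<^sup>2" "((x + 0) \<bullet> axis e 1) / norm x = cosine e x"
      by (simp_all add: power2_norm_eq_inner cosine_def)
    then show ?thesis using False by (simp add: separable_def field_simps)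
  qed (simp add: separable_def)
  have "(LINT x|lborel. - separable e (- real CARD('n)) f' W x) = 0"
    unfolding eq[symmetric] by (rule div) (use f(3) in auto)
  then show ?thesis by (simp add: polar_integral_def)
qed

lemma polar_integral_linear:
  assumes "continuous_on UNIV f" "\<And>t. t \<notin> {lo..hi} \<Longrightarrow> f t = 0" "continuous_on UNIV W"
    and "continuous_on UNIV g" "\<And>t. t \<notin> {lo..hi} \<Longrightarrow> g t = 0" "continuous_on UNIV V"
  shows "(LINT x|lborel. separable e (- real CARD('n)) f W x + c * separable e (- real CARD('n)) g V x)
     = polar_integral e f W + c * polar_integral e g V"
  unfolding polar_integral_def
  using integrable_separable[OF assms(1-3)] integrable_separable[OF assms(4-6)] by simp

lemma polar_integral_mono:
  assumes "continuous_on UNIV f" "\<And>t. t \<notin> {lo..hi} \<Longrightarrow> f t = 0" "continuous_on UNIV W"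
    and "continuous_on UNIV g" "\<And>t. t \<notin> {lo..hi} \<Longrightarrow> g t = 0" "continuous_on UNIV V"
    and le: "\<And>t s. \<bar>s\<bar> \<le> 1 \<Longrightarrow> f t * W s \<le> g t * V s"
  shows "polar_integral e f W \<le> polar_integral e g V"
  unfolding polar_integral_def
proof (intro integral_mono integrable_separable[OF assms(1-3)] integrable_separable[OF assms(4-6)])
  show "separable e (- real CARD('n)) f W x \<le> separable e (- real CARD('n)) g V x" for x
    using mult_left_mono[OF le[OF abs_cosine_le, of "tau x" e x], of "norm x powr (- real CARD('n))"]
    by (simp add: separable_def mult.assoc)
qed

text \<open>
  Integration by parts on the sphere: apply the divergence theorem to a field in the direction of
  \<open>e\<^sub>n\<close>, along which the cosine \<open>s\<close> has derivative \<open>(1 - s\<^sup>2) / |x|\<close>; the terms with the radial derivative of \<open>f\<close>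
  integrate to zero.
\<close>
lemma polar_integral_sphere_parts:
  assumes f: "Ck_on 1 UNIV f" "\<And>t. (f has_real_derivative f' t) (at t)" "\<And>t. t \<notin> {lo..hi} \<Longrightarrow> f t = 0"
    and f'0: "\<And>t. t \<notin> {lo..hi} \<Longrightarrow> f' t = 0" and f'c: "continuous_on UNIV f'"
    and Y: "Ck_on 1 UNIV Y" "\<And>s. (Y has_real_derivative Y' s) (at s)" and Y'c: "continuous_on UNIV Y'"
  shows "polar_integral e f (\<lambda>s. (1 - s\<^sup>2) * Y' s) = (CARD('n) - 1) * polar_integral e f (\<lambda>s. s * Y s)"
proof -
  let ?p = "1 - real CARD('n)"
  let ?R = "separable e ?p f Y"
  have z: "?R x = 0" if "x \<notin> annulus lo hi" for x
    by (rule separable_zero_outside[OF f(3) that])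
  note der = directional_derivative_integral_eq_0(2)[OF Ck_on_separable[where lo = lo and hi = hi, OF f(1) _ Y(1)] compact_annulus z
      separable_has_derivative[where lo = lo and hi = hi, OF f(2) Y(2) f(3)], where v = "axis e 1"]
  let ?S = "separable e (- real CARD('n))"
  have fc: "continuous_on UNIV f" and Yc: "continuous_on UNIV Y"
    using f(1) Y(1) by (auto intro: Ck_on_imp_continuous)
  have sYC: "Ck_on 1 UNIV (\<lambda>s. s * Y s)" by (intro Ck_intros Y)
  have eq: "(if x = 0 then 0 else
      norm x powr ?p * ((?p * f (tau x) - f' (tau x)) * Y (cosine e x) * (axis e 1 \<bullet> x) / (norm x)\<^sup>2
        + f (tau x) * Y' (cosine e x) * ((axis e 1 \<bullet> (axis e 1 :: real ^ 'n)) / norm x - cosine e x * (axis e 1 \<bullet> x) / (norm x)\<^sup>2)))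
    = (?S f (\<lambda>s. (1 - s\<^sup>2) * Y' s) x + ?p * ?S f (\<lambda>s. s * Y s) x) + (- 1) * ?S f' (\<lambda>s. s * Y s) x" for x
  proof (cases "x = 0")
    case False
    have 1: "axis e 1 \<bullet> x = norm x * cosine e x" using False by (simp add: cosine_def inner_commute)
    have 2: "axis e 1 \<bullet> (axis e 1 :: real ^ 'n) = 1" by (simp add: inner_axis_axis)
    have 3: "norm x powr ?p = norm x * norm x powr (- real CARD('n))" using False by (simp add: powr_diff powr_minus divide_inverse)
    show ?thesis unfolding 1 2 3 using False
      by (simp add: separable_def field_simps power2_eq_square)
  qed (simp add: separable_def)
  have "0 = (LINT x|lborel. (?S f (\<lambda>s. (1 - s\<^sup>2) * Y' s) x + ?p * ?S f (\<lambda>s. s * Y s) x) + (- 1) * ?S f' (\<lambda>s. s * Y s) x)"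
    unfolding eq[symmetric] by (rule der[symmetric]) (use f(3) in auto)
  also have "\<dots> = (LINT x|lborel. ?S f (\<lambda>s. (1 - s\<^sup>2) * Y' s) x + ?p * ?S f (\<lambda>s. s * Y s) x) - polar_integral e f' (\<lambda>s. s * Y s)"
    unfolding polar_integral_def
    by (subst Bochner_Integration.integral_add)
       (auto intro!: Bochner_Integration.integrable_add integrable_mult_right integrable_separable[OF fc f(3)] integrable_separable[OF f'c f'0] continuous_intros Y'c Yc)
  also have "(LINT x|lborel. ?S f (\<lambda>s. (1 - s\<^sup>2) * Y' s) x + ?p * ?S f (\<lambda>s. s * Y s) x)
      = polar_integral e f (\<lambda>s. (1 - s\<^sup>2) * Y' s) + ?p * polar_integral e f (\<lambda>s. s * Y s)"
    by (rule polar_integral_linear[OF fc f(3) _ fc f(3)]) (auto intro!: continuous_intros Y'c Yc)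
  also have "polar_integral e f' (\<lambda>s. s * Y s) = 0"
    by (rule polar_integral_derivative_eq_0[OF f sYC, where W' = "\<lambda>s. Y s + s * Y' s"])
       (auto intro!: derivative_eq_intros Y(2))
  finally show ?thesis by (simp add: algebra_simps)
qed

lemma polar_integral_reflect:
  assumes "continuous_on UNIV f" "\<And>t. t \<notin> {lo..hi} \<Longrightarrow> f t = 0" "continuous_on UNIV W"
  shows "polar_integral e f (\<lambda>s. W (- s)) = polar_integral e f W"
proof -
  have "separable e (- real CARD('n)) f (\<lambda>s. W (- s)) = (\<lambda>x. separable e (- real CARD('n)) f W (- x))"
    by (simp add: separable_def tau_def fun_eq_iff)
  then show ?thesis unfolding polar_integral_def
    using lborel_integral_reflection[of "separable e (- real CARD('n)) f W"] borel_measurable_integrable[OF integrable_separable[OF assms]]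
    by simp
qed

end

section \<open>Angular cut-off\<close>

text \<open>
  A smooth convex substitute for the positive part of \<open>s - \<delta>\<close>. The half-space ground state is
  proportional to the cosine \<open>s\<close> and vanishes only on the boundary plane; cutting it off at the angle \<open>s = \<delta>\<close> keeps
  the support in a cone, whose part near the origin lies inside the interior ball.
\<close>
definition cap :: "real \<Rightarrow> real \<Rightarrow> real" where
  "cap \<delta> s = (s - \<delta>) * flat_exp 0 ((s - \<delta>) / \<delta>)"

definition cap_deriv :: "real \<Rightarrow> real \<Rightarrow> real" where
  "cap_deriv \<delta> s = flat_exp 0 ((s - \<delta>) / \<delta>) + flat_exp 1 ((s - \<delta>) / \<delta>)"

lemma Ck_on_cap: "Ck_on k U (cap \<delta>)"
  unfolding cap_def[abs_def] divide_inverse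
  by (intro Ck_intros Ck_on_compose[OF Ck_on_flat_exp[of _ UNIV]]) auto

lemma Ck_on_cap_deriv: "Ck_on k U (cap_deriv \<delta>)"
  unfolding cap_deriv_def[abs_def] divide_inverse
  by (intro Ck_intros Ck_on_compose[OF Ck_on_flat_exp[of _ UNIV]]) auto

text \<open>
  The factor \<open>s - \<delta>\<close> lowers the index of \<open>flat_exp\<close> by one and cancels the \<open>\<delta>\<close> of the chain rule.
\<close>
lemma cap_has_derivative:
  assumes "\<delta> > 0"
  shows "(cap \<delta> has_real_derivative cap_deriv \<delta> s) (at s)"
proof -
  define y where "y = (s - \<delta>) / \<delta>"
  have "((\<lambda>s. flat_exp 0 ((s - \<delta>) / \<delta>)) has_real_derivative flat_exp 2 y * (1 / \<delta>)) (at s)"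
  proof (rule DERIV_chain2[where g = "\<lambda>s. (s - \<delta>) / \<delta>"])
    show "(flat_exp 0 has_real_derivative flat_exp 2 y) (at ((s - \<delta>) / \<delta>))"
      using flat_exp_deriv[of 0 y] by (simp add: y_def numeral_2_eq_2)
  qed (use assms in \<open>auto intro!: derivative_eq_intros\<close>)
  then have "(cap \<delta> has_real_derivative (s - \<delta>) * (flat_exp 2 y * (1 / \<delta>)) + 1 * flat_exp 0 y) (at s)"
    unfolding cap_def[abs_def] by (auto intro!: derivative_eq_intros simp: y_def)
  moreover have "(s - \<delta>) * (flat_exp 2 y * (1 / \<delta>)) = flat_exp 1 y"
    using assms by (auto simp: flat_exp_def y_def zero_less_divide_iff power2_eq_square)
  ultimately show ?thesis by (simp add: cap_deriv_def y_def add.commute)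
qed

lemma cap_deriv_bounds: "0 \<le> cap_deriv \<delta> s" "cap_deriv \<delta> s \<le> 1"
proof -
  have "exp (- z) + z * exp (- z) \<le> 1" for z :: real
  proof -
    have "(1 + z) * exp (- z) \<le> exp z * exp (- z)" by (intro mult_right_mono exp_ge_add_one_self) auto
    then show ?thesis by (simp add: exp_minus algebra_simps)
  qed
  from this[of "inverse ((s - \<delta>) / \<delta>)"] show "cap_deriv \<delta> s \<le> 1"
    by (auto simp: cap_deriv_def flat_exp_def)
  have "0 \<le> flat_exp j y" for j y by (simp add: flat_exp_def)
  then show "0 \<le> cap_deriv \<delta> s" by (simp only: cap_deriv_def add_nonneg_nonneg)
qed

lemma cap_eq_0: "\<delta> > 0 \<Longrightarrow> s \<le> \<delta> \<Longrightarrow> cap \<delta> s = 0"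
  by (simp add: cap_def flat_exp_def zero_less_divide_iff)

lemma cap_pos: "\<delta> > 0 \<Longrightarrow> s > \<delta> \<Longrightarrow> cap \<delta> s > 0"
  by (simp add: cap_def flat_exp_def)

lemma cap_nonneg: "\<delta> > 0 \<Longrightarrow> 0 \<le> cap \<delta> s"
  using cap_eq_0[of \<delta> s] cap_pos[of \<delta> s] by (cases "s \<le> \<delta>") auto

lemma cap_le: "\<delta> > 0 \<Longrightarrow> s \<ge> 0 \<Longrightarrow> cap \<delta> s \<le> s"
proof (cases "s \<le> \<delta>")
  case False
  assume "\<delta> > 0" "s \<ge> 0"
  then have "cap \<delta> s \<le> (s - \<delta>) * 1"
    unfolding cap_def using False by (intro mult_left_mono) (auto simp: flat_exp_def)
  then show ?thesis using \<open>\<delta> > 0\<close> by simp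
qed (simp add: cap_eq_0)

lemma cap_ge: "\<delta> > 0 \<Longrightarrow> s - 2 * \<delta> \<le> cap \<delta> s"
proof (cases "s \<le> \<delta>")
  case False
  assume \<delta>: "\<delta> > 0"
  have "1 + (- (\<delta> / (s - \<delta>))) \<le> exp (- (\<delta> / (s - \<delta>)))" by (rule exp_ge_add_one_self)
  then have "(s - \<delta>) * (1 - \<delta> / (s - \<delta>)) \<le> (s - \<delta>) * exp (- (\<delta> / (s - \<delta>)))"
    using False by (intro mult_left_mono) auto
  moreover have "(s - \<delta>) * (1 - \<delta> / (s - \<delta>)) = s - 2 * \<delta>" using False by (simp add: field_simps)
  ultimately show ?thesis using False \<delta> by (simp add: cap_def flat_exp_def)
next
  case True
  assume "\<delta> > 0"
  then show ?thesis using True cap_nonneg[of \<delta> s] by linarith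
qed

lemma cap_defect_le:
  assumes "\<delta> > 0" "\<bar>s\<bar> \<le> 1"
  shows "s * cap \<delta> s \<le> (cap \<delta> s)\<^sup>2 + 2 * \<delta>"
proof (cases "s \<le> \<delta>")
  case False
  then have s: "0 \<le> s" "s \<le> 1" using assms by auto
  have "cap \<delta> s * (s - cap \<delta> s) \<le> 1 * (2 * \<delta>)"
    by (rule mult_mono) (use cap_le[of \<delta> s] cap_ge[of \<delta> s] cap_nonneg[of \<delta> s] s assms in auto)
  then show ?thesis by (simp add: power2_eq_square algebra_simps)
qed (use assms in \<open>auto simp: cap_eq_0\<close>)

lemma cap_even_ge:
  assumes "\<delta> > 0" "\<bar>s\<bar> \<le> 1"
  shows "s\<^sup>2 - 4 * \<delta> \<le> (cap \<delta> s)\<^sup>2 + (cap \<delta> (- s))\<^sup>2"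
proof -
  have *: "s\<^sup>2 - 4 * \<delta> \<le> (cap \<delta> s)\<^sup>2" if "0 \<le> s" "s \<le> 1" for s
  proof (cases "s \<le> 2 * \<delta>")
    case True
    have "s * s \<le> s * 1" using that by (intro mult_left_mono) auto
    then have "s\<^sup>2 \<le> 4 * \<delta>" using True assms by (simp add: power2_eq_square)
    then show ?thesis using zero_le_power2[of "cap \<delta> s"] by linarith
  next
    case False
    have "(s - 2 * \<delta>)\<^sup>2 \<le> (cap \<delta> s)\<^sup>2" using False cap_ge[OF assms(1), of s] by (intro power_mono) auto
    moreover have "s * \<delta> \<le> 1 * \<delta>" using that assms by (intro mult_right_mono) auto
    moreover have "\<delta>\<^sup>2 \<ge> 0" by simp
    moreover have "(s - 2 * \<delta>)\<^sup>2 = s\<^sup>2 - 4 * (s * \<delta>) + 4 * \<delta>\<^sup>2" by (simp add: power2_eq_square algebra_simps)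
    ultimately show ?thesis by linarith
  qed
  show ?thesis
  proof (cases "s \<ge> 0")
    case True
    then show ?thesis using *[of s] assms zero_le_power2[of "cap \<delta> (- s)"] by linarith
  next
    case False
    then show ?thesis using *[of "- s"] assms zero_le_power2[of "cap \<delta> s"] unfolding power2_minus by linarith
  qed
qed

lemma Ck_on_1_deriv:
  assumes "Ck_on 1 UNIV (f :: real \<Rightarrow> real)"
  shows "(f has_real_derivative deriv f t) (at t)" "continuous_on UNIV (deriv f)"
proof -
  obtain f' where f': "\<And>x. (f has_derivative (\<lambda>h. \<Sum>b\<in>Basis. (h \<bullet> b) * f' b x)) (at x)"
      "\<And>b::real. b \<in> Basis \<Longrightarrow> Ck_on 0 UNIV (f' b)"
    using Ck_on_SucE[of 0 UNIV f] assms by auto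
  have d: "(f has_real_derivative f' 1 x) (at x)" for x
    using f'(1)[of x] by (simp add: has_field_derivative_def mult.commute[of _ "f' 1 x"])
  then have "deriv f = f' 1" by (auto intro!: DERIV_imp_deriv)
  then show "(f has_real_derivative deriv f t) (at t)" "continuous_on UNIV (deriv f)"
    using d f'(2)[of 1] by auto
qed

lemma deriv_zero_outside:
  assumes "\<And>t. t \<notin> {lo..hi} \<Longrightarrow> (f :: real \<Rightarrow> real) t = 0" "t \<notin> {lo..hi}"
  shows "deriv f t = 0"
proof (rule DERIV_imp_deriv)
  show "(f has_real_derivative 0) (at t)"
    by (rule has_field_derivative_transform_within_open[where S = "- {lo..hi}" and f = "\<lambda>t. 0"])
       (use assms in auto)
qed

context punctured_domain
begin

lemma polar_integral_add:
  assumes "continuous_on UNIV f" "\<And>t. t \<notin> {lo..hi} \<Longrightarrow> f t = 0" "continuous_on UNIV W" "continuous_on UNIV V"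
  shows "polar_integral e f (\<lambda>s. W s + c * V s) = polar_integral e f W + c * polar_integral e f V"
proof -
  have "polar_integral e f (\<lambda>s. W s + c * V s)
      = (LINT x|lborel. separable e (- real CARD('n)) f W x + c * separable e (- real CARD('n)) f V x)"
    unfolding polar_integral_def separable_def
    by (intro Bochner_Integration.integral_cong refl) (simp add: algebra_simps)
  then show ?thesis using polar_integral_linear[OF assms(1-3,1,2,4)] by simp
qed

text \<open>
  On the half sphere the cosine is an eigenfunction of the Laplacian with eigenvalue \<open>n - 1\<close>. The cut-off
  loses only a factor \<open>1 + O(\<delta>)\<close> in the Rayleigh quotient: since \<open>0 \<le> Z' \<le> 1\<close>, the spherical energy of \<open>Z\<close> is at most
  the integral of \<open>(1 - s\<^sup>2) Z'\<close>, which equals \<open>n - 1\<close> times that of \<open>s Z\<close> by parts, and \<open>s Z - Z\<^sup>2 \<le> 2 \<delta>\<close>. The resulting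
  multiple of the integral of \<open>1\<close> is compared with that of \<open>Z\<^sup>2\<close>, uniformly in \<open>\<delta>\<close>, by the symmetry \<open>x \<mapsto> - x\<close> and
  the fact that \<open>s\<^sup>2\<close> has mean \<open>1/n\<close> over the sphere.
\<close>
lemma polar_integral_cap_defect:
  fixes \<delta> :: real
  assumes f: "Ck_on 1 UNIV f" "\<And>t. t \<notin> {lo..hi} \<Longrightarrow> f t = 0" "\<And>t. f t \<ge> 0"
    and \<delta>: "\<delta> > 0" "8 * CARD('n) * \<delta> \<le> 1"
  shows "polar_integral e f (\<lambda>s. (1 - s\<^sup>2) * (cap_deriv \<delta> s)\<^sup>2)
    \<le> (CARD('n) - 1) * polar_integral e f (\<lambda>s. (cap \<delta> s)\<^sup>2)
      + 8 * (CARD('n))\<^sup>2 * \<delta> * polar_integral e f (\<lambda>s. (cap \<delta> s)\<^sup>2)"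
proof -
  define n where "n = real CARD('n)"
  have n: "n \<ge> 1" by (simp add: n_def Suc_le_eq)
  note d = Ck_on_1_deriv[OF f(1)] and z = deriv_zero_outside[of lo hi f, OF f(2)]
  have fc: "continuous_on UNIV f" using f(1) by (rule Ck_on_imp_continuous)
  have cc: "continuous_on UNIV (cap \<delta>)" "continuous_on UNIV (cap_deriv \<delta>)"
    using Ck_on_cap[of 0] Ck_on_cap_deriv[of 0] by auto
  have ccm: "continuous_on UNIV (\<lambda>s. cap \<delta> (- s))"
    by (intro continuous_on_compose2[OF cc(1)] continuous_intros) auto
  let ?I = "polar_integral e f"
  have parts: "?I (\<lambda>s. (1 - s\<^sup>2) * Y' s) = (n - 1) * ?I (\<lambda>s. s * Y s)"
    if "Ck_on 1 UNIV Y" "\<And>s. (Y has_real_derivative Y' s) (at s)" "continuous_on UNIV Y'" for Y Y'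
    unfolding n_def using polar_integral_sphere_parts[OF f(1) d(1) f(2) z d(2) that] by (simp add: of_nat_diff Suc_le_eq)
  have 1: "?I (\<lambda>s. (1 - s\<^sup>2) * (cap_deriv \<delta> s)\<^sup>2) \<le> ?I (\<lambda>s. (1 - s\<^sup>2) * cap_deriv \<delta> s)"
  proof (rule polar_integral_mono[OF fc f(2) _ fc f(2)])
    fix t s :: real assume "\<bar>s\<bar> \<le> 1"
    then have "s\<^sup>2 \<le> 1" by (simp add: abs_square_le_1)
    moreover have "(cap_deriv \<delta> s)\<^sup>2 \<le> cap_deriv \<delta> s"
      using mult_left_mono[OF cap_deriv_bounds(2) cap_deriv_bounds(1), of \<delta> s \<delta> s] by (simp add: power2_eq_square)
    ultimately show "f t * ((1 - s\<^sup>2) * (cap_deriv \<delta> s)\<^sup>2) \<le> f t * ((1 - s\<^sup>2) * cap_deriv \<delta> s)"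
      using f(3) by (intro mult_left_mono) auto
  qed (auto intro!: continuous_intros cc)
  have 2: "?I (\<lambda>s. (1 - s\<^sup>2) * cap_deriv \<delta> s) = (n - 1) * ?I (\<lambda>s. s * cap \<delta> s)"
    by (rule parts[OF Ck_on_cap _ cc(2)]) (rule cap_has_derivative[OF \<delta>(1)])
  have "?I (\<lambda>s. s * cap \<delta> s) \<le> ?I (\<lambda>s. (cap \<delta> s)\<^sup>2 + (2 * \<delta>) * 1)"
    by (rule polar_integral_mono[OF fc f(2) _ fc f(2)])
       (use cap_defect_le[OF \<delta>(1)] f(3) in \<open>auto intro!: continuous_intros cc mult_left_mono\<close>)
  also have "\<dots> = ?I (\<lambda>s. (cap \<delta> s)\<^sup>2) + 2 * \<delta> * ?I (\<lambda>s. 1)"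
    by (rule polar_integral_add[OF fc f(2)]) (auto intro!: continuous_intros cc)
  finally have 3: "?I (\<lambda>s. s * cap \<delta> s) \<le> ?I (\<lambda>s. (cap \<delta> s)\<^sup>2) + 2 * \<delta> * ?I (\<lambda>s. 1)" .
  have 4: "n * ?I (\<lambda>s. s\<^sup>2) = ?I (\<lambda>s. 1)"
  proof -
    have "?I (\<lambda>s. (1 - s\<^sup>2) * 1) = (n - 1) * ?I (\<lambda>s. s * s)"
      by (rule parts) (auto intro!: Ck_on_id_real continuous_intros)
    moreover have "?I (\<lambda>s. 1 + (- 1) * s\<^sup>2) = ?I (\<lambda>s. 1) + (- 1) * ?I (\<lambda>s. s\<^sup>2)"
      by (rule polar_integral_add[OF fc f(2)]) (auto intro!: continuous_intros)
    ultimately show ?thesis by (simp add: power2_eq_square algebra_simps)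
  qed
  have 5: "?I (\<lambda>s. s\<^sup>2) - 4 * \<delta> * ?I (\<lambda>s. 1) \<le> 2 * ?I (\<lambda>s. (cap \<delta> s)\<^sup>2)"
  proof -
    have "?I (\<lambda>s. s\<^sup>2) - 4 * \<delta> * ?I (\<lambda>s. 1) = ?I (\<lambda>s. s\<^sup>2 + (- (4 * \<delta>)) * 1)"
      by (subst polar_integral_add[OF fc f(2)]) (auto intro!: continuous_intros)
    also have "\<dots> \<le> ?I (\<lambda>s. (cap \<delta> s)\<^sup>2 + 1 * (cap \<delta> (- s))\<^sup>2)"
      by (rule polar_integral_mono[OF fc f(2) _ fc f(2)])
         (use cap_even_ge[OF \<delta>(1)] f(3) in \<open>auto intro!: continuous_intros cc ccm mult_left_mono\<close>)
    also have "\<dots> = ?I (\<lambda>s. (cap \<delta> s)\<^sup>2) + 1 * ?I (\<lambda>s. (cap \<delta> (- s))\<^sup>2)"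
      by (rule polar_integral_add[OF fc f(2)]) (auto intro!: continuous_intros cc ccm)
    also have "?I (\<lambda>s. (cap \<delta> (- s))\<^sup>2) = ?I (\<lambda>s. (cap \<delta> s)\<^sup>2)"
      by (rule polar_integral_reflect[OF fc f(2), where W = "\<lambda>s. (cap \<delta> s)\<^sup>2"]) (auto intro!: continuous_intros cc)
    finally show ?thesis by simp
  qed
  have I0: "?I (\<lambda>s. 1) \<ge> 0"
    unfolding polar_integral_def using f(3) by (intro integral_nonneg_AE AE_I2) (auto simp: separable_def)
  have 6: "?I (\<lambda>s. 1) \<le> 4 * n * ?I (\<lambda>s. (cap \<delta> s)\<^sup>2)"
  proof -
    have "n * (?I (\<lambda>s. s\<^sup>2) - 4 * \<delta> * ?I (\<lambda>s. 1)) \<le> n * (2 * ?I (\<lambda>s. (cap \<delta> s)\<^sup>2))"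
      using 5 n by (intro mult_left_mono) auto
    then have "?I (\<lambda>s. 1) - (4 * n * \<delta>) * ?I (\<lambda>s. 1) \<le> 2 * n * ?I (\<lambda>s. (cap \<delta> s)\<^sup>2)"
      using 4 by (simp add: algebra_simps)
    moreover have "(4 * n * \<delta>) * ?I (\<lambda>s. 1) \<le> (1 / 2) * ?I (\<lambda>s. 1)"
      using \<delta>(2) I0 by (intro mult_right_mono) (auto simp: n_def)
    ultimately show ?thesis by simp
  qed
  have "?I (\<lambda>s. (1 - s\<^sup>2) * (cap_deriv \<delta> s)\<^sup>2) \<le> (n - 1) * (?I (\<lambda>s. (cap \<delta> s)\<^sup>2) + 2 * \<delta> * ?I (\<lambda>s. 1))"
    using 1 2 mult_left_mono[OF 3, of "n - 1"] n by simp
  also have "\<dots> \<le> (n - 1) * ?I (\<lambda>s. (cap \<delta> s)\<^sup>2) + n * (2 * \<delta> * (4 * n * ?I (\<lambda>s. (cap \<delta> s)\<^sup>2)))"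
  proof -
    have "(n - 1) * (2 * \<delta> * ?I (\<lambda>s. 1)) \<le> n * (2 * \<delta> * (4 * n * ?I (\<lambda>s. (cap \<delta> s)\<^sup>2)))"
      by (intro mult_mono mult_left_mono 6) (use n \<delta> I0 in auto)
    then show ?thesis by (simp add: algebra_simps)
  qed
  finally show ?thesis
    unfolding n_def by (simp add: power2_eq_square algebra_simps of_nat_diff Suc_le_eq)
qed

end

section \<open>Radial profile\<close>

lemma integral_real_derivative_from_left:
  fixes h :: "real \<Rightarrow> real"
  assumes "continuous_on UNIV h" "c < y"
  shows "((\<lambda>y. integral {c..y} h) has_real_derivative h y) (at y)"
proof -
  have "((\<lambda>y. integral {c..y} h) has_real_derivative h y) (at y within {c..y + 1})"
    by (rule integral_has_real_derivative) (use assms in \<open>auto intro: continuous_on_subset\<close>)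
  then show ?thesis
    using at_within_Icc_at[of c y "y + 1"] assms by simp
qed

text \<open>
  The constant \<open>C\<close> is the quotient of the integrals of \<open>b'\<^sup>2\<close> and \<open>b\<^sup>2\<close>. Stating this through a compactly supported
  primitive \<open>\<beta>\<close> of \<open>b'\<^sup>2 - C b\<^sup>2\<close> lets the identity survive any later change of variables, because derivatives of
  compactly supported radial functions integrate to zero.
\<close>
lemma ex_bump:
  "\<exists>(b :: real \<Rightarrow> real) \<beta> C. (\<forall>k. Ck_on k UNIV b) \<and> Ck_on 1 UNIV \<beta> \<and>
     (\<forall>y. (\<beta> has_real_derivative ((deriv b y)\<^sup>2 - C * (b y)\<^sup>2)) (at y)) \<and>
     (\<forall>y. y \<notin> {0..1} \<longrightarrow> b y = 0 \<and> \<beta> y = 0) \<and> b (1 / 2) \<noteq> 0"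
proof -
  define b where "b y = flat_exp 0 y * flat_exp 0 (1 - y)" for y :: real
  have bC: "Ck_on k UNIV b" for k
    unfolding b_def by (intro Ck_intros Ck_on_flat_exp Ck_on_compose[OF Ck_on_flat_exp[of _ UNIV]]) auto
  have b0: "b y = 0" if "y \<notin> {0..1}" for y using that by (auto simp: b_def flat_exp_def)
  have bpos: "b (1 / 2) \<noteq> 0" by (simp add: b_def flat_exp_def)
  note b' = Ck_on_1_deriv[OF bC]
  have b'0: "deriv b y = 0" if "y \<notin> {0..1}" for y
    using deriv_zero_outside[of 0 1 b y] b0 that by blast
  have b'C: "Ck_on 0 UNIV (deriv b)" using b'(2) by simp
  have bc: "continuous_on UNIV b" using bC[of 0] by simp
  have pos: "integral {-1..1} (\<lambda>y. (b y)\<^sup>2) \<noteq> 0"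
  proof
    assume "integral {-1..1} (\<lambda>y. (b y)\<^sup>2) = 0"
    moreover have "continuous_on {-1..1} (\<lambda>y. (b y)\<^sup>2)"
      using bc by (auto intro!: continuous_intros intro: continuous_on_subset)
    ultimately have "\<forall>y\<in>{-1..1}. (b y)\<^sup>2 = 0"
      by (subst (asm) integral_eq_0_iff) auto
    then show False using bpos by (auto dest!: bspec[of _ _ "1 / 2"])
  qed
  define C where "C = integral {-1..1} (\<lambda>y. (deriv b y)\<^sup>2) / integral {-1..1} (\<lambda>y. (b y)\<^sup>2)"
  define h where "h y = (deriv b y)\<^sup>2 - C * (b y)\<^sup>2" for y
  have hc: "continuous_on UNIV h" unfolding h_def by (intro continuous_intros b'(2) bc)
  have h0: "h y = 0" if "y \<notin> {0..1}" for y using b0[OF that] b'0[OF that] by (simp add: h_def)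
  have hi: "h integrable_on {u..v}" for u v
    using hc by (auto intro: integrable_continuous_interval continuous_on_subset)
  have tot: "integral {-1..1} h = 0"
  proof -
    have i: "(\<lambda>y. (deriv b y)\<^sup>2) integrable_on {-1..1}" "(\<lambda>y. (b y)\<^sup>2) integrable_on {-1..1}"
      using b'(2) bc by (auto intro!: integrable_continuous_interval continuous_intros intro: continuous_on_subset)
    have "integral {-1..1} h = integral {-1..1} (\<lambda>y. (deriv b y)\<^sup>2) - C * integral {-1..1} (\<lambda>y. (b y)\<^sup>2)"
      unfolding h_def using i by (subst integral_diff) (auto intro!: integrable_on_mult_right)
    then show ?thesis using pos by (simp add: C_def)
  qed
  define \<beta> where "\<beta> y = integral {-1..y} h" for y
  have left: "\<beta> y = 0" if "y < 0" for y
  proof -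
    have "\<beta> y = integral {-1..y} (\<lambda>y. 0)" unfolding \<beta>_def by (rule integral_cong) (use that h0 in auto)
    then show ?thesis by simp
  qed
  have right: "\<beta> y = 0" if "y > 1" for y
  proof -
    have "\<beta> y = integral {-1..1} h + integral {1..y} h"
      unfolding \<beta>_def using that hi by (subst Henstock_Kurzweil_Integration.integral_combine) auto
    also have "integral {1..y} h = integral {1..y} (\<lambda>y. 0)"
    proof (rule integral_cong)
      fix x assume "x \<in> {1..y}"
      have "h 1 = 0"
      proof -
        have "deriv b 1 = 0"
        proof (rule DERIV_imp_deriv)
          have "(b has_real_derivative flat_exp 2 1 * flat_exp 0 (1 - 1) + (flat_exp 2 (1 - 1) * (0 - 1)) * flat_exp 0 1) (at 1)"
            unfolding b_def[abs_def]
            by (intro DERIV_mult DERIV_chain2[of "flat_exp 0"] DERIV_diff DERIV_const DERIV_ident)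
               (use flat_exp_deriv[of 0] in \<open>simp_all add: numeral_2_eq_2\<close>)
          then show "(b has_real_derivative 0) (at 1)" by (simp add: flat_exp_def)
        qed
        then show ?thesis by (simp add: h_def b_def flat_exp_def)
      qed
      then show "h x = 0" using \<open>x \<in> {1..y}\<close> h0[of x] by (cases "x = 1") auto
    qed
    finally show ?thesis using tot by simp
  qed
  have \<beta>d: "(\<beta> has_real_derivative h y) (at y)" for y
  proof (cases "y > -1")
    case True
    then show ?thesis unfolding \<beta>_def[abs_def] using integral_real_derivative_from_left[OF hc] by simp
  next
    case False
    have "(\<beta> has_real_derivative 0) (at y)"
      by (rule has_field_derivative_transform_within_open[where S = "{..<0}" and f = "\<lambda>y. 0"])
         (use False left in auto)
    then show ?thesis using h0[of y] False by simp
  qed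
  have "Ck_on 1 UNIV \<beta>"
    unfolding One_nat_def by (rule Ck_on_real_SucI[OF \<beta>d]) (use hc in simp)
  then show ?thesis
    using bC \<beta>d b0 left right bpos unfolding h_def
    by (intro exI[of _ b] exI[of _ \<beta>] exI[of _ C]) (auto simp: not_le)
qed

text \<open>
  The inverse of the iterated logarithm \<open>zlog m\<close>.
\<close>
definition exp_tower :: "nat \<Rightarrow> real \<Rightarrow> real" where
  "exp_tower m = (\<lambda>y. exp y - 1) ^^ m"

lemma exp_tower_Suc: "exp_tower (Suc m) y = exp (exp_tower m y) - 1"
  by (simp add: exp_tower_def)

lemma exp_tower_shift: "exp_tower m (exp y - 1) = exp_tower (Suc m) y"
  by (induction m) (auto simp: exp_tower_def)

lemma exp_tower_pos: "y > 0 \<Longrightarrow> exp_tower m y > 0"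
  by (induction m) (auto simp: exp_tower_def)

lemma le_zlog_iff: "\<tau> > 0 \<Longrightarrow> y \<le> zlog m \<tau> \<longleftrightarrow> exp_tower m y \<le> \<tau>"
proof (induction m arbitrary: y)
  case (Suc m)
  have "y \<le> zlog (Suc m) \<tau> \<longleftrightarrow> exp y - 1 \<le> zlog m \<tau>"
    using zlog_pos[OF Suc.prems, of m] by (auto simp: ln_ge_iff)
  then show ?case using Suc by (simp add: exp_tower_shift)
qed (simp add: exp_tower_def)

lemma zlog_le_iff: "\<tau> > 0 \<Longrightarrow> zlog m \<tau> \<le> y \<longleftrightarrow> \<tau> \<le> exp_tower m y"
proof (induction m arbitrary: y)
  case (Suc m)
  have "zlog (Suc m) \<tau> \<le> y \<longleftrightarrow> zlog m \<tau> \<le> exp y - 1"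
    using zlog_pos[OF Suc.prems, of m] by (subst exp_le_cancel_iff[symmetric]) (simp add: algebra_simps)
  then show ?case using Suc by (simp add: exp_tower_shift)
qed (simp add: exp_tower_def)

text \<open>
  The radial profile of a nearly optimal function is \<open>G = g b ((z - a) / K)\<close>, where \<open>z = zlog m\<close> and
  \<open>g = (X\<^sub>1 \<cdots> X\<^sub>m) powr (- 1/2)\<close>. Since \<open>g'' = - 1/4 (\<Sum>i\<le>m. P\<^sub>i\<^sup>2) g\<close>, one has
  \<open>G'\<^sup>2 = g\<^sup>2 B'\<^sup>2 + 1/4 (\<Sum>i\<le>m. P\<^sub>i\<^sup>2) G\<^sup>2\<close> up to the derivative of \<open>g g' B\<^sup>2\<close>, with \<open>B = b ((z - a) / K)\<close>. In the variable \<open>z\<close>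
  the first term is the one-dimensional energy of a bump of width \<open>K\<close>, hence a multiple \<open>C / K\<^sup>2\<close> of the last
  Hardy weight, up to a derivative again. Both derivatives are collected in \<open>F\<close>.
\<close>
lemma ex_hardy_profile:
  fixes b \<beta> :: "real \<Rightarrow> real"
  assumes b: "\<And>k. Ck_on k UNIV b" "Ck_on 1 UNIV \<beta>"
    "\<And>y. (\<beta> has_real_derivative ((deriv b y)\<^sup>2 - C * (b y)\<^sup>2)) (at y)"
    "\<And>y. y \<notin> {0..1} \<Longrightarrow> b y = 0" "\<And>y. y \<notin> {0..1} \<Longrightarrow> \<beta> y = 0" "b (1 / 2) \<noteq> 0"
    and a: "a > 0" and K: "K > 0" and m: "m \<ge> 1"
  defines "lo \<equiv> exp_tower m a" and "hi \<equiv> exp_tower m (a + K)"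
  shows "\<exists>G F. (\<forall>k. Ck_on k UNIV G) \<and> Ck_on 1 UNIV F \<and>
    (\<forall>t. t \<notin> {lo..hi} \<longrightarrow> G t = 0 \<and> F t = 0) \<and> (\<exists>t>0. G t \<noteq> 0) \<and>
    (\<forall>t>0. (deriv G t)\<^sup>2 = (1 / 4 + C / K\<^sup>2) * ((zprod m t)\<^sup>2 * (G t)\<^sup>2)
        + 1 / 4 * (\<Sum>i=1..m-1. (zprod i t)\<^sup>2 * (G t)\<^sup>2) + deriv F t)"
proof -
  have lo: "lo > 0" using exp_tower_pos[OF a] by (simp add: lo_def)
  define y where "y t = (zlog m t - a) / K" for t
  define g where "g t = exp ((\<Sum>j=1..m. zlog j t) / 2)" for t
  define G0 where "G0 t = g t * b (y t)" for t
  define F0 where "F0 t = zsum m t / 2 * (G0 t)\<^sup>2 + \<beta> (y t) / K" for t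
  define G where "G t = (if t > 0 then G0 t else 0)" for t
  define F where "F t = (if t > 0 then F0 t else 0)" for t
  have yout: "y t \<notin> {0..1}" if "t > 0" "t \<notin> {lo..hi}" for t
  proof -
    have "\<not> (a \<le> zlog m t \<and> zlog m t \<le> a + K)"
      using that unfolding lo_def hi_def by (simp add: le_zlog_iff zlog_le_iff)
    then show ?thesis using K by (auto simp: y_def divide_simps)
  qed
  have G0z: "G0 t = 0" "F0 t = 0" if "t > 0" "t \<notin> {lo..hi}" for t
    using b(4,5)[OF yout[OF that]] by (simp_all add: G0_def F0_def)
  have Gz: "G t = 0" "F t = 0" if "t \<notin> {lo..hi}" for t
    using G0z[OF _ that] by (auto simp: G_def F_def)
  have yC: "Ck_on k {0<..} y" for k
    unfolding y_def[abs_def] using K by (intro Ck_intros Ck_on_zlog) auto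
  have gC: "Ck_on k {0<..} g" for k
    unfolding g_def[abs_def] by (intro Ck_intros Ck_on_zlog) auto
  have G0C: "Ck_on k {0<..} G0" for k
    unfolding G0_def[abs_def] by (intro Ck_intros gC Ck_on_compose[OF b(1) yC]) auto
  have F0C: "Ck_on 1 {0<..} F0"
    unfolding F0_def[abs_def] using K by (intro Ck_intros G0C Ck_on_zsum Ck_on_compose[OF b(2) yC]) auto
  have GC: "Ck_on k UNIV G" for k
    by (rule Ck_on_zero_extension[of "{0<..}" "{lo..hi}"])
       (use lo Gz in \<open>auto simp: G_def intro: Ck_on_cong[OF _ _ G0C]\<close>)
  have "Ck_on 1 {0<..} F"
    by (rule Ck_on_cong[OF _ _ F0C]) (auto simp: F_def)
  then have FC: "Ck_on 1 UNIV F"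
    by (rule Ck_on_zero_extension[of "{0<..}" "{lo..hi}", rotated -1]) (use lo Gz in auto)
  have nz: "\<exists>t>0. G t \<noteq> 0"
  proof -
    \<comment> \<open>The midpoint of the bump.\<close>
    define t where "t = exp_tower m (a + K / 2)"
    have t: "t > 0" unfolding t_def using a K by (intro exp_tower_pos) auto
    have "zlog m t = a + K / 2"
      using le_zlog_iff[OF t, of "a + K / 2" m] zlog_le_iff[OF t, of m "a + K / 2"] by (auto simp: t_def)
    then have "y t = 1 / 2" using K by (simp add: y_def)
    then have "b (y t) \<noteq> 0" using b(6) by metis
    then show ?thesis using t by (intro exI[of _ t]) (auto simp: G_def G0_def g_def)
  qed
  have id: "(deriv G t)\<^sup>2 = (1 / 4 + C / K\<^sup>2) * ((zprod m t)\<^sup>2 * (G t)\<^sup>2)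
        + 1 / 4 * (\<Sum>i=1..m-1. (zprod i t)\<^sup>2 * (G t)\<^sup>2) + deriv F t" if t: "t > 0" for t
  proof -
    define P where "P = zprod m t"
    define \<eta> where "\<eta> = zsum m t"
    define Q where "Q = zsqsum m t"
    define B' where "B' = deriv b (y t)"
    have yd: "(y has_real_derivative P / K) (at t)"
      unfolding y_def[abs_def] P_def using K zlog_deriv[OF t, of m] by (auto intro!: derivative_eq_intros)
    have gd: "(g has_real_derivative g t * (\<eta> / 2)) (at t)"
      unfolding g_def[abs_def] \<eta>_def zsum_def
      by (intro DERIV_fun_exp DERIV_cdivide DERIV_sum zlog_deriv t)
    have bd: "((\<lambda>t. b (y t)) has_real_derivative B' * (P / K)) (at t)"
      unfolding B'_def by (rule DERIV_chain2[OF Ck_on_1_deriv(1)[OF b(1)] yd])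
    have \<beta>d: "((\<lambda>t. \<beta> (y t)) has_real_derivative (B'\<^sup>2 - C * (b (y t))\<^sup>2) * (P / K)) (at t)"
      unfolding B'_def by (rule DERIV_chain2[OF b(3) yd])
    define G' where "G' = g t * (\<eta> / 2) * b (y t) + B' * (P / K) * g t"
    have G0d: "(G0 has_real_derivative G') (at t)"
      unfolding G0_def[abs_def] G'_def by (rule DERIV_mult[OF gd bd])
    define F' where "F' = (- (\<eta>\<^sup>2 + Q) / 2) / 2 * (G0 t)\<^sup>2 + \<eta> / 2 * (2 * G0 t * G') + (B'\<^sup>2 - C * (b (y t))\<^sup>2) * (P / K) / K"
    have F0d: "(F0 has_real_derivative F') (at t)"
      unfolding F0_def[abs_def] F'_def \<eta>_def Q_def
    proof (intro DERIV_add DERIV_cdivide \<beta>d)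
      have "((\<lambda>t. zsum m t / 2 * (G0 t)\<^sup>2) has_real_derivative
          (- ((zsum m t)\<^sup>2 + zsqsum m t) / 2) / 2 * (G0 t)\<^sup>2 + (2 * G0 t * G') * (zsum m t / 2)) (at t)"
        by (rule DERIV_mult[OF DERIV_cdivide[OF zsum_deriv[OF t]]])
           (use DERIV_power[OF G0d, of 2] in \<open>simp add: ac_simps\<close>)
      then show "((\<lambda>t. zsum m t / 2 * (G0 t)\<^sup>2) has_real_derivative
          - ((zsum m t)\<^sup>2 + zsqsum m t) / 2 / 2 * (G0 t)\<^sup>2 + zsum m t / 2 * (2 * G0 t * G')) (at t)"
        by (simp add: mult.commute)
    qed
    have dG: "deriv G t = G'"
      by (rule DERIV_imp_deriv, rule has_field_derivative_transform_within_open[OF G0d, of "{0<..}"])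
         (use t in \<open>auto simp: G_def\<close>)
    have dF: "deriv F t = F'"
      by (rule DERIV_imp_deriv, rule has_field_derivative_transform_within_open[OF F0d, of "{0<..}"])
         (use t in \<open>auto simp: F_def\<close>)
    have gP: "(g t)\<^sup>2 * P = 1"
      unfolding g_def P_def zprod_def by (simp add: exp_minus flip: exp_double)
    have Qm: "Q = (\<Sum>i=1..m-1. (zprod i t)\<^sup>2) + P\<^sup>2"
      using m by (cases m) (auto simp: Q_def zsqsum_def P_def)
    define B where "B = b (y t)"
    have "P = P * ((g t)\<^sup>2 * P)" using gP by simp
    then have P: "P = P\<^sup>2 * (g t)\<^sup>2" by (simp add: power2_eq_square algebra_simps)
    have G0t: "G0 t = g t * B" by (simp add: G0_def B_def)
    have "G'\<^sup>2 = (g t)\<^sup>2 * B\<^sup>2 * \<eta>\<^sup>2 / 4 + \<eta> * g t * B * (B' * (P / K) * g t) + B'\<^sup>2 / K\<^sup>2 * (P\<^sup>2 * (g t)\<^sup>2)"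
      using K by (simp add: G'_def B_def power2_eq_square field_simps)
    also have "\<dots> = (g t)\<^sup>2 * B\<^sup>2 * \<eta>\<^sup>2 / 4 + \<eta> * g t * B * (B' * (P / K) * g t) + B'\<^sup>2 / K\<^sup>2 * P"
      using P by simp
    also have "\<dots> = F' + Q / 4 * (g t * B)\<^sup>2 + C / K\<^sup>2 * B\<^sup>2 * P"
      unfolding F'_def G0t B_def[symmetric] G'_def
      using K by (simp add: power2_eq_square field_simps)
    also have "C / K\<^sup>2 * B\<^sup>2 * P = C / K\<^sup>2 * (P\<^sup>2 * (g t * B)\<^sup>2)"
      by (subst P) (simp add: power_mult_distrib)
    finally have "G'\<^sup>2 = F' + Q / 4 * (G0 t)\<^sup>2 + C / K\<^sup>2 * (P\<^sup>2 * (G0 t)\<^sup>2)" by (simp add: G0t)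
    then show ?thesis
      unfolding dG dF Qm using t by (simp add: G_def P_def sum_distrib_left sum_distrib_right algebra_simps add_divide_distrib)
  qed
  show ?thesis
    by (rule exI[of _ G], rule exI[of _ F], intro conjI allI impI GC FC nz Gz id)
qed

section \<open>Growth of exponential towers\<close>

lemma exp_tower_tendsto: "filterlim (exp_tower m) at_top at_top"
proof (induction m)
  case 0
  then show ?case by (simp add: exp_tower_def filterlim_ident id_def)
next
  case (Suc m)
  have "filterlim (\<lambda>y. - 1 + exp (exp_tower m y)) at_top at_top"
    by (intro filterlim_tendsto_add_at_top[OF tendsto_const] filterlim_compose[OF exp_at_top Suc])
  then show ?case by (simp add: exp_tower_Suc[abs_def])
qed

text \<open>
  A shift by \<open>K\<close> below a tower of exponentials is negligible against one more exponential on top: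
  for one level this is \<open>a + K \<le> exp (\<epsilon> a)\<close>, and each further level needs only
  \<open>exp (y / 2) \<le> \<epsilon> (exp y - 1)\<close> for large \<open>y\<close>.
\<close>
lemma exp_tower_shift_subexponential:
  assumes "\<epsilon> > 0"
  shows "\<forall>\<^sub>F a in at_top. exp_tower m (a + K) \<le> exp (\<epsilon> * exp_tower m a)"
  using assms
proof (induction m arbitrary: \<epsilon>)
  case 0
  have "\<forall>\<^sub>F a in at_top. a + K \<le> exp (\<epsilon> * a)" using 0 by real_asymp
  then show ?case by (simp add: exp_tower_def)
next
  case (Suc m)
  have "\<forall>\<^sub>F y in at_top. exp (1 / 2 * y) \<le> \<epsilon> * (exp y - 1)" using Suc.prems by real_asymp
  then have "\<forall>\<^sub>F a in at_top. exp (1 / 2 * exp_tower m a) \<le> \<epsilon> * (exp (exp_tower m a) - 1)"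
    using exp_tower_tendsto[of m] by (rule eventually_compose_filterlim)
  moreover have "\<forall>\<^sub>F a in at_top. exp_tower m (a + K) \<le> exp (1 / 2 * exp_tower m a)"
    by (rule Suc.IH) simp
  ultimately show ?case
  proof eventually_elim
    case (elim a)
    have "exp_tower (Suc m) (a + K) \<le> exp (exp_tower m (a + K))" by (simp add: exp_tower_Suc)
    also have "\<dots> \<le> exp (exp (1 / 2 * exp_tower m a))" using elim by simp
    also have "\<dots> \<le> exp (\<epsilon> * exp_tower (Suc m) a)" using elim by (simp add: exp_tower_Suc)
    finally show ?case .
  qed
qed

text \<open>
  The support of the profile is the interval from \<open>exp_tower m a\<close> to \<open>exp_tower m (a + K)\<close> in the variable \<open>\<tau>\<close>. The
  angular cut-off costs a multiple of the largest radius, hence of \<open>exp (- exp_tower m a)\<close>, while the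
  ratio between the leading weight and the last one is at most a power of \<open>1 + \<tau>\<close> for the largest \<open>\<tau>\<close>. The first wins as \<open>a\<close> grows.
\<close>
lemma exp_tower_negligible:
  assumes "m \<ge> 1"
  shows "((\<lambda>a. exp (- exp_tower m a) * (1 + exp_tower m (a + K)) ^ (2 * m)) \<longlongrightarrow> 0) at_top"
proof (rule tendsto_sandwich[OF _ _ tendsto_const])
  \<comment> \<open>With this rate the power \<open>2 m\<close> grows like half of the decaying exponential.\<close>
  define \<epsilon> where "\<epsilon> = 1 / (4 * real m)"
  have \<epsilon>: "\<epsilon> > 0" using assms by (simp add: \<epsilon>_def)
  have pos: "\<forall>\<^sub>F a in at_top. 0 < a \<and> 0 < a + K"
    using eventually_gt_at_top[of "max 0 (- K)"] by eventually_elim auto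
  show "\<forall>\<^sub>F a in at_top. 0 \<le> exp (- exp_tower m a) * (1 + exp_tower m (a + K)) ^ (2 * m)"
    by (simp add: power_mult)
  show "\<forall>\<^sub>F a in at_top. exp (- exp_tower m a) * (1 + exp_tower m (a + K)) ^ (2 * m) \<le> 2 ^ (2 * m) * exp (- (1 / 2) * exp_tower m a)"
    using pos exp_tower_shift_subexponential[OF \<epsilon>, of m K]
  proof eventually_elim
    case (elim a)
    have p: "0 < exp_tower m a" "0 < exp_tower m (a + K)" using exp_tower_pos elim by auto
    have "1 \<le> exp (\<epsilon> * exp_tower m a)" using p \<epsilon> by simp
    then have "1 + exp_tower m (a + K) \<le> 2 * exp (\<epsilon> * exp_tower m a)" using elim by linarith
    then have "(1 + exp_tower m (a + K)) ^ (2 * m) \<le> (2 * exp (\<epsilon> * exp_tower m a)) ^ (2 * m)"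
      using p by (intro power_mono) auto
    also have "\<dots> = 2 ^ (2 * m) * exp (real (2 * m) * (\<epsilon> * exp_tower m a))"
      by (simp only: power_mult_distrib exp_of_nat_mult)
    also have "real (2 * m) * (\<epsilon> * exp_tower m a) = 1 / 2 * exp_tower m a"
      using assms by (simp add: \<epsilon>_def)
    finally have "exp (- exp_tower m a) * (1 + exp_tower m (a + K)) ^ (2 * m)
      \<le> exp (- exp_tower m a) * (2 ^ (2 * m) * exp (1 / 2 * exp_tower m a))" by (intro mult_left_mono) auto
    also have "\<dots> = 2 ^ (2 * m) * (exp (- exp_tower m a) * exp (1 / 2 * exp_tower m a))" by (simp only: ac_simps)
    also have "exp (- exp_tower m a) * exp (1 / 2 * exp_tower m a) = exp (- (1 / 2) * exp_tower m a)"
      by (simp add: exp_add[symmetric] del: exp_add)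
    finally show ?case .
  qed
  have "((\<lambda>y::real. 2 ^ (2 * m) * exp (- (1 / 2) * y)) \<longlongrightarrow> 0) at_top" by real_asymp
  then show "((\<lambda>a. 2 ^ (2 * m) * exp (- (1 / 2) * exp_tower m a)) \<longlongrightarrow> 0) at_top"
    by (rule filterlim_compose[OF _ exp_tower_tendsto])
qed

section \<open>Nearly optimal test functions\<close>

context punctured_domain
begin

text \<open>
  The gradient splits orthogonally into its radial and its tangential part; the latter has squared
  length \<open>(1 - s\<^sup>2) W'\<^sup>2 f\<^sup>2\<close> up to the power of \<open>|x|\<close>.
\<close>
lemma gradient_separable:
  fixes e :: 'n
  assumes f: "\<And>t. (f has_real_derivative f' t) (at t)" and W: "\<And>s. (W has_real_derivative W' s) (at s)"
    and supp: "\<And>t. t \<notin> {lo..hi} \<Longrightarrow> f t = 0"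
  shows "(norm (gradient (separable e p f W) x))\<^sup>2
    = norm x powr (2 * p - 2) * ((p * f (tau x) - f' (tau x))\<^sup>2 * (W (cosine e x))\<^sup>2
       + (f (tau x))\<^sup>2 * ((1 - (cosine e x)\<^sup>2) * (W' (cosine e x))\<^sup>2))"
proof (cases "x = 0")
  case True
  have "gradient (separable e p f W) x = 0"
    by (rule gradient_eqI)
       (use separable_has_derivative[where lo = lo and hi = hi, of f f' W W' e p x] f W supp True in simp)
  then show ?thesis using True by simp
next
  case False
  define r where "r = norm x"
  define s where "s = cosine e x"
  have r: "r > 0" using False by (simp add: r_def)
  define \<alpha> where "\<alpha> = (p * f (tau x) - f' (tau x)) * W s / r\<^sup>2"
  define \<gamma> where "\<gamma> = f (tau x) * W' s"
  define w where "w = (1 / r) *\<^sub>R axis e 1 - (s / r\<^sup>2) *\<^sub>R x"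
  have xe: "x \<bullet> axis e 1 = r * s" using r by (simp add: s_def cosine_def r_def)
  have xx: "x \<bullet> x = r\<^sup>2" by (simp add: r_def power2_norm_eq_inner)
  have ee: "axis e 1 \<bullet> (axis e 1 :: real ^ 'n) = 1" by (simp add: inner_axis_axis)
  have grad: "gradient (separable e p f W) x = (r powr p) *\<^sub>R (\<alpha> *\<^sub>R x + \<gamma> *\<^sub>R w)"
  proof (rule gradient_eqI)
    have "(separable e p f W has_derivative (\<lambda>h. if x = 0 then 0 else
      norm x powr p * ((p * f (tau x) - f' (tau x)) * W (cosine e x) * (h \<bullet> x) / (norm x)\<^sup>2
        + f (tau x) * W' (cosine e x) * ((h \<bullet> axis e 1) / norm x - cosine e x * (h \<bullet> x) / (norm x)\<^sup>2)))) (at x)"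
      using f W supp by (intro separable_has_derivative)
    then show "(separable e p f W has_derivative (\<lambda>h. h \<bullet> (r powr p *\<^sub>R (\<alpha> *\<^sub>R x + \<gamma> *\<^sub>R w)))) (at x)"
      by (rule has_derivative_eq_rhs)
         (use False in \<open>simp add: fun_eq_iff \<alpha>_def \<gamma>_def w_def r_def s_def inner_add_right inner_diff_right algebra_simps\<close>)
  qed
  have wx: "w \<bullet> x = 0" using r by (simp add: w_def inner_diff_left xx xe inner_commute[of "axis e 1" x])
  have ww: "w \<bullet> w = (1 - s\<^sup>2) / r\<^sup>2"
    using r by (simp add: w_def inner_diff_left inner_diff_right xx xe ee inner_commute[of "axis e 1" x] power2_eq_square field_simps)
  have "(norm (gradient (separable e p f W) x))\<^sup>2 = (r powr p)\<^sup>2 * (norm (\<alpha> *\<^sub>R x + \<gamma> *\<^sub>R w))\<^sup>2"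
    unfolding grad by (simp add: power_mult_distrib)
  also have "(norm (\<alpha> *\<^sub>R x + \<gamma> *\<^sub>R w))\<^sup>2 = \<alpha>\<^sup>2 * r\<^sup>2 + \<gamma>\<^sup>2 * ((1 - s\<^sup>2) / r\<^sup>2)"
    unfolding power2_norm_eq_inner
    by (simp add: inner_add_left inner_add_right wx inner_commute[of x w] xx ww power2_eq_square)
  also have "(r powr p)\<^sup>2 * (\<alpha>\<^sup>2 * r\<^sup>2 + \<gamma>\<^sup>2 * ((1 - s\<^sup>2) / r\<^sup>2))
      = (r powr p)\<^sup>2 / r\<^sup>2 * ((p * f (tau x) - f' (tau x))\<^sup>2 * (W s)\<^sup>2 + (f (tau x))\<^sup>2 * ((1 - s\<^sup>2) * (W' s)\<^sup>2))"
    using r by (simp add: \<alpha>_def \<gamma>_def power2_eq_square field_simps)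
  also have "(r powr p)\<^sup>2 / r\<^sup>2 = r powr (2 * p - 2)"
    using r by (simp add: powr_diff powr_power power2_eq_square[of r] flip: powr_add)
  finally show ?thesis by (simp add: r_def s_def)
qed

text \<open>
  The ball consists of the points with \<open>|x|\<^sup>2 < 2 r\<^sub>0 x\<^sub>n\<close>. In the cone \<open>\<delta> |x| \<le> x\<^sub>n\<close> this holds as soon as
  \<open>|x| \<le> \<delta> r\<^sub>0\<close>.
\<close>
lemma cone_in_ball:
  assumes r0: "r0 > 0" and \<delta>: "outer_scale * exp (- lo) = \<delta> * r0" "\<delta> > 0"
    and x: "x \<in> annulus lo hi" "\<delta> * norm x \<le> x \<bullet> axis e 1"
  shows "x \<in> ball (r0 *\<^sub>R axis e 1) r0"
proof -
  have n: "norm x > 0" using x(1) zero_notin_annulus by auto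
  have "(norm x)\<^sup>2 \<le> norm x * (\<delta> * r0)"
    using x(1) n \<delta> by (simp add: annulus_def power2_eq_square)
  also have "\<dots> \<le> r0 * (x \<bullet> axis e 1)" using mult_left_mono[OF x(2), of r0] r0 by (simp add: mult_ac)
  also have "\<dots> < 2 * (r0 * (x \<bullet> axis e 1))"
  proof -
    have "0 < \<delta> * norm x" using \<delta> n by simp
    then have "0 < x \<bullet> axis e 1" using x(2) by linarith
    then show ?thesis using r0 by simp
  qed
  finally have "(norm (r0 *\<^sub>R axis e 1 - x))\<^sup>2 < r0\<^sup>2"
    unfolding power2_norm_eq_inner
    by (simp add: inner_diff_left inner_diff_right inner_axis_axis inner_commute power2_eq_square)
  then show ?thesis using r0 power_less_imp_less_base[of _ 2 r0] by (simp add: dist_norm)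
qed

text \<open>
  The competitor is \<open>|x| powr (1 - n/2)\<close> times the radial profile times the angular cut-off. The radial
  energy contributes \<open>(n/2 - 1)\<^sup>2\<close> and the angular one \<open>n - 1\<close>, up to \<open>O(\<delta>)\<close>, and these add up to \<open>n\<^sup>2/4\<close>. The profile then
  reproduces the lower weights exactly and the last one with constant \<open>1/4 + C / K\<^sup>2\<close>. The width \<open>K\<close> is chosen
  first; then \<open>a\<close> is taken so large that the support is close enough to the origin for the angular error
  to be small compared with the last weight.
\<close>
lemma ex_near_optimal:
  fixes e :: 'n
  defines "n \<equiv> real CARD('n)"
  assumes ball: "ball (r0 *\<^sub>R axis e 1) r0 \<subseteq> \<Omega>" "r0 > 0" and m: "m \<ge> 1" and \<epsilon>: "\<epsilon> > 0"
  shows "\<exists>u\<in>test_functions \<Omega>. (\<exists>x. u x \<noteq> 0) \<and>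
    dirichlet_energy \<Omega> u - n\<^sup>2 / 4 * (LINT x:\<Omega>|lborel. (u x)\<^sup>2 / (norm x)\<^sup>2)
      - 1 / 4 * (\<Sum>i=1..m-1. hardy_term \<Omega> D i u) \<le> (1 / 4 + \<epsilon>) * hardy_term \<Omega> D m u"
proof -
  have n: "n \<ge> 1" by (simp add: n_def Suc_le_eq)
  obtain b \<beta> C where bump: "\<And>k. Ck_on k UNIV b" "Ck_on 1 UNIV \<beta>"
    "\<And>y. (\<beta> has_real_derivative ((deriv b y)\<^sup>2 - C * (b y)\<^sup>2)) (at y)"
    "\<And>y. y \<notin> {0..1} \<Longrightarrow> b y = 0" "\<And>y. y \<notin> {0..1} \<Longrightarrow> \<beta> y = 0" "b (1 / 2) \<noteq> 0"
    using ex_bump by blast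
  obtain K where K: "K > 0" "C / K\<^sup>2 \<le> \<epsilon> / 2"
  proof
    \<comment> \<open>The maximum with 1 gives \<open>K \<le> K\<^sup>2\<close>.\<close>
    define K where "K = max 1 (2 * \<bar>C\<bar> / \<epsilon>)"
    have "K * 1 \<le> K * K" by (intro mult_left_mono) (auto simp: K_def)
    then have "2 * \<bar>C\<bar> / \<epsilon> \<le> K\<^sup>2" by (simp add: power2_eq_square K_def)
    then have "\<bar>C\<bar> \<le> \<epsilon> / 2 * K\<^sup>2" using \<epsilon> by (simp add: field_simps)
    then have "C \<le> \<epsilon> / 2 * K\<^sup>2" by simp
    then show "C / K\<^sup>2 \<le> \<epsilon> / 2" by (simp add: divide_le_eq K_def)
    show "K > 0" by (simp add: K_def)
  qed
  obtain a where a: "a > 0"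
    and small: "8 * n\<^sup>2 * (outer_scale / r0) * (exp (- exp_tower m a) * (1 + exp_tower m (a + K)) ^ (2 * m)) < min 1 (\<epsilon> / 2)"
  proof -
    have "((\<lambda>a. 8 * n\<^sup>2 * (outer_scale / r0) * (exp (- exp_tower m a) * (1 + exp_tower m (a + K)) ^ (2 * m)))
        \<longlongrightarrow> 8 * n\<^sup>2 * (outer_scale / r0) * 0) at_top"
      by (intro tendsto_mult tendsto_const exp_tower_negligible m)
    then have "\<forall>\<^sub>F a in at_top. 8 * n\<^sup>2 * (outer_scale / r0) * (exp (- exp_tower m a) * (1 + exp_tower m (a + K)) ^ (2 * m)) < min 1 (\<epsilon> / 2)"
      by (rule order_tendstoD(2)) (use \<epsilon> in simp)
    from eventually_conj[OF this eventually_gt_at_top[of 0]] obtain a where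
      "8 * n\<^sup>2 * (outer_scale / r0) * (exp (- exp_tower m a) * (1 + exp_tower m (a + K)) ^ (2 * m)) < min 1 (\<epsilon> / 2)" "a > 0"
      using eventually_happens'[OF trivial_limit_at_top_linorder] by blast
    then show ?thesis using that by blast
  qed
  define lo where "lo = exp_tower m a"
  define hi where "hi = exp_tower m (a + K)"
  have lo: "lo > 0" and hi: "hi > 0" unfolding lo_def hi_def using a K by (auto intro!: exp_tower_pos)
  obtain G F where G: "\<And>k. Ck_on k UNIV G" and F: "Ck_on 1 UNIV F"
    and z: "\<And>t. t \<notin> {lo..hi} \<Longrightarrow> G t = 0" "\<And>t. t \<notin> {lo..hi} \<Longrightarrow> F t = 0"
    and nz: "\<exists>t>0. G t \<noteq> 0"
    and id: "\<And>t. t > 0 \<Longrightarrow> (deriv G t)\<^sup>2 = (1 / 4 + C / K\<^sup>2) * ((zprod m t)\<^sup>2 * (G t)\<^sup>2)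
        + 1 / 4 * (\<Sum>i=1..m-1. (zprod i t)\<^sup>2 * (G t)\<^sup>2) + deriv F t"
    using ex_hardy_profile[OF bump a K(1) m] unfolding lo_def hi_def by blast
  \<comment> \<open>The radial support reaches up to \<open>|x| = \<delta> r\<^sub>0\<close>, and up to this radius the cone lies in the ball.\<close>
  define \<delta> where "\<delta> = outer_scale / r0 * exp (- lo)"
  have \<delta>: "\<delta> > 0" using outer_scale_pos ball(2) by (simp add: \<delta>_def)
  have sm: "8 * n\<^sup>2 * \<delta> * (1 + hi) ^ (2 * m) < min 1 (\<epsilon> / 2)"
    using small by (simp add: \<delta>_def lo_def hi_def mult.assoc)
  have \<delta>1: "8 * n * \<delta> \<le> 1"
  proof -
    have "8 * n * \<delta> * 1 \<le> 8 * n\<^sup>2 * \<delta> * (1 + hi) ^ (2 * m)"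
      using n \<delta> hi by (intro mult_mono one_le_power) (auto simp: power2_eq_square)
    then show ?thesis using sm by simp
  qed
  define p where "p = 1 - n / 2"
  define u where "u = separable e p G (cap \<delta>)"
  define K' where "K' = annulus lo hi \<inter> {x. \<delta> * norm x \<le> x \<bullet> axis e 1}"
  have K'c: "compact K'"
    unfolding K'_def by (intro compact_Int_closed compact_annulus closed_Collect_le continuous_intros)
  have K'\<Omega>: "K' \<subseteq> \<Omega>"
  proof
    fix x assume "x \<in> K'"
    then have "x \<in> ball (r0 *\<^sub>R axis e 1) r0"
      using ball(2) \<delta> by (intro cone_in_ball[of r0 lo \<delta> x hi e]) (auto simp: K'_def \<delta>_def)
    then show "x \<in> \<Omega>" using ball(1) by blast
  qed
  have u0: "u x = 0" if "x \<notin> K'" for x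
  proof (cases "x \<in> annulus lo hi")
    case True
    then have "x \<bullet> axis e 1 < \<delta> * norm x" "norm x > 0"
      using that zero_notin_annulus[of lo hi] by (auto simp: K'_def)
    then have "cosine e x \<le> \<delta>" by (simp add: cosine_def divide_le_eq)
    then show ?thesis by (simp add: u_def separable_def cap_eq_0[OF \<delta>])
  next
    case False
    show ?thesis unfolding u_def by (rule separable_zero_outside[OF z(1) False])
  qed
  have uC: "Ck_on k UNIV u" for k unfolding u_def using Ck_on_separable[OF G z(1) Ck_on_cap] by blast
  have ut: "u \<in> test_functions \<Omega>" by (rule test_functionsI[OF K'c K'\<Omega> u0 uC])
  have unz: "\<exists>x. u x \<noteq> 0"
  proof -
    obtain t where t: "t > 0" "G t \<noteq> 0" using nz by blast
    \<comment> \<open>On the axis of the cone the cosine is 1.\<close>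
    define x :: "real ^ 'n" where "x = (outer_scale * exp (- t)) *\<^sub>R axis e 1"
    have nx: "norm x = outer_scale * exp (- t)" using outer_scale_pos by (simp add: x_def norm_axis_1)
    have "tau x = t" using outer_scale_pos by (simp add: tau_def nx exp_minus inverse_eq_divide)
    moreover have "cosine e x = 1" using outer_scale_pos unfolding cosine_def nx by (simp add: x_def inner_axis_axis)
    moreover have "norm x \<noteq> 0" using outer_scale_pos by (simp add: nx)
    moreover have "cap \<delta> 1 \<noteq> 0"
    proof -
      have "\<delta> * 1 \<le> \<delta> * n" using n \<delta> by (intro mult_left_mono) auto
      moreover have "8 * (\<delta> * n) \<le> 1" using \<delta>1 by (simp add: mult_ac)
      ultimately have "\<delta> < 1" using \<delta> by linarith
      then show ?thesis using cap_pos[OF \<delta>, of 1] by simp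
    qed
    ultimately show ?thesis using t by (intro exI[of _ x]) (simp add: u_def separable_def)
  qed
  let ?S = "separable e (- real CARD('n))" and ?Z = "\<lambda>s. (cap \<delta> s)\<^sup>2"
  have usq: "(u x)\<^sup>2 / (norm x)\<^sup>2 = norm x powr (- real CARD('n)) * (G (tau x))\<^sup>2 * (cap \<delta> (cosine e x))\<^sup>2" for x
  proof (cases "x = 0")
    case False
    then have "(norm x powr p)\<^sup>2 / (norm x)\<^sup>2 = norm x powr (- real CARD('n))"
      by (simp add: p_def n_def powr_power power2_eq_square[of "norm x"] powr_diff powr_minus field_simps flip: powr_add)
    moreover have "(u x)\<^sup>2 / (norm x)\<^sup>2 = (norm x powr p)\<^sup>2 / (norm x)\<^sup>2 * (G (tau x))\<^sup>2 * (cap \<delta> (cosine e x))\<^sup>2"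
      by (simp add: u_def separable_def power_mult_distrib)
    ultimately show ?thesis by simp
  qed (simp add: u_def separable_def)
  define h where "h i t = (zprod i t)\<^sup>2 * (G t)\<^sup>2" for i t
  have hz: "h i t = 0" if "t \<notin> {lo..hi}" for i t using z(1)[OF that] by (simp add: h_def)
  have hC: "Ck_on 1 UNIV (h i)" for i
    by (rule Ck_on_zero_extension[of "{0<..}" "{lo..hi}"])
       (use lo hz in \<open>auto simp: h_def[abs_def] intro!: Ck_intros Ck_on_zprod Ck_on_subset[OF G]\<close>)
  have hc: "continuous_on UNIV (h i)" for i using hC by (rule Ck_on_imp_continuous)
  have cc: "continuous_on UNIV (cap \<delta>)" "continuous_on UNIV (cap_deriv \<delta>)"
    using Ck_on_cap[of 0] Ck_on_cap_deriv[of 0] by auto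
  have Zc: "continuous_on UNIV ?Z" by (intro continuous_intros cc)
  have hardy: "hardy_term \<Omega> D i u = polar_integral e (h i) ?Z" for i
    unfolding hardy_term_eq(1)[OF ut] polar_integral_def usq
    by (intro Bochner_Integration.integral_cong refl) (simp add: separable_def h_def)
  have lead: "(LINT x:\<Omega>|lborel. (u x)\<^sup>2 / (norm x)\<^sup>2) = polar_integral e (h 0) ?Z"
    unfolding leading_term_eq(1)[OF ut] polar_integral_def
    by (intro Bochner_Integration.integral_cong refl) (simp only: usq, simp add: separable_def h_def)
  define H where "H t = (p * G t - deriv G t)\<^sup>2" for t
  \<comment> \<open>The mixed term \<open>- 2 p G G'\<close> of the radial energy is the derivative of \<open>- p G\<^sup>2\<close>.\<close>
  define F3 where "F3 t = F t - p * h 0 t" for t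
  note G' = Ck_on_1_deriv[OF G] and F' = Ck_on_1_deriv[OF F]
  have F3C: "Ck_on 1 UNIV F3" unfolding F3_def[abs_def] by (intro Ck_intros F hC)
  have F3z: "F3 t = 0" if "t \<notin> {lo..hi}" for t using z(2)[OF that] hz[OF that] by (simp add: F3_def)
  note F3' = Ck_on_1_deriv[OF F3C]
  have G'z: "deriv G t = 0" "deriv F3 t = 0" if "t \<notin> {lo..hi}" for t
    using deriv_zero_outside[of lo hi G t] deriv_zero_outside[of lo hi F3 t] z(1) F3z that by blast+
  have Hz: "H t = 0" if "t \<notin> {lo..hi}" for t using z(1)[OF that] G'z[OF that] by (simp add: H_def)
  have Hc: "continuous_on UNIV H" unfolding H_def using G[of 0] by (intro continuous_intros G') simp
  have dF3: "deriv F3 t = deriv F t - 2 * p * G t * deriv G t" for t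
  proof (rule DERIV_imp_deriv)
    have "((\<lambda>t. F t - p * (G t)\<^sup>2) has_real_derivative deriv F t - 2 * p * G t * deriv G t) (at t)"
      by (rule derivative_eq_intros F' G' refl)+ simp
    then show "(F3 has_real_derivative deriv F t - 2 * p * G t * deriv G t) (at t)"
      by (simp add: F3_def[abs_def] h_def)
  qed
  have Hid: "H t = p\<^sup>2 * h 0 t + (1 / 4 + C / K\<^sup>2) * h m t + 1 / 4 * (\<Sum>i=1..m-1. h i t) + deriv F3 t" for t
  proof (cases "t > 0")
    case True
    have "H t = p\<^sup>2 * h 0 t + (deriv G t)\<^sup>2 - 2 * p * G t * deriv G t"
      by (simp add: H_def h_def power2_eq_square algebra_simps)
    then show ?thesis using id[OF True] dF3[of t] unfolding h_def by simp
  next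
    case False
    then have "t \<notin> {lo..hi}" using lo by auto
    then show ?thesis using Hz hz G'z by simp
  qed
  have F3I: "polar_integral e (deriv F3) ?Z = 0"
    by (rule polar_integral_derivative_eq_0[OF F3C F3'(1) F3z, where W' = "\<lambda>s. 2 * cap \<delta> s * cap_deriv \<delta> s"])
       (auto intro!: Ck_intros Ck_on_cap derivative_eq_intros cap_has_derivative \<delta>)
  have int: "integrable lborel (?S f ?Z)" if "continuous_on UNIV f" "\<And>t. t \<notin> {lo..hi} \<Longrightarrow> f t = 0" for f
    by (rule integrable_separable[OF that Zc])
  have HI: "polar_integral e H ?Z = p\<^sup>2 * polar_integral e (h 0) ?Z + (1 / 4 + C / K\<^sup>2) * polar_integral e (h m) ?Z
      + 1 / 4 * (\<Sum>i=1..m-1. polar_integral e (h i) ?Z)"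
  proof -
    have eq: "?S H ?Z x = p\<^sup>2 * ?S (h 0) ?Z x + (1 / 4 + C / K\<^sup>2) * ?S (h m) ?Z x
        + 1 / 4 * (\<Sum>i=1..m-1. ?S (h i) ?Z x) + ?S (deriv F3) ?Z x" for x
      unfolding separable_def Hid by (simp add: sum_distrib_left sum_distrib_right algebra_simps)
    have "polar_integral e H ?Z = (LINT x|lborel. p\<^sup>2 * ?S (h 0) ?Z x + (1 / 4 + C / K\<^sup>2) * ?S (h m) ?Z x
        + 1 / 4 * (\<Sum>i=1..m-1. ?S (h i) ?Z x) + ?S (deriv F3) ?Z x)"
      unfolding polar_integral_def by (intro Bochner_Integration.integral_cong refl eq)
    also have "\<dots> = p\<^sup>2 * polar_integral e (h 0) ?Z + (1 / 4 + C / K\<^sup>2) * polar_integral e (h m) ?Z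
      + 1 / 4 * (\<Sum>i=1..m-1. polar_integral e (h i) ?Z) + polar_integral e (deriv F3) ?Z"
      using int[OF hc hz] int[OF F3'(2) G'z(2)] unfolding polar_integral_def by simp
    finally show ?thesis using F3I by simp
  qed
  have energy: "dirichlet_energy \<Omega> u = polar_integral e H ?Z + polar_integral e (h 0) (\<lambda>s. (1 - s\<^sup>2) * (cap_deriv \<delta> s)\<^sup>2)"
  proof -
    have "dirichlet_energy \<Omega> u = (LINT x|lborel. (norm (gradient u x))\<^sup>2)"
      unfolding dirichlet_energy_def
      by (rule set_integral_zero_outside) (use gradient_compact_support(2)[OF uC K'c u0] K'\<Omega> in auto)
    also have "\<dots> = (LINT x|lborel. ?S H ?Z x + 1 * ?S (h 0) (\<lambda>s. (1 - s\<^sup>2) * (cap_deriv \<delta> s)\<^sup>2) x)"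
    proof (intro Bochner_Integration.integral_cong refl)
      fix x :: "real ^ 'n"
      have pe: "2 * p - 2 = - real CARD('n)" by (simp add: p_def n_def)
      have "(norm (gradient u x))\<^sup>2
        = norm x powr (- real CARD('n)) * ((p * G (tau x) - deriv G (tau x))\<^sup>2 * (cap \<delta> (cosine e x))\<^sup>2
          + (G (tau x))\<^sup>2 * ((1 - (cosine e x)\<^sup>2) * (cap_deriv \<delta> (cosine e x))\<^sup>2))"
        unfolding u_def pe[symmetric] using G' cap_has_derivative[OF \<delta>] z(1) by (intro gradient_separable)
      then show "(norm (gradient u x))\<^sup>2 = ?S H ?Z x + 1 * ?S (h 0) (\<lambda>s. (1 - s\<^sup>2) * (cap_deriv \<delta> s)\<^sup>2) x"
        by (simp add: separable_def H_def h_def algebra_simps)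
    qed
    also have "\<dots> = polar_integral e H ?Z + 1 * polar_integral e (h 0) (\<lambda>s. (1 - s\<^sup>2) * (cap_deriv \<delta> s)\<^sup>2)"
      by (rule polar_integral_linear[OF Hc Hz Zc hc hz]) (auto intro!: continuous_intros cc)
    finally show ?thesis by simp
  qed
  have cd: "polar_integral e (h 0) (\<lambda>s. (1 - s\<^sup>2) * (cap_deriv \<delta> s)\<^sup>2)
      \<le> (n - 1) * polar_integral e (h 0) ?Z + 8 * n\<^sup>2 * \<delta> * polar_integral e (h 0) ?Z"
  proof -
    have "h 0 t \<ge> 0" for t by (simp add: h_def)
    from polar_integral_cap_defect[OF hC hz this \<delta>] \<delta>1 show ?thesis
      by (simp add: n_def of_nat_diff Suc_le_eq)
  qed
  have J: "polar_integral e (h 0) ?Z \<le> (1 + hi) ^ (2 * m) * polar_integral e (h m) ?Z"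
  proof -
    have "polar_integral e (h 0) ?Z \<le> polar_integral e (\<lambda>t. (1 + hi) ^ (2 * m) * h m t) ?Z"
    proof (rule polar_integral_mono[OF hc hz Zc _ _ Zc])
      fix t s :: real
      have "h 0 t \<le> (1 + hi) ^ (2 * m) * h m t"
      proof (cases "t \<in> {lo..hi}")
        case True
        then have t: "t > 0" "t \<le> hi" using lo by auto
        have "1 \<le> zprod m t * (1 + t) ^ m" by (rule zprod_ge_power[OF t(1)])
        also have "\<dots> \<le> zprod m t * (1 + hi) ^ m"
          using t zprod_pos[of m t] by (intro mult_left_mono power_mono) auto
        finally have "1 \<le> (zprod m t * (1 + hi) ^ m)\<^sup>2" by (rule one_le_power)
        also have "\<dots> = (1 + hi) ^ (2 * m) * (zprod m t)\<^sup>2"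
          by (simp add: power_mult_distrib mult.commute power_mult[symmetric])
        finally have "1 * (G t)\<^sup>2 \<le> ((1 + hi) ^ (2 * m) * (zprod m t)\<^sup>2) * (G t)\<^sup>2"
          by (intro mult_right_mono) auto
        then show ?thesis by (simp add: h_def mult.assoc)
      qed (simp add: hz)
      then show "h 0 t * (cap \<delta> s)\<^sup>2 \<le> (1 + hi) ^ (2 * m) * h m t * (cap \<delta> s)\<^sup>2" by (intro mult_right_mono) auto
    qed (use hc hz in \<open>auto intro!: continuous_intros\<close>)
    also have "\<dots> = (LINT x|lborel. (1 + hi) ^ (2 * m) * ?S (h m) ?Z x)"
      unfolding polar_integral_def separable_def by (intro Bochner_Integration.integral_cong refl) (simp add: mult_ac)
    also have "\<dots> = (1 + hi) ^ (2 * m) * polar_integral e (h m) ?Z" by (simp add: polar_integral_def)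
    finally show ?thesis .
  qed
  have Hm0: "polar_integral e (h m) ?Z \<ge> 0" using hardy_term_nonneg[OF ut, of m] by (simp add: hardy)
  have err: "8 * n\<^sup>2 * \<delta> * polar_integral e (h 0) ?Z \<le> \<epsilon> / 2 * polar_integral e (h m) ?Z"
  proof -
    have "8 * n\<^sup>2 * \<delta> * polar_integral e (h 0) ?Z \<le> 8 * n\<^sup>2 * \<delta> * ((1 + hi) ^ (2 * m) * polar_integral e (h m) ?Z)"
      using \<delta> by (intro mult_left_mono J) auto
    also have "\<dots> = (8 * n\<^sup>2 * \<delta> * (1 + hi) ^ (2 * m)) * polar_integral e (h m) ?Z" by (simp only: mult.assoc)
    also have "\<dots> \<le> \<epsilon> / 2 * polar_integral e (h m) ?Z" using sm by (intro mult_right_mono Hm0) auto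
    finally show ?thesis .
  qed
  have errK: "C / K\<^sup>2 * polar_integral e (h m) ?Z \<le> \<epsilon> / 2 * polar_integral e (h m) ?Z"
    by (intro mult_right_mono K Hm0)
  have "p\<^sup>2 + (n - 1) = n\<^sup>2 / 4" by (simp add: p_def power2_eq_square field_simps)
  then have pJ: "p\<^sup>2 * J + (n - 1) * J = n\<^sup>2 / 4 * J" for J by (simp flip: distrib_right)
  have "dirichlet_energy \<Omega> u - n\<^sup>2 / 4 * (LINT x:\<Omega>|lborel. (u x)\<^sup>2 / (norm x)\<^sup>2)
      - 1 / 4 * (\<Sum>i=1..m-1. hardy_term \<Omega> D i u) \<le> (1 / 4 + \<epsilon>) * hardy_term \<Omega> D m u"
    unfolding energy HI lead hardy
    using cd err errK pJ[of "polar_integral e (h 0) ?Z"] by (simp only: distrib_right)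
  then show ?thesis using ut unz by blast
qed

end

text \<open>
  Two disjoint balls that touch at the origin are tangent there, so their centres are opposite.
\<close>
lemma interior_ball_center:
  fixes \<Omega> :: "(real ^ 'n::finite) set"
  assumes "\<rho> > 0" "r > 0" "ball (- \<rho> *\<^sub>R axis e 1) \<rho> \<subseteq> - closure \<Omega>"
    and "ball c r \<subseteq> \<Omega>" "0 \<in> frontier (ball c r)"
  shows "c = r *\<^sub>R axis e 1"
proof -
  let ?v = "\<rho> *\<^sub>R axis e 1 :: real ^ 'n"
  have nc: "norm c = r" using assms(2,5) by (simp add: frontier_ball sphere_def dist_norm)
  define w where "w = c + ?v"
  have "r + \<rho> \<le> norm w"
  proof (rule ccontr)
    assume "\<not> r + \<rho> \<le> norm w"
    then have w: "norm w < r + \<rho>" by simp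
    \<comment> \<open>The point dividing the segment between the centres in the ratio of the radii.\<close>
    define p where "p = (\<rho> / (r + \<rho>)) *\<^sub>R w - ?v"
    have "norm ((\<rho> / (r + \<rho>)) *\<^sub>R w) < \<rho>"
      using w assms(1,2) by (simp add: divide_simps)
    then have 1: "p \<in> ball (- \<rho> *\<^sub>R axis e 1) \<rho>"
      by (simp add: p_def dist_norm norm_minus_commute)
    have "c - p = (r / (r + \<rho>)) *\<^sub>R w"
    proof -
      have "c - p = w - (\<rho> / (r + \<rho>)) *\<^sub>R w" by (simp add: p_def w_def)
      also have "\<dots> = (1 - \<rho> / (r + \<rho>)) *\<^sub>R w" by (simp add: scaleR_diff_left)
      also have "1 - \<rho> / (r + \<rho>) = r / (r + \<rho>)" using assms(1,2) by (simp add: field_simps)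
      finally show ?thesis .
    qed
    then have "norm (c - p) < r" using w assms(1,2) by (simp add: divide_simps)
    then have "p \<in> ball c r" by (simp add: dist_norm)
    then show False using 1 assms(3,4) closure_subset[of \<Omega>] by blast
  qed
  then have "(r + \<rho>)\<^sup>2 \<le> (norm w)\<^sup>2" using assms(1,2) by (intro power_mono) auto
  moreover have cc: "c \<bullet> c = r\<^sup>2" using nc by (simp flip: power2_norm_eq_inner)
  ultimately have "2 * \<rho> * r \<le> 2 * \<rho> * (c \<bullet> axis e 1)"
    unfolding power2_norm_eq_inner
    by (simp add: w_def inner_add_left inner_add_right inner_axis_axis inner_commute power2_eq_square algebra_simps)
  then have le: "r \<le> c \<bullet> axis e 1" using assms(1) by simp
  have "(norm (c - r *\<^sub>R axis e 1))\<^sup>2 = 2 * r * (r - c \<bullet> axis e 1)"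
    unfolding power2_norm_eq_inner
    by (simp add: inner_diff_left inner_diff_right inner_axis_axis inner_commute cc power2_eq_square algebra_simps)
  also have "\<dots> \<le> 0" using le assms(2) by (simp add: mult_nonneg_nonpos)
  finally show ?thesis by simp
qed

section \<open>Sharp constants\<close>

lemma INF_ereal_quotient_eq:
  fixes f g :: "'a \<Rightarrow> real"
  assumes pos: "\<And>u. u \<in> S \<Longrightarrow> g u > 0" and lower: "\<And>u. u \<in> S \<Longrightarrow> c * g u \<le> f u"
    and upper: "\<And>\<epsilon>. \<epsilon> > 0 \<Longrightarrow> \<exists>u\<in>S. f u \<le> (c + \<epsilon>) * g u"
  shows "(INF u\<in>S. ereal (f u / g u)) = ereal c"
proof (rule antisym)
  show "ereal c \<le> (INF u\<in>S. ereal (f u / g u))"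
    by (rule INF_greatest) (use pos lower in \<open>simp add: pos_le_divide_eq\<close>)
  show "(INF u\<in>S. ereal (f u / g u)) \<le> ereal c"
  proof (rule ereal_le_epsilon2)
    fix \<epsilon> :: real assume "\<epsilon> > 0"
    then obtain u where u: "u \<in> S" "f u \<le> (c + \<epsilon>) * g u" using upper by blast
    have "(INF u\<in>S. ereal (f u / g u)) \<le> ereal (f u / g u)" by (rule INF_lower[OF u(1)])
    also have "\<dots> \<le> ereal c + ereal \<epsilon>" using u(2) pos[OF u(1)] by (simp add: pos_divide_le_eq)
    finally show "(INF u\<in>S. ereal (f u / g u)) \<le> ereal c + ereal \<epsilon>" .
  qed
qed

lemma summable_suminf_le_of_partial_sums:
  fixes f :: "nat \<Rightarrow> real"
  assumes "\<And>i. 0 \<le> f i" "\<And>m. (\<Sum>i=1..m. f i) \<le> B"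
  shows "summable (\<lambda>i. f (Suc i))" "(\<Sum>i. f (Suc i)) \<le> B"
proof -
  have le: "(\<Sum>i<m. f (Suc i)) \<le> B" for m
    using assms(2)[of m] by (simp add: sum.atLeast1_atMost_eq)
  show s: "summable (\<lambda>i. f (Suc i))"
    by (rule bounded_imp_summable[where B = B]) (use assms(1) le[of "Suc _"] in \<open>auto simp: lessThan_Suc_atMost\<close>)
  show "(\<Sum>i. f (Suc i)) \<le> B" by (rule suminf_le_const[OF s le])
qed

theorem theorem3:
  assumes "CARD('n::finite) \<ge> 2"
  shows "\<exists>\<sigma>>0. \<forall>(e :: 'n) (\<Omega> :: (real ^ 'n) set) (\<rho> :: real) (D :: real).
    open \<Omega> \<longrightarrow> connected \<Omega> \<longrightarrow> \<Omega> \<noteq> {} \<longrightarrow> bounded \<Omega> \<longrightarrow> 0 \<in> frontier \<Omega> \<longrightarrow>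
    \<rho> > 0 \<longrightarrow> ball (- \<rho> *\<^sub>R axis e 1) \<rho> \<subseteq> - closure \<Omega> \<longrightarrow>
    D = (SUP x\<in>\<Omega>. norm x) \<longrightarrow> \<rho> \<ge> D / \<sigma> \<longrightarrow>
    (\<forall>u \<in> test_functions \<Omega>.
        summable (\<lambda>i. hardy_term \<Omega> D (Suc i) u) \<and>
        dirichlet_energy \<Omega> u
          \<ge> (real CARD('n))\<^sup>2 / 4 * (LINT x:\<Omega>|lborel. (u x)\<^sup>2 / (norm x)\<^sup>2)
            + 1 / 4 * (\<Sum>i. hardy_term \<Omega> D (Suc i) u)) \<and>
    (interior_ball_at_0 \<Omega> \<longrightarrow>
      (INF u \<in> {u \<in> test_functions \<Omega>. \<exists>x. u x \<noteq> 0}. ereal (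
          (dirichlet_energy \<Omega> u
             - (real CARD('n))\<^sup>2 / 4 * (LINT x:\<Omega>|lborel. (u x)\<^sup>2 / (norm x)\<^sup>2))
          / hardy_term \<Omega> D 1 u)) = ereal (1 / 4) \<and>
      (\<forall>m\<ge>2.
        (INF u \<in> {u \<in> test_functions \<Omega>. \<exists>x. u x \<noteq> 0}. ereal (
          (dirichlet_energy \<Omega> u
             - (real CARD('n))\<^sup>2 / 4 * (LINT x:\<Omega>|lborel. (u x)\<^sup>2 / (norm x)\<^sup>2)
             - 1 / 4 * (\<Sum>i = 1..m - 1. hardy_term \<Omega> D i u))
          / hardy_term \<Omega> D m u)) = ereal (1 / 4)))"
proof -
  define n where "n = real CARD('n)"
  have n: "n \<ge> 2" using assms by (simp add: n_def)
  define \<sigma> where "\<sigma> = 1 / (8 * n * (n + 1))"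
  have \<sigma>: "\<sigma> > 0" using n by (simp add: \<sigma>_def)
  show ?thesis
  proof (rule exI[of _ \<sigma>], intro conjI \<sigma> allI impI)
    fix e :: 'n and \<Omega> :: "(real ^ 'n) set" and \<rho> D :: real
    assume \<Omega>: "open \<Omega>" "\<Omega> \<noteq> {}" "bounded \<Omega>" "0 \<in> frontier \<Omega>"
      and \<rho>: "\<rho> > 0" "ball (- \<rho> *\<^sub>R axis e 1) \<rho> \<subseteq> - closure \<Omega>"
      and D: "D = (SUP x\<in>\<Omega>. norm x)" and \<rho>D: "\<rho> \<ge> D / \<sigma>"
    have z: "0 \<notin> \<Omega>" using \<Omega>(1,4) by (simp add: frontier_def interior_open)
    have "bdd_above (norm ` \<Omega>)" using \<Omega>(3) by (auto simp: bounded_iff bdd_above_def)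
    then have le: "norm x \<le> D" if "x \<in> \<Omega>" for x
      unfolding D using that by (intro cSUP_upper)
    obtain x0 where x0: "x0 \<in> \<Omega>" using \<Omega>(2) by blast
    then have "norm x0 > 0" using z by auto
    then have Dpos: "D > 0" using le[OF x0] by linarith
    interpret punctured_domain \<Omega> D by unfold_locales (use \<Omega>(1) z le Dpos in auto)
    have \<rho>n: "8 * n * (n + 1) * D \<le> \<rho>" using \<rho>D by (simp add: \<sigma>_def mult_ac)
    have hardy: "n\<^sup>2 / 4 * (LINT x:\<Omega>|lborel. (u x)\<^sup>2 / (norm x)\<^sup>2) + 1 / 4 * (\<Sum>i=1..m. hardy_term \<Omega> D i u)
        \<le> dirichlet_energy \<Omega> u" if "u \<in> test_functions \<Omega>" for u m
      unfolding n_def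
      by (rule improved_hardy_finite[OF that \<rho>(1) \<rho>n[unfolded n_def]])
         (rule exterior_ball_imp_pos[OF \<Omega>(1) \<rho>])
    show "\<forall>u \<in> test_functions \<Omega>. summable (\<lambda>i. hardy_term \<Omega> D (Suc i) u) \<and>
        dirichlet_energy \<Omega> u \<ge> (real CARD('n))\<^sup>2 / 4 * (LINT x:\<Omega>|lborel. (u x)\<^sup>2 / (norm x)\<^sup>2)
            + 1 / 4 * (\<Sum>i. hardy_term \<Omega> D (Suc i) u)"
    proof
      fix u assume u: "u \<in> test_functions \<Omega>"
      have rearrange: "J + 1 / 4 * s \<le> d \<longleftrightarrow> s \<le> 4 * (d - J)" for J s d :: real by (simp add: field_simps)
      have "(\<Sum>i=1..m. hardy_term \<Omega> D i u)
          \<le> 4 * (dirichlet_energy \<Omega> u - n\<^sup>2 / 4 * (LINT x:\<Omega>|lborel. (u x)\<^sup>2 / (norm x)\<^sup>2))" for m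
        by (rule hardy[OF u, of m, unfolded rearrange])
      note s = summable_suminf_le_of_partial_sums[OF hardy_term_nonneg[OF u] this]
      then show "summable (\<lambda>i. hardy_term \<Omega> D (Suc i) u) \<and>
        dirichlet_energy \<Omega> u \<ge> (real CARD('n))\<^sup>2 / 4 * (LINT x:\<Omega>|lborel. (u x)\<^sup>2 / (norm x)\<^sup>2)
            + 1 / 4 * (\<Sum>i. hardy_term \<Omega> D (Suc i) u)"
        unfolding n_def[symmetric] rearrange by blast
    qed
    assume "interior_ball_at_0 \<Omega>"
    then obtain c r where r: "r > 0" "ball c r \<subseteq> \<Omega>" "0 \<in> frontier (ball c r)"
      by (auto simp: interior_ball_at_0_def)
    have ball: "ball (r *\<^sub>R axis e 1) r \<subseteq> \<Omega>"
      using interior_ball_center[OF \<rho>(1) r(1) \<rho>(2) r(2,3)] r(2) by simp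
    have sharp: "(INF u \<in> {u \<in> test_functions \<Omega>. \<exists>x. u x \<noteq> 0}. ereal (
          (dirichlet_energy \<Omega> u
             - (real CARD('n))\<^sup>2 / 4 * (LINT x:\<Omega>|lborel. (u x)\<^sup>2 / (norm x)\<^sup>2)
             - 1 / 4 * (\<Sum>i = 1..m - 1. hardy_term \<Omega> D i u))
          / hardy_term \<Omega> D m u)) = ereal (1 / 4)" if m: "m \<ge> 1" for m
    proof (rule INF_ereal_quotient_eq)
      fix u assume u: "u \<in> {u \<in> test_functions \<Omega>. \<exists>x. u x \<noteq> 0}"
      then show "hardy_term \<Omega> D m u > 0" using hardy_term_pos by blast
      have rearrange: "1 / 4 * h \<le> d - J - 1 / 4 * s'" if "J + 1 / 4 * s \<le> d" "s = s' + h" for J s s' h d :: real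
        using that by (simp add: field_simps)
      have "(\<Sum>i=1..m. hardy_term \<Omega> D i u) = (\<Sum>i=1..m-1. hardy_term \<Omega> D i u) + hardy_term \<Omega> D m u"
        using m by (cases m) auto
      then show "1 / 4 * hardy_term \<Omega> D m u \<le> dirichlet_energy \<Omega> u
             - (real CARD('n))\<^sup>2 / 4 * (LINT x:\<Omega>|lborel. (u x)\<^sup>2 / (norm x)\<^sup>2)
             - 1 / 4 * (\<Sum>i = 1..m - 1. hardy_term \<Omega> D i u)"
        by (rule rearrange[rotated]) (use hardy[of u m] u in \<open>simp add: n_def\<close>)
    next
      fix \<epsilon> :: real assume "\<epsilon> > 0"
      then show "\<exists>u\<in>{u \<in> test_functions \<Omega>. \<exists>x. u x \<noteq> 0}. dirichlet_energy \<Omega> u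
             - (real CARD('n))\<^sup>2 / 4 * (LINT x:\<Omega>|lborel. (u x)\<^sup>2 / (norm x)\<^sup>2)
             - 1 / 4 * (\<Sum>i = 1..m - 1. hardy_term \<Omega> D i u) \<le> (1 / 4 + \<epsilon>) * hardy_term \<Omega> D m u"
        using ex_near_optimal[OF ball r(1) m, of \<epsilon>] by blast
    qed
    show "(INF u \<in> {u \<in> test_functions \<Omega>. \<exists>x. u x \<noteq> 0}. ereal (
          (dirichlet_energy \<Omega> u
             - (real CARD('n))\<^sup>2 / 4 * (LINT x:\<Omega>|lborel. (u x)\<^sup>2 / (norm x)\<^sup>2))
          / hardy_term \<Omega> D 1 u)) = ereal (1 / 4)"
      using sharp[of 1] by simp
    show "(INF u \<in> {u \<in> test_functions \<Omega>. \<exists>x. u x \<noteq> 0}. ereal (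
          (dirichlet_energy \<Omega> u
             - (real CARD('n))\<^sup>2 / 4 * (LINT x:\<Omega>|lborel. (u x)\<^sup>2 / (norm x)\<^sup>2)
             - 1 / 4 * (\<Sum>i = 1..m - 1. hardy_term \<Omega> D i u))
          / hardy_term \<Omega> D m u)) = ereal (1 / 4)" if "m \<ge> 2" for m
      using sharp[of m] that by simp
  qed
qed

end
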